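(* Let $\mathbb{G}$ be a compact quantum group and let $\alpha$ be a unitary representation of $\mathbb{G}$ on a Hilbert space $\mathscr{H}$ of finite dimension $d$. Suppose that there is an integer $N\in\mathbb{N}$ such that $\alpha^N$ is contained in $\alpha^{N+1}$. Then: (1) there is an isometry $\nu\in\mathscr{H}^{N+1}(\mathscr{H}^* )^N\cap\mathcal{O}^{\alpha}$ (i.e. $\nu^*\nu=1$); (2) $\mathcal{O}^{\alpha}$ is isomorphic to the Pimsner algebra $\mathcal{O}_E$ generated by the natural $C^*$-correspondence $E=\nu^*\mathcal{F}^{\alpha}$ over $A=\mathcal{F}^{\alpha}$, with right and left actions of $\mathcal{F}^\alpha$ given by multiplication in $\mathcal{O}^{\alpha}$ and inner product $\langle\xi,\eta\rangle=\xi^*\eta$.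
   Context: All tensor products of $C^*$-algebras are minimal. A compact quantum group (CQG) $\mathbb{G}$ is a separable unital $C^*$-algebra $C(\mathbb{G})$ with a unital $*$-homomorphism $\Delta\colon C(\mathbb{G})\to C(\mathbb{G})\otimes C(\mathbb{G})$ which is coassociative and satisfies the cancellation property (the spans of $\Delta(C(\mathbb G))(C(\mathbb G)\otimes 1)$ and $\Delta(C(\mathbb G))(1\otimes C(\mathbb G))$ are dense in $C(\mathbb G)\otimes C(\mathbb G)$). A (unitary) representation of $\mathbb{G}$ on a Hilbert space $\mathscr{H}$ of finite dimension $d$ with orthonormal basis $(e_i)$ is a matrix $\alpha=(\alpha_{ij})\in M_d(C(\mathbb{G}))$ with $\Delta(\alpha_{ij})=\sum_k\alpha_{ik}\otimes\alpha_{kj}$, $\sum_k\alpha_{ki}^*\alpha_{kj}=\delta_{ij}$ and $\sum_k\alpha_{ik}\alpha_{jk}^*=\delta_{ij}$; it acts by $\delta_\alpha(e_i)=\sum_j e_j\otimes\alpha_{ji}$. The tensor product of $\alpha$ and $\beta$ has coefficients $\alpha_{ij}\beta_{kl}$; $\alpha^\ell$ is the $\ell$-fold tensor power of $\alpha$, with $\alpha^0$ the trivial one-dimensional representation. "$\beta$ is contained in $\gamma$" means $\beta$ is equivalent to a subrepresentation of $\gamma$. The Cuntz algebra $\mathcal{O}_d$ is the universal unital $C^*$-algebra generated by $S_1,\dots,S_d$ with $S_i^*S_j=\delta_{ij}1$, $\sum_jS_jS_j^*=1$. Set $\mathscr{H}^\ell(\mathscr{H}^* )^k=\mathrm{Span}\{S_{i_1}\cdots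 S_{i_\ell}S_{j_1}^*\cdots S_{j_k}^*\}\subseteq\mathcal{O}_d$. The representation $\alpha$ induces an action $\underline{\delta}\colon\mathcal{O}_d\to\mathcal{O}_d\otimes C(\mathbb{G})$ with $\underline{\delta}(S_i)=\sum_jS_j\otimes\alpha_{ji}$; $\mathcal{O}^{\alpha}=\{T\in\mathcal{O}_d:\underline{\delta}(T)=T\otimes1\}$. The gauge action $\gamma$ of $S^1$ on $\mathcal{O}_d$ is $\gamma_z(S_j)=zS_j$; $\mathcal{F}^{\alpha}=\{T\in\mathcal{O}^{\alpha}:\gamma_z(T)=T\ \forall z\in S^1\}$. A $C^*$-correspondence $E$ over a unital $C^*$-algebra $A$ is a right Hilbert $A$-module with a $*$-morphism $\phi$ from $A$ to the adjointable operators on $E$ with $\phi(1_A)=\mathrm{Id}_E$. A frame of $E$ is a finite family $(\xi_i)$ in $E$ with $\sum_i\xi_i\langle\xi_i,\xi\rangle_A=\xi$ for all $\xi\in E$ (for $E=\nu^*\mathcal F^\alpha$, the single element $\nu^*$ is a frame). A compatible representation of $E$ (with frame $(\xi_i)$) on a $C^*$-algebra $B$ is a $*$-homomorphism $\pi\colon A\to B$ and a linear map $t\colon E\to B$ such that (i) $t(\xi)^*t(\eta)=\pi(\langle\xi,\eta\rangle_A)$, (ii) $\pi(a)t(\xi)=t(\phi(a)\xi)$, (iii) $\sum_it(\xi_i)t(\xi_i)^*=\pi(1)$ (independent of the frame). The Pimsner algebra $\mathcal{O}_E$ is the universal $C^*$-algebra generated by compatible representations of $E$: it carries a compatible representation,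 generates it, and any compatible representation $(\pi,t)$ on $B$ factors through a unique $*$-morphism $\mathcal{O}_E\to B$. *)

theory Defs
  imports "HOL-Analysis.Analysis"
begin

section \<open>C*-algebras\<close>

class complex_vector_space = real_vector +
  fixes scaleC :: "complex \<Rightarrow> 'a \<Rightarrow> 'a" (infixr "*\<^sub>C" 75)
  assumes scaleR_scaleC: "r *\<^sub>R x = complex_of_real r *\<^sub>C x"
    and scaleC_add_right: "c *\<^sub>C (x + y) = c *\<^sub>C x + c *\<^sub>C y"
    and scaleC_add_left: "(c + c') *\<^sub>C x = c *\<^sub>C x + c' *\<^sub>C x"
    and scaleC_scaleC: "c *\<^sub>C c' *\<^sub>C x = (c * c') *\<^sub>C x"

lemma scaleC_one: "1 *\<^sub>C x = (x :: 'a::complex_vector_space)"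
  using scaleR_scaleC[of 1 x] by simp

global_interpretation complex_vector: vector_space
    "scaleC :: complex \<Rightarrow> 'a \<Rightarrow> 'a::complex_vector_space"
  defines cspan = complex_vector.span
    and csubspace = complex_vector.subspace
    and cdependent = complex_vector.dependent
  by unfold_locales
    (simp_all add: scaleC_add_right scaleC_add_left scaleC_scaleC scaleC_one)

class cstar_algebra = complex_vector_space + real_normed_algebra + banach +
  fixes star :: "'a \<Rightarrow> 'a"
  assumes scaleC_mult_left: "(c *\<^sub>C x) * y = c *\<^sub>C (x * y)"
    and scaleC_mult_right: "x * (c *\<^sub>C y) = c *\<^sub>C (x * y)"
    and norm_scaleC: "norm (c *\<^sub>C x) = cmod c * norm x"
    and star_star: "star (star x) = x"
    and star_add: "star (x + y) = star x + star y"
    and star_scaleC: "star (c *\<^sub>C x) = cnj c *\<^sub>C star x"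
    and star_mult: "star (x * y) = star y * star x"
    and cstar_identity: "norm (star x * x) = (norm x)\<^sup>2"

text \<open>The zero algebra counts as unital, so that the universal unital algebra on
  the Cuntz relations also exists for \<open>d = 0\<close>.  This is why \<^class>\<open>ring_1\<close> is not used.\<close>

class unital_cstar_algebra = cstar_algebra + monoid_mult

definition star_subalgebra :: "'a::cstar_algebra set \<Rightarrow> bool" where
  "star_subalgebra A \<longleftrightarrow> csubspace A \<and> (\<forall>x\<in>A. \<forall>y\<in>A. x * y \<in> A) \<and> (\<forall>x\<in>A. star x \<in> A)"

definition cstar_subalgebra :: "'a::cstar_algebra set \<Rightarrow> bool" where
  "cstar_subalgebra A \<longleftrightarrow> star_subalgebra A \<and> closed A"

definition cstar_generated :: "'a::cstar_algebra set \<Rightarrow> 'a set" where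
  "cstar_generated X = \<Inter>{A. cstar_subalgebra A \<and> X \<subseteq> A}"

definition star_hom_on :: "'a::cstar_algebra set \<Rightarrow> ('a \<Rightarrow> 'b::cstar_algebra) \<Rightarrow> bool" where
  "star_hom_on A f \<longleftrightarrow>
     (\<forall>x\<in>A. \<forall>y\<in>A. f (x + y) = f x + f y \<and> f (x * y) = f x * f y) \<and>
     (\<forall>c. \<forall>x\<in>A. f (c *\<^sub>C x) = c *\<^sub>C f x) \<and>
     (\<forall>x\<in>A. f (star x) = star (f x))"

definition unital_star_hom :: "('a::unital_cstar_algebra \<Rightarrow> 'b::unital_cstar_algebra) \<Rightarrow> bool" where
  "unital_star_hom f \<longleftrightarrow> star_hom_on UNIV f \<and> f 1 = 1"

definition cstar_isomorphic :: "'a::cstar_algebra set \<Rightarrow> 'b::cstar_algebra set \<Rightarrow> bool" where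
  "cstar_isomorphic A B \<longleftrightarrow> (\<exists>f. star_hom_on A f \<and> bij_betw f A B)"

section \<open>Minimal tensor products\<close>

definition cstar_norm_on :: "'a::cstar_algebra set \<Rightarrow> ('a \<Rightarrow> real) \<Rightarrow> bool" where
  "cstar_norm_on D p \<longleftrightarrow>
     (\<forall>x\<in>D. \<forall>y\<in>D. p (x + y) \<le> p x + p y \<and> p (x * y) \<le> p x * p y) \<and>
     (\<forall>c. \<forall>x\<in>D. p (c *\<^sub>C x) = cmod c * p x) \<and>
     (\<forall>x\<in>D. p (star x * x) = (p x)\<^sup>2) \<and>
     (\<forall>x\<in>D. p x = 0 \<longrightarrow> x = 0)"

text \<open>\<open>min_tensor_product m\<close>: the type \<open>'t\<close>, with \<open>m a b\<close> in the role of the elementary tensor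
  of \<open>a\<close> and \<open>b\<close>, is the minimal tensor product of \<open>'a\<close> and \<open>'b\<close>.  The first three conditions
  make the canonical map from the algebraic tensor product to \<open>'t\<close> a *-homomorphism, the fourth
  one makes it injective, so that its image \<open>cspan (range (\<lambda>(a, b). m a b))\<close> is a copy of the
  algebraic tensor product.  The last two say that \<open>'t\<close> is its completion for the least
  C*-norm, which by Takesaki's theorem is the spatial norm.\<close>

definition min_tensor_product ::
    "('a::cstar_algebra \<Rightarrow> 'b::cstar_algebra \<Rightarrow> 't::cstar_algebra) \<Rightarrow> bool" where
  "min_tensor_product m \<longleftrightarrow>
     (\<forall>a a' b b'. m (a + a') b = m a b + m a' b \<and> m a (b + b') = m a b + m a b') \<and>
     (\<forall>c a b. m (c *\<^sub>C a) b = c *\<^sub>C m a b \<and> m a (c *\<^sub>C b) = c *\<^sub>C m a b) \<and>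
     (\<forall>a a' b b'. m a b * m a' b' = m (a * a') (b * b') \<and> star (m a b) = m (star a) (star b)) \<and>
     (\<forall>F b. finite F \<longrightarrow> \<not> cdependent F \<longrightarrow> (\<Sum>a\<in>F. m a (b a)) = 0 \<longrightarrow> (\<forall>a\<in>F. b a = 0)) \<and>
     closure (cspan (range (\<lambda>(a, b). m a b))) = UNIV \<and>
     (\<forall>p. cstar_norm_on (cspan (range (\<lambda>(a, b). m a b))) p \<longrightarrow>
        (\<forall>x\<in>cspan (range (\<lambda>(a, b). m a b)). norm x \<le> p x))"

section \<open>Compact quantum groups and their representations\<close>

text \<open>\<open>'g\<close> is the algebra of the quantum group, \<open>'gg\<close> its tensor square and \<open>'ggg\<close> its tensor
  cube, presented both as \<open>'gg\<close> tensor \<open>'g\<close> and as \<open>'g\<close> tensor \<open>'gg\<close>.  In \<open>coassoc\<close>, \<open>D1\<close> and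
  \<open>D2\<close> are \<open>\<Delta>\<close> tensor \<open>id\<close> and \<open>id\<close> tensor \<open>\<Delta>\<close>; they are determined by their values
  on elementary tensors, since *-homomorphisms of C*-algebras are continuous.\<close>

locale compact_quantum_group =
  fixes tens :: "'g::unital_cstar_algebra \<Rightarrow> 'g \<Rightarrow> 'gg::unital_cstar_algebra"
    and tensL :: "'gg \<Rightarrow> 'g \<Rightarrow> 'ggg::unital_cstar_algebra"
    and tensR :: "'g \<Rightarrow> 'gg \<Rightarrow> 'ggg"
    and \<Delta> :: "'g \<Rightarrow> 'gg"
  assumes tens: "min_tensor_product tens"
    and tensL: "min_tensor_product tensL"
    and tensR: "min_tensor_product tensR"
    and tens_assoc: "tensL (tens a b) c = tensR a (tens b c)"
    and separable: "\<exists>D :: 'g set. countable D \<and> closure D = UNIV"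
    and hom: "unital_star_hom \<Delta>"
    and coassoc: "\<exists>D1 D2. unital_star_hom D1 \<and> unital_star_hom D2 \<and>
      (\<forall>a b. D1 (tens a b) = tensL (\<Delta> a) b) \<and> (\<forall>a b. D2 (tens a b) = tensR a (\<Delta> b)) \<and>
      (\<forall>a. D1 (\<Delta> a) = D2 (\<Delta> a))"
    and cancel_left: "closure (cspan {\<Delta> a * tens b 1 |a b. True}) = UNIV"
    and cancel_right: "closure (cspan {\<Delta> a * tens 1 b |a b. True}) = UNIV"

text \<open>Representations are coefficient matrices with respect to an orthonormal basis indexed by a
  finite set \<open>I\<close>.\<close>

definition unitary_rep ::
    "('g::unital_cstar_algebra \<Rightarrow> 'g \<Rightarrow> 'gg::unital_cstar_algebra) \<Rightarrow> ('g \<Rightarrow> 'gg) \<Rightarrow>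
     'i set \<Rightarrow> ('i \<Rightarrow> 'i \<Rightarrow> 'g) \<Rightarrow> bool" where
  "unitary_rep tens \<Delta> I \<alpha> \<longleftrightarrow> finite I \<and> (\<forall>i\<in>I. \<forall>j\<in>I.
     \<Delta> (\<alpha> i j) = (\<Sum>k\<in>I. tens (\<alpha> i k) (\<alpha> k j)) \<and>
     (\<Sum>k\<in>I. star (\<alpha> k i) * \<alpha> k j) = (if i = j then 1 else 0) \<and>
     (\<Sum>k\<in>I. \<alpha> i k * star (\<alpha> j k)) = (if i = j then 1 else 0))"

text \<open>The basis of the \<open>n\<close>-fold tensor power of a \<open>d\<close>-dimensional space is indexed by the words of
  length \<open>n\<close> over \<open>{..<d}\<close>.\<close>

definition words :: "nat \<Rightarrow> nat \<Rightarrow> nat list set" where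
  "words d n = {w. length w = n \<and> set w \<subseteq> {..<d}}"

definition rep_power :: "(nat \<Rightarrow> nat \<Rightarrow> 'g::unital_cstar_algebra) \<Rightarrow> nat list \<Rightarrow> nat list \<Rightarrow> 'g" where
  "rep_power \<alpha> v w = prod_list (map2 \<alpha> v w)"

text \<open>The columns of \<open>F\<close> are an orthonormal basis \<open>f\<^sub>m = (\<Sum>i\<in>I. F i m e\<^sub>i)\<close>, \<open>m \<in> M\<close>, of an
  invariant subspace, and \<open>\<sigma>\<close> is the matrix of the restriction of \<open>\<gamma>\<close> in this basis: the
  coaction of \<open>\<gamma>\<close> sends \<open>f\<^sub>n\<close> to the sum over \<open>m \<in> M\<close> of \<open>f\<^sub>m\<close> tensor \<open>\<sigma> m n\<close>.\<close>

definition subrepresentation ::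
    "'i set \<Rightarrow> ('i \<Rightarrow> 'i \<Rightarrow> 'g::unital_cstar_algebra) \<Rightarrow> 'm set \<Rightarrow> ('i \<Rightarrow> 'm \<Rightarrow> complex) \<Rightarrow>
     ('m \<Rightarrow> 'm \<Rightarrow> 'g) \<Rightarrow> bool" where
  "subrepresentation I \<gamma> M F \<sigma> \<longleftrightarrow> finite M \<and>
     (\<forall>m\<in>M. \<forall>n\<in>M. (\<Sum>i\<in>I. cnj (F i m) * F i n) = (if m = n then 1 else 0)) \<and>
     (\<forall>i\<in>I. \<forall>n\<in>M. (\<Sum>j\<in>I. F j n *\<^sub>C \<gamma> i j) = (\<Sum>m\<in>M. F i m *\<^sub>C \<sigma> m n))"

definition equivalent_reps ::
    "'j set \<Rightarrow> ('j \<Rightarrow> 'j \<Rightarrow> 'g::unital_cstar_algebra) \<Rightarrow> 'm set \<Rightarrow> ('m \<Rightarrow> 'm \<Rightarrow> 'g) \<Rightarrow> bool" where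
  "equivalent_reps J \<beta> M \<sigma> \<longleftrightarrow> (\<exists>U V.
     (\<forall>m\<in>M. \<forall>n\<in>M. (\<Sum>j\<in>J. U m j * V j n) = (if m = n then 1 else 0 :: complex)) \<and>
     (\<forall>j\<in>J. \<forall>k\<in>J. (\<Sum>m\<in>M. V j m * U m k) = (if j = k then 1 else 0)) \<and>
     (\<forall>m\<in>M. \<forall>j\<in>J. (\<Sum>k\<in>J. U m k *\<^sub>C \<beta> k j) = (\<Sum>n\<in>M. U n j *\<^sub>C \<sigma> m n)))"

definition contained_in ::
    "'j set \<Rightarrow> ('j \<Rightarrow> 'j \<Rightarrow> 'g::unital_cstar_algebra) \<Rightarrow> 'i set \<Rightarrow> ('i \<Rightarrow> 'i \<Rightarrow> 'g) \<Rightarrow> bool" where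
  "contained_in J \<beta> I \<gamma> \<longleftrightarrow>
     (\<exists>(M :: nat set) F \<sigma>. subrepresentation I \<gamma> M F \<sigma> \<and> equivalent_reps J \<beta> M \<sigma>)"

section \<open>Cuntz algebras\<close>

definition cuntz_family :: "nat \<Rightarrow> (nat \<Rightarrow> 'o::unital_cstar_algebra) \<Rightarrow> bool" where
  "cuntz_family d S \<longleftrightarrow>
     (\<forall>i<d. \<forall>j<d. star (S i) * S j = (if i = j then 1 else 0)) \<and>
     (\<Sum>j<d. S j * star (S j)) = 1"

text \<open>\<open>cuntz_algebra TYPE('b) d S\<close>: the type \<open>'o\<close> is generated by \<open>S 0, \<dots>, S (d - 1)\<close> and has the
  universal property of the Cuntz algebra with respect to the unital C*-algebra \<open>'b\<close>.
  The Cuntz algebra has it for every \<open>'b\<close>; since a hypothesis can only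
  mention fixed types, it is assumed for the targets of the gauge action and of the action of
  the quantum group, which is weaker.\<close>

definition cuntz_algebra ::
    "'b::unital_cstar_algebra itself \<Rightarrow> nat \<Rightarrow> (nat \<Rightarrow> 'o::unital_cstar_algebra) \<Rightarrow> bool" where
  "cuntz_algebra _ d S \<longleftrightarrow>
     cuntz_family d S \<and> cstar_generated (S ` {..<d}) = UNIV \<and>
     (\<forall>T :: nat \<Rightarrow> 'b. cuntz_family d T \<longrightarrow>
        (\<exists>!\<phi>. unital_star_hom \<phi> \<and> (\<forall>i<d. \<phi> (S i) = T i)))"

definition cuntz_bimodule :: "nat \<Rightarrow> (nat \<Rightarrow> 'o::unital_cstar_algebra) \<Rightarrow> nat \<Rightarrow> nat \<Rightarrow> 'o set" where
  "cuntz_bimodule d S l k =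
     cspan {prod_list (map S v) * prod_list (map (\<lambda>j. star (S j)) w) |v w.
            v \<in> words d l \<and> w \<in> words d k}"

definition cuntz_action ::
    "('o::unital_cstar_algebra \<Rightarrow> 'g::unital_cstar_algebra \<Rightarrow> 'og::unital_cstar_algebra) \<Rightarrow>
     nat \<Rightarrow> (nat \<Rightarrow> 'o) \<Rightarrow> (nat \<Rightarrow> nat \<Rightarrow> 'g) \<Rightarrow> 'o \<Rightarrow> 'og" where
  "cuntz_action m d S \<alpha> =
     (THE \<delta>. unital_star_hom \<delta> \<and> (\<forall>i<d. \<delta> (S i) = (\<Sum>j<d. m (S j) (\<alpha> j i))))"

definition gauge_action :: "nat \<Rightarrow> (nat \<Rightarrow> 'o::unital_cstar_algebra) \<Rightarrow> complex \<Rightarrow> 'o \<Rightarrow> 'o" where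
  "gauge_action d S z = (THE g. unital_star_hom g \<and> (\<forall>j<d. g (S j) = z *\<^sub>C S j))"

definition fixed_algebra ::
    "('o::unital_cstar_algebra \<Rightarrow> 'g::unital_cstar_algebra \<Rightarrow> 'og::unital_cstar_algebra) \<Rightarrow>
     nat \<Rightarrow> (nat \<Rightarrow> 'o) \<Rightarrow> (nat \<Rightarrow> nat \<Rightarrow> 'g) \<Rightarrow> 'o set" where
  "fixed_algebra m d S \<alpha> = {T. cuntz_action m d S \<alpha> T = m T 1}"

definition gauge_fixed_algebra ::
    "('o::unital_cstar_algebra \<Rightarrow> 'g::unital_cstar_algebra \<Rightarrow> 'og::unital_cstar_algebra) \<Rightarrow>
     nat \<Rightarrow> (nat \<Rightarrow> 'o) \<Rightarrow> (nat \<Rightarrow> nat \<Rightarrow> 'g) \<Rightarrow> 'o set" where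
  "gauge_fixed_algebra m d S \<alpha> =
     {T \<in> fixed_algebra m d S \<alpha>. \<forall>z. cmod z = 1 \<longrightarrow> gauge_action d S z T = T}"

section \<open>Correspondences and Pimsner algebras\<close>

record ('a, 'e) correspondence =
  coeffs :: "'a set"
  vectors :: "'e set"
  right_act :: "'e \<Rightarrow> 'a \<Rightarrow> 'e"
  inner_prod :: "'e \<Rightarrow> 'e \<Rightarrow> 'a"
  left_act :: "'a \<Rightarrow> 'e \<Rightarrow> 'e"

text \<open>The adjoint of \<open>left_act E a\<close> is \<open>left_act E (star a)\<close>; an operator with an adjoint
  is automatically linear over the coefficient algebra.\<close>

definition cstar_correspondence ::
    "('a::unital_cstar_algebra, 'e::complex_vector_space) correspondence \<Rightarrow> bool" where
  "cstar_correspondence E \<longleftrightarrow>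
    (let A = coeffs E; X = vectors E; r = right_act E; ip = inner_prod E; l = left_act E in
      cstar_subalgebra A \<and> 1 \<in> A \<and> csubspace X \<and>
      \<comment> \<open>right module\<close>
      (\<forall>\<xi>\<in>X. \<forall>a\<in>A. r \<xi> a \<in> X) \<and>
      (\<forall>\<xi>\<in>X. \<forall>\<eta>\<in>X. \<forall>a\<in>A. r (\<xi> + \<eta>) a = r \<xi> a + r \<eta> a) \<and>
      (\<forall>\<xi>\<in>X. \<forall>a\<in>A. \<forall>b\<in>A. r \<xi> (a + b) = r \<xi> a + r \<xi> b \<and> r \<xi> (a * b) = r (r \<xi> a) b) \<and>
      (\<forall>c. \<forall>\<xi>\<in>X. \<forall>a\<in>A. r (c *\<^sub>C \<xi>) a = c *\<^sub>C r \<xi> a \<and> r \<xi> (c *\<^sub>C a) = c *\<^sub>C r \<xi> a) \<and>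
      (\<forall>\<xi>\<in>X. r \<xi> 1 = \<xi>) \<and>
      \<comment> \<open>inner product\<close>
      (\<forall>\<xi>\<in>X. \<forall>\<eta>\<in>X. ip \<xi> \<eta> \<in> A \<and> star (ip \<xi> \<eta>) = ip \<eta> \<xi>) \<and>
      (\<forall>\<xi>\<in>X. \<forall>\<eta>\<in>X. \<forall>\<zeta>\<in>X. ip \<xi> (\<eta> + \<zeta>) = ip \<xi> \<eta> + ip \<xi> \<zeta>) \<and>
      (\<forall>c. \<forall>\<xi>\<in>X. \<forall>\<eta>\<in>X. ip \<xi> (c *\<^sub>C \<eta>) = c *\<^sub>C ip \<xi> \<eta>) \<and>
      (\<forall>\<xi>\<in>X. \<forall>\<eta>\<in>X. \<forall>a\<in>A. ip \<xi> (r \<eta> a) = ip \<xi> \<eta> * a) \<and>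
      (\<forall>\<xi>\<in>X. \<exists>a\<in>A. ip \<xi> \<xi> = star a * a) \<and>
      (\<forall>\<xi>\<in>X. ip \<xi> \<xi> = 0 \<longrightarrow> \<xi> = 0) \<and>
      \<comment> \<open>completeness\<close>
      (\<forall>x. (\<forall>n. x n \<in> X) \<longrightarrow>
         (\<forall>e>0. \<exists>k::nat. \<forall>m\<ge>k. \<forall>n\<ge>k. sqrt (norm (ip (x m - x n) (x m - x n))) < e) \<longrightarrow>
         (\<exists>\<xi>\<in>X. (\<lambda>n. sqrt (norm (ip (x n - \<xi>) (x n - \<xi>)))) \<longlonglongrightarrow> 0)) \<and>
      \<comment> \<open>left action\<close>
      (\<forall>a\<in>A. \<forall>\<xi>\<in>X. l a \<xi> \<in> X) \<and>
      (\<forall>a\<in>A. \<forall>\<xi>\<in>X. \<forall>\<eta>\<in>X. ip (l a \<xi>) \<eta> = ip \<xi> (l (star a) \<eta>)) \<and>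
      (\<forall>a\<in>A. \<forall>b\<in>A. \<forall>\<xi>\<in>X. l (a + b) \<xi> = l a \<xi> + l b \<xi> \<and> l (a * b) \<xi> = l a (l b \<xi>)) \<and>
      (\<forall>c. \<forall>a\<in>A. \<forall>\<xi>\<in>X. l (c *\<^sub>C a) \<xi> = c *\<^sub>C l a \<xi>) \<and>
      (\<forall>\<xi>\<in>X. l 1 \<xi> = \<xi>))"

definition is_frame :: "('a, 'e::complex_vector_space) correspondence \<Rightarrow> 'e list \<Rightarrow> bool" where
  "is_frame E fs \<longleftrightarrow> set fs \<subseteq> vectors E \<and>
     (\<forall>\<xi>\<in>vectors E. (\<Sum>f\<leftarrow>fs. right_act E f (inner_prod E f \<xi>)) = \<xi>)"

definition compatible_rep ::
    "('a::unital_cstar_algebra, 'e::complex_vector_space) correspondence \<Rightarrow> 'e list \<Rightarrow>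
     'b::cstar_algebra set \<Rightarrow> ('a \<Rightarrow> 'b) \<Rightarrow> ('e \<Rightarrow> 'b) \<Rightarrow> bool" where
  "compatible_rep E fs B \<pi> t \<longleftrightarrow>
     \<pi> ` coeffs E \<subseteq> B \<and> star_hom_on (coeffs E) \<pi> \<and>
     t ` vectors E \<subseteq> B \<and>
     (\<forall>\<xi>\<in>vectors E. \<forall>\<eta>\<in>vectors E. t (\<xi> + \<eta>) = t \<xi> + t \<eta>) \<and>
     (\<forall>c. \<forall>\<xi>\<in>vectors E. t (c *\<^sub>C \<xi>) = c *\<^sub>C t \<xi>) \<and>
     (\<forall>\<xi>\<in>vectors E. \<forall>\<eta>\<in>vectors E. star (t \<xi>) * t \<eta> = \<pi> (inner_prod E \<xi> \<eta>)) \<and>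
     (\<forall>a\<in>coeffs E. \<forall>\<xi>\<in>vectors E. \<pi> a * t \<xi> = t (left_act E a \<xi>)) \<and>
     (\<Sum>f\<leftarrow>fs. t f * star (t f)) = \<pi> 1"

text \<open>\<open>pimsner_algebra TYPE('b) E fs P \<pi> t\<close>: the C*-algebra \<open>P\<close> with the compatible representation
  \<open>(\<pi>, t)\<close> has the universal property of the Pimsner algebra of \<open>E\<close> with respect to the
  C*-algebra \<open>'b\<close>, which need not be unital.\<close>

definition pimsner_algebra ::
    "'b::cstar_algebra itself \<Rightarrow>
     ('a::unital_cstar_algebra, 'e::complex_vector_space) correspondence \<Rightarrow> 'e list \<Rightarrow>
     'p::cstar_algebra set \<Rightarrow> ('a \<Rightarrow> 'p) \<Rightarrow> ('e \<Rightarrow> 'p) \<Rightarrow> bool" where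
  "pimsner_algebra _ E fs P \<pi> t \<longleftrightarrow>
     cstar_correspondence E \<and> is_frame E fs \<and>
     cstar_subalgebra P \<and> compatible_rep E fs P \<pi> t \<and>
     cstar_generated (\<pi> ` coeffs E \<union> t ` vectors E) = P \<and>
     (\<forall>\<rho> s. compatible_rep E fs (UNIV :: 'b set) \<rho> s \<longrightarrow>
        (\<exists>!\<phi>. \<phi> \<in> extensional P \<and> star_hom_on P \<phi> \<and>
           (\<forall>a\<in>coeffs E. \<phi> (\<pi> a) = \<rho> a) \<and> (\<forall>\<xi>\<in>vectors E. \<phi> (t \<xi>) = s \<xi>)))"

definition isometry_correspondence ::
    "'o::unital_cstar_algebra set \<Rightarrow> 'o \<Rightarrow> ('o, 'o) correspondence" where
  "isometry_correspondence A \<nu> =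
     \<lparr>coeffs = A, vectors = (\<lambda>T. star \<nu> * T) ` A, right_act = (*),
      inner_prod = (\<lambda>\<xi> \<eta>. star \<xi> * \<eta>), left_act = (*)\<rparr>"

end

theory Submission
  imports Defs
begin

text \<open>An intertwiner from \<open>\<alpha>\<^sup>N\<close> into \<open>\<alpha>\<^bsup>N+1\<^esup>\<close> is an invariant \<open>T \<in> \<H>\<^bsup>N+1\<^esup>(\<H>\<^sup>*)\<^sup>N\<close> with a left
  inverse, and \<open>\<nu> = T (T\<^sup>*T)\<^bsup>-1/2\<^esup>\<close>.  The gauge action preserves \<open>\<O>\<^sup>\<alpha>\<close>, because
  \<open>\<gamma>\<^sub>z \<otimes> id\<close> is isometric for the minimal norm, so Fejer sums show that the spectral subspaces
  of \<open>\<O>\<^sup>\<alpha>\<close> span a dense subalgebra.  An element \<open>x\<close> of degree \<open>m - n\<close> satisfies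
  \<open>x = \<nu>\<^bsup>*n\<^esup> (\<nu>\<^sup>n x \<nu>\<^bsup>*m\<^esup>) \<nu>\<^sup>m\<close> with the bracket in \<open>\<F>\<^sup>\<alpha>\<close>; this dictates the value at \<open>x\<close> of the
  homomorphism induced by a compatible representation.  On a sum of \<open>2n + 1\<close> homogeneous terms
  that homomorphism is bounded by \<open>2n + 1\<close> times the norm, and applying this to the powers of
  \<open>x\<^sup>*x\<close> shows that it is contractive, so it extends to all of \<open>\<O>\<^sup>\<alpha>\<close>.\<close>

section \<open>*-homomorphisms are contractive\<close>

text \<open>Square roots and inverse square roots come from the binomial series of (e - x)^s, which
  converges for norms below 1 and stays in any closed subalgebra with unit e. This is why a strict
  bound on 1 - t T*T has to be derived, by hand, from a left inverse of T. Compatible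
  representations may land in algebras without unit, so units, powers and series are taken relative
  to an idempotent e, typically the image of 1. The tensor product is known only through its least
  C*-norm, so \<gamma>_z \<otimes> id is at hand merely on finite sums of elementary tensors; its
  norm bound comes from minimality and reaches the invariant elements by approximation. Integrals
  over the circle are replaced by averages over roots of unity. On homogeneous elements the induced
  homomorphism is contractive by the C*-identity. The obstacle is a sum of them: the target of a
  compatible representation carries no circle action, so no gauge-invariant expectation can bound
  the sum there. Hence the argument with powers.\<close>

lemma star_zero [simp]: "star (0 :: 'a::cstar_algebra) = 0"
  using star_add[of 0 "0::'a"] by simp

lemma star_uminus [simp]: "star (- x) = - star (x :: 'a::cstar_algebra)"
  using star_add[of x "- x"] by (simp add: minus_unique)

lemma star_diff: "star (x - y) = star x - star (y :: 'a::cstar_algebra)"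
  using star_add[of x "- y"] by simp

lemma star_sum: "star (sum f A) = (\<Sum>i\<in>A. star (f i :: 'a::cstar_algebra))"
  by (induction A rule: infinite_finite_induct) (auto simp: star_add)

lemma star_scaleR: "star (r *\<^sub>R x) = r *\<^sub>R star (x :: 'a::cstar_algebra)"
  by (simp add: scaleR_scaleC star_scaleC)

lemma star_one [simp]: "star (1 :: 'a::unital_cstar_algebra) = 1"
  by (metis mult_1_left mult_1_right star_mult star_star)

lemma norm_star [simp]: "norm (star x) = norm (x :: 'a::cstar_algebra)"
proof -
  have le: "norm y \<le> norm (star y)" for y :: 'a
  proof (cases "y = 0")
    case False
    have "norm y * norm y \<le> norm (star y) * norm y"
      using norm_mult_ineq[of "star y" y] by (simp add: cstar_identity power2_eq_square)
    then show ?thesis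
      using False by simp
  qed simp
  show ?thesis
    using le[of x] le[of "star x"] by (simp add: star_star)
qed

lemma star_mult_self_eq_0: "star x * x = 0 \<longleftrightarrow> x = (0 :: 'a::cstar_algebra)"
  by (metis cstar_identity norm_eq_zero power_eq_0_iff mult_zero_right zero_eq_power2)

text \<open>The norm of \<open>1\<close> is idempotent, hence 0 or 1; the value 0 is that of the
  zero algebra, which the class admits.\<close>

lemma norm_one_le: "norm (1 :: 'a::unital_cstar_algebra) \<le> 1"
proof -
  have "norm (1::'a) = (norm (1::'a))\<^sup>2"
    using cstar_identity[of "1::'a"] by simp
  then show ?thesis
    by (metis power2_eq_square mult_cancel_right1 order_refl zero_le_one)
qed

lemma norm_isometry_le:
  assumes "star x * x = (1 :: 'a::unital_cstar_algebra)"
  shows "norm x \<le> 1"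
  using cstar_identity[of x] norm_one_le[where 'a='a] assms
  by (metis norm_ge_zero power2_le_imp_le one_power2 zero_le_one)

lemma bounded_linear_star: "bounded_linear (star :: 'a::cstar_algebra \<Rightarrow> 'a)"
  by (rule bounded_linear_intro[where K=1]) (auto simp: star_add star_scaleR)

lemma bounded_linear_scaleC: "bounded_linear (\<lambda>x :: 'a::cstar_algebra. c *\<^sub>C x)"
  by (rule bounded_linear_intro[where K="cmod c"])
    (auto simp: scaleC_add_right scaleR_scaleC scaleC_scaleC mult.commute norm_scaleC)

lemmas tendsto_star [tendsto_intros] = bounded_linear.tendsto[OF bounded_linear_star]
lemmas tendsto_scaleC [tendsto_intros] = bounded_linear.tendsto[OF bounded_linear_scaleC]
lemmas continuous_on_scaleC [continuous_intros] =
  bounded_linear.continuous_on[OF bounded_linear_scaleC]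

lemma csubspace_scaleR: "csubspace A \<Longrightarrow> x \<in> A \<Longrightarrow> r *\<^sub>R x \<in> A"
  by (simp add: scaleR_scaleC complex_vector.subspace_scale)

text \<open>An epsilon/3 argument: the maps \<open>L n\<close> are uniformly contractive, so
  convergence to the identity need only be tested on a dense set. It is meant for the Fejer
  means.\<close>

lemma closed_tendsto_id:
  fixes L :: "nat \<Rightarrow> 'a::cstar_algebra \<Rightarrow> 'a"
  assumes "\<And>n x y. L n (x - y) = L n x - L n y" "\<And>n x. norm (L n x) \<le> norm x"
  shows "closed {x. (\<lambda>n. L n x) \<longlonglongrightarrow> x}"
  unfolding closed_sequential_limits
proof (intro allI impI, elim conjE)
  fix X x assume X: "\<forall>i. X i \<in> {x. (\<lambda>n. L n x) \<longlonglongrightarrow> x}" "X \<longlonglongrightarrow> x"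
  show "x \<in> {x. (\<lambda>n. L n x) \<longlonglongrightarrow> x}"
  proof (safe, rule LIMSEQ_I)
    fix r :: real assume "r > 0"
    then obtain i where i: "norm (X i - x) < r / 3"
      using LIMSEQ_D[OF X(2), of "r / 3"] by auto
    obtain n0 where n0: "\<And>n. n \<ge> n0 \<Longrightarrow> norm (L n (X i) - X i) < r / 3"
      using X(1) LIMSEQ_D[of "\<lambda>n. L n (X i)" "X i" "r / 3"] \<open>r > 0\<close> by auto
    have "norm (L n x - x) < r" if "n \<ge> n0" for n
    proof -
      have "L n x - x = (L n (X i) - X i) + (X i - x) - L n (X i - x)"
        by (simp add: assms(1))
      also have "norm \<dots> \<le> norm (L n (X i) - X i) + norm (X i - x) + norm (X i - x)"
        using norm_triangle_ineq4[of "(L n (X i) - X i) + (X i - x)" "L n (X i - x)"]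
          norm_triangle_ineq[of "L n (X i) - X i" "X i - x"] assms(2)[of n "X i - x"] by simp
      finally show ?thesis
        using n0[OF that] i by simp
    qed
    then show "\<exists>n0. \<forall>n\<ge>n0. norm (L n x - x) < r"
      by blast
  qed
qed

text \<open>A unit of \<open>A\<close> in an ambient algebra that may have another unit or none. The
  image of \<open>1\<close> under a nonunital homomorphism is such a unit for the image.\<close>

definition local_unit :: "'a::cstar_algebra \<Rightarrow> 'a set \<Rightarrow> bool" where
  "local_unit e A \<longleftrightarrow> e \<in> A \<and> (\<forall>x\<in>A. e * x = x \<and> x * e = x)"

lemma local_unit_star: 
  assumes "local_unit e A" "star_subalgebra A" 
  shows "star e = e"
proof -
  have "star e \<in> A"
    using assms by (auto simp: local_unit_def star_subalgebra_def)
  then have "e * star e = star e"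
    using assms by (auto simp: local_unit_def)
  then show ?thesis
    by (metis star_mult star_star)
qed

lemma local_unit_one: "1 \<in> A \<Longrightarrow> local_unit (1 :: 'a::unital_cstar_algebra) A"
  by (auto simp: local_unit_def)

text \<open>Powers with \<open>e\<close> as the zeroth power, since the type has no
  \<open>1\<close>.\<close>

primrec unit_power :: "'a::cstar_algebra \<Rightarrow> 'a \<Rightarrow> nat \<Rightarrow> 'a" where
  "unit_power e x 0 = e"
| "unit_power e x (Suc n) = x * unit_power e x n"

text \<open>For \<open>norm x < 1\<close> this is the real power \<open>s\<close> of
  \<open>e - x\<close>. The exponents 1/2 and -1/2 replace the continuous functional
  calculus.\<close>

definition binom_series :: "'a::cstar_algebra \<Rightarrow> real \<Rightarrow> 'a \<Rightarrow> 'a" where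
  "binom_series e s x = (\<Sum>n. ((s gchoose n) * (-1) ^ n) *\<^sub>R unit_power e x n)"

context
  fixes A :: "'a::cstar_algebra set" and e :: 'a
  assumes A: "cstar_subalgebra A" and e: "local_unit e A"
begin

lemma unit_power_mem: "x \<in> A \<Longrightarrow> unit_power e x n \<in> A"
  using A e by (induction n) (auto simp: cstar_subalgebra_def star_subalgebra_def local_unit_def)

lemma unit_power_add:
  "x \<in> A \<Longrightarrow> unit_power e x (m + n) = unit_power e x m * unit_power e x n"
proof (induction m)
  case 0
  have "e * unit_power e x n = unit_power e x n"
    using e unit_power_mem[OF 0] unfolding local_unit_def by blast
  then show ?case
    by simp
next
  case (Suc m)
  have "unit_power e x (Suc m + n) = x * (unit_power e x m * unit_power e x n)"
    using Suc by simp
  then show ?case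
    by (simp only: mult.assoc unit_power.simps)
qed

lemma norm_unit_power: "norm (unit_power e x n) \<le> norm x ^ n * norm e"
proof (induction n)
  case (Suc n)
  have "norm (unit_power e x (Suc n)) \<le> norm x * norm (unit_power e x n)"
    by (simp add: norm_mult_ineq)
  also have "\<dots> \<le> norm x * (norm x ^ n * norm e)"
    by (intro mult_left_mono Suc) auto
  finally show ?case
    by (simp add: mult.assoc)
qed simp

lemma summable_binom_series:
  assumes "norm x < 1"
  shows "summable (\<lambda>n. norm (((s gchoose n) * (-1) ^ n) *\<^sub>R unit_power e x n))"
proof -
  have "ereal (norm (norm x)) < conv_radius (\<lambda>n. s gchoose n)"
    using assms by (simp add: conv_radius_gchoose)
  then have "summable (\<lambda>n. norm ((s gchoose n) * norm x ^ n))"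
    by (rule abs_summable_in_conv_radius)
  then have *: "summable (\<lambda>n. norm ((s gchoose n) * norm x ^ n) * norm e)"
    by (rule summable_mult2)
  show ?thesis
    by (rule summable_comparison_test'[OF *, where N=0])
      (use norm_unit_power in \<open>auto simp: abs_mult mult.assoc power_abs intro!: mult_left_mono\<close>)
qed

lemma binom_series_sums:
  assumes "norm x < 1"
  shows "(\<lambda>n. ((s gchoose n) * (-1) ^ n) *\<^sub>R unit_power e x n) sums binom_series e s x"
  unfolding binom_series_def
  using summable_norm_cancel[OF summable_binom_series[OF assms]] by (rule summable_sums)

lemma binom_series_mem:
  assumes "norm x < 1" "x \<in> A"
  shows "binom_series e s x \<in> A"
proof -
  have sub: "csubspace A" and cl: "closed A"
    using A by (auto simp: cstar_subalgebra_def star_subalgebra_def)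
  have "(\<lambda>n. \<Sum>i<n. ((s gchoose i) * (-1) ^ i) *\<^sub>R unit_power e x i) \<longlonglongrightarrow> binom_series e s x"
    using binom_series_sums[OF assms(1)] by (simp add: sums_def)
  moreover have "(\<Sum>i<n. ((s gchoose i) * (-1) ^ i) *\<^sub>R unit_power e x i) \<in> A" for n
    by (intro complex_vector.subspace_sum[OF sub] csubspace_scaleR[OF sub] unit_power_mem assms)
  ultimately show ?thesis
    by (rule closed_sequentially[OF cl, rotated])
qed

text \<open>Exponents add: the coefficients of the Cauchy product are given by Vandermonde's
  identity, and the signs multiply to \<open>(-1) ^ k\<close>.\<close>

lemma binom_series_add:
  assumes "norm x < 1" "x \<in> A"
  shows "binom_series e s x * binom_series e t x = binom_series e (s + t) x"
proof -
  let ?c = "\<lambda>s n. (s gchoose n) * (-1) ^ n"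
  have "binom_series e s x * binom_series e t x
      = (\<Sum>k. \<Sum>i\<le>k. (?c s i *\<^sub>R unit_power e x i) * (?c t (k - i) *\<^sub>R unit_power e x (k - i)))"
    unfolding binom_series_def
    by (rule Cauchy_product[OF summable_binom_series[OF assms(1)] summable_binom_series[OF assms(1)]])
  also have "\<dots> = binom_series e (s + t) x"
    unfolding binom_series_def
  proof (intro suminf_cong)
    fix k
    have "(\<Sum>i\<le>k. (?c s i *\<^sub>R unit_power e x i) * (?c t (k - i) *\<^sub>R unit_power e x (k - i)))
        = (\<Sum>i\<in>{0..k}. ((s gchoose i) * (t gchoose (k - i)) * (-1) ^ k) *\<^sub>R unit_power e x k)"
    proof (intro sum.cong)
      fix i assume "i \<in> {0..k}"
      then have "unit_power e x i * unit_power e x (k - i) = unit_power e x k"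
        "(-1 :: real) ^ i * (-1) ^ (k - i) = (-1) ^ k"
        using unit_power_add[OF assms(2), of i "k - i"] power_add[of "-1::real" i "k - i"] by auto
      then show "(?c s i *\<^sub>R unit_power e x i) * (?c t (k - i) *\<^sub>R unit_power e x (k - i))
          = ((s gchoose i) * (t gchoose (k - i)) * (-1) ^ k) *\<^sub>R unit_power e x k"
        by (simp add: mult.commute[of "(-1) ^ (k - i)"] mult.assoc mult.left_commute[of "(-1) ^ i" "t gchoose (k - i)"])
    qed auto
    also have "\<dots> = ?c (s + t) k *\<^sub>R unit_power e x k"
      by (simp only: gbinomial_Vandermonde flip: sum_distrib_right scaleR_sum_left)
    finally show "(\<Sum>i\<le>k. (?c s i *\<^sub>R unit_power e x i) * (?c t (k - i) *\<^sub>R unit_power e x (k - i)))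
        = ?c (s + t) k *\<^sub>R unit_power e x k" .
  qed
  finally show ?thesis .
qed

lemma binom_series_0: "binom_series e 0 x = e"
proof -
  have "binom_series e 0 x = (\<Sum>n\<in>{0}. ((0 gchoose n) * (-1) ^ n) *\<^sub>R unit_power e x n)"
    unfolding binom_series_def
    by (rule suminf_finite) (auto simp: gbinomial_0_left)
  then show ?thesis
    by simp
qed

lemma binom_series_1:
  assumes "x \<in> A"
  shows "binom_series e 1 x = e - x"
proof -
  have "(1 :: real) gchoose n = of_nat (1 choose n)" for n
    by (simp add: binomial_gbinomial)
  then have "binom_series e 1 x = (\<Sum>n\<in>{0,1}. ((1 gchoose n) * (-1) ^ n) *\<^sub>R unit_power e x n)"
    unfolding binom_series_def
    by (intro suminf_finite) (auto simp: binomial_eq_0)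
  then show ?thesis
    using assms e by (simp add: local_unit_def)
qed

lemma binom_series_star:
  assumes "norm x < 1" "x \<in> A" "star x = x"
  shows "star (binom_series e s x) = binom_series e s x"
proof -
  have [simp]: "star e = e"
    using local_unit_star[OF e] A by (simp add: cstar_subalgebra_def)
  have comm: "unit_power e x n * x = x * unit_power e x n" for n
    using unit_power_add[OF assms(2), of n 1] unit_power_add[OF assms(2), of 1 n] assms(2) e
    by (auto simp: local_unit_def)
  have [simp]: "star (unit_power e x n) = unit_power e x n" for n
    by (induction n) (auto simp: star_mult assms comm)
  have "(\<lambda>n. star (((s gchoose n) * (-1) ^ n) *\<^sub>R unit_power e x n)) sums star (binom_series e s x)"
    by (rule bounded_linear.sums[OF bounded_linear_star binom_series_sums[OF assms(1)]])
  then show ?thesis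
    using binom_series_sums[OF assms(1)] by (simp add: star_scaleR sums_unique2)
qed

lemma binom_series_commute:
  assumes "norm x < 1" "x \<in> A" "y \<in> A" "x * y = y * x"
  shows "binom_series e s x * y = y * binom_series e s x"
proof -
  have *: "unit_power e x n * y = y * unit_power e x n" for n
  proof (induction n)
    case (Suc n)
    then show ?case
      by (metis assms(4) mult.assoc unit_power.simps(2))
  qed (use e assms in \<open>auto simp: local_unit_def\<close>)
  have "(\<lambda>n. (((s gchoose n) * (-1) ^ n) *\<^sub>R unit_power e x n) * y) sums (binom_series e s x * y)"
    "(\<lambda>n. y * (((s gchoose n) * (-1) ^ n) *\<^sub>R unit_power e x n)) sums (y * binom_series e s x)"
    by (intro sums_mult sums_mult2 binom_series_sums assms)+
  then show ?thesis
    by (simp add: * sums_unique2)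
qed

end

section \<open>Homomorphisms on subalgebras and their automatic continuity\<close>

lemma star_hom_onD:
  assumes "star_hom_on A f"
  shows "x \<in> A \<Longrightarrow> y \<in> A \<Longrightarrow> f (x + y) = f x + f y"
    and "x \<in> A \<Longrightarrow> y \<in> A \<Longrightarrow> f (x * y) = f x * f y"
    and "x \<in> A \<Longrightarrow> f (c *\<^sub>C x) = c *\<^sub>C f x"
    and "x \<in> A \<Longrightarrow> f (star x) = star (f x)"
    and "x \<in> A \<Longrightarrow> f (r *\<^sub>R x) = r *\<^sub>R f x"
  using assms by (auto simp: star_hom_on_def scaleR_scaleC)

lemma star_hom_on_diff:
  assumes "star_hom_on A f" "csubspace A" "x \<in> A" "y \<in> A"
  shows "f (x - y) = f x - f y"
proof -
  have "f (x + (-1) *\<^sub>C y) = f x + (-1) *\<^sub>C f y"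
    using assms by (metis star_hom_onD(1,3) complex_vector.subspace_scale)
  then show ?thesis
    by simp
qed

lemma star_hom_on_0:
  assumes "star_hom_on A f" "csubspace A"
  shows "f 0 = 0"
  using star_hom_on_diff[OF assms, of 0 0] complex_vector.subspace_0[OF assms(2)] by simp

lemma star_hom_on_sum:
  assumes "star_hom_on A f" "csubspace A" "\<And>i. i \<in> I \<Longrightarrow> g i \<in> A"
  shows "f (\<Sum>i\<in>I. g i) = (\<Sum>i\<in>I. f (g i))"
  using assms(3)
proof (induction I rule: infinite_finite_induct)
  case (insert i I)
  then show ?case
    using star_hom_onD(1)[OF assms(1)] complex_vector.subspace_sum[OF assms(2), of I g] by simp
qed (auto simp: star_hom_on_0[OF assms(1,2)])

text \<open>A selfadjoint strict contraction \<open>h\<close> is the real part of the unitary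
  \<open>h + \<i> \<surd>(e - h\<^sup>2)\<close>, and *-homomorphisms map unitaries to partial isometries.\<close>

lemma star_hom_on_contractive:
  assumes A: "cstar_subalgebra A" and e: "local_unit e A" and f: "star_hom_on A f" and x: "x \<in> A"
  shows "norm (f x) \<le> norm x"
proof -
  have sub: "csubspace A" "\<And>x y. x \<in> A \<Longrightarrow> y \<in> A \<Longrightarrow> x * y \<in> A" "\<And>x. x \<in> A \<Longrightarrow> star x \<in> A"
    using A by (auto simp: cstar_subalgebra_def star_subalgebra_def)
  note mem = complex_vector.subspace_add[OF sub(1)] complex_vector.subspace_scale[OF sub(1)] sub
    complex_vector.subspace_diff[OF sub(1)]
  note hom = star_hom_onD[OF f]
  have eA: "e \<in> A" and [simp]: "star e = e"
    using e local_unit_star[OF e] A by (auto simp: local_unit_def cstar_subalgebra_def)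
  \<comment> \<open>\<open>f e\<close> is a selfadjoint idempotent, so its norm is 0 or 1.\<close>
  have "f e * f e = f e" "star (f e) = f e"
    using hom(2,4)[OF eA] hom(2)[OF eA eA] e by (auto simp: local_unit_def)
  then have "norm (f e) = (norm (f e))\<^sup>2"
    using cstar_identity[of "f e"] by simp
  then have fe: "norm (f e) \<le> 1"
    by (metis power2_eq_square mult_cancel_right1 order_refl zero_le_one)
  have *: "norm (f h) \<le> 1" if h: "h \<in> A" "star h = h" "norm h < 1" for h
  proof -
    define k where "k = binom_series e (1 / 2) (h * h)"
    have hh: "norm (h * h) < 1" "h * h \<in> A" "star (h * h) = h * h"
      using h norm_mult_ineq[of h h] mult_strict_mono[of "norm h" 1 "norm h" 1] sub
      by (auto simp: star_mult)
    have k: "k \<in> A" "star k = k" "k * h = h * k"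
      unfolding k_def using binom_series_mem[OF A e hh(1,2)] binom_series_star[OF A e hh]
        binom_series_commute[OF A e hh(1,2) h(1)] by (auto simp: mult.assoc)
    have kk: "k * k = e - h * h"
      unfolding k_def using binom_series_add[OF A e hh(1,2), of "1/2" "1/2"]
        binom_series_1[OF A e hh(2)] by simp
    define u where "u = h + \<i> *\<^sub>C k"
    have u: "u \<in> A"
      unfolding u_def by (intro mem h k)
    have su: "star u = h - \<i> *\<^sub>C k"
      by (simp add: u_def star_add star_scaleC h k)
    have "star u * u = (h - \<i> *\<^sub>C k) * (h + \<i> *\<^sub>C k)"
      unfolding su by (simp only: u_def)
    also have "\<dots> = e"
      by (simp add: algebra_simps scaleC_mult_left scaleC_mult_right scaleC_scaleC kk k)
    finally have "star (f u) * f u = f e"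
      using hom(2)[of "star u" u] hom(4)[OF u] u mem by simp
    then have "(norm (f u))\<^sup>2 \<le> 1"
      using cstar_identity[of "f u"] fe by simp
    then have fu: "norm (f u) \<le> 1"
      by (metis power2_le_imp_le one_power2 zero_le_one)
    have "h = (1/2) *\<^sub>R (u + star u)"
      unfolding su by (simp add: u_def flip: scaleR_2)
    then have "f h = (1/2) *\<^sub>R (f u + star (f u))"
      using u mem hom by metis
    then have "norm (f h) = (1/2) * norm (f u + star (f u))"
      by simp
    also have "\<dots> \<le> (1/2) * (norm (f u) + norm (star (f u)))"
      by (intro mult_left_mono norm_triangle_ineq) auto
    finally show ?thesis
      using fu by simp
  qed
  \<comment> \<open>The square root needs a strict contraction, so \<open>h\<close> is divided by
    slightly more than its norm.\<close>
  have selfadj: "norm (f h) \<le> norm h" if h: "h \<in> A" "star h = h" for h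
  proof (rule field_le_epsilon)
    fix \<epsilon> :: real assume "\<epsilon> > 0"
    define c where "c = norm h + \<epsilon>"
    have c: "c > 0" "norm h < c"
      using \<open>\<epsilon> > 0\<close> by (auto simp: c_def add_nonneg_pos)
    have "norm (f ((1 / c) *\<^sub>R h)) \<le> 1"
      using c h by (intro *) (auto simp: star_scaleR csubspace_scaleR[OF sub(1)])
    then have "norm (f h) / c \<le> 1"
      using hom(5)[OF h(1), of "1 / c"] c by simp
    then show "norm (f h) \<le> norm h + \<epsilon>"
      using c by (simp add: c_def field_simps)
  qed
  have "(norm (f x))\<^sup>2 = norm (f (star x * x))"
    using x sub hom by (simp add: cstar_identity)
  also have "\<dots> \<le> norm (star x * x)"
    by (intro selfadj sub x) (simp add: star_mult star_star)
  finally have "(norm (f x))\<^sup>2 \<le> (norm x)\<^sup>2"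
    by (simp only: cstar_identity)
  then show ?thesis
    by (rule power2_le_imp_le) simp
qed

lemma star_hom_on_tendsto:
  assumes A: "cstar_subalgebra A" and e: "local_unit e A" and f: "star_hom_on A f"
    and X: "\<And>n. X n \<in> A" "X \<longlonglongrightarrow> x"
  shows "(\<lambda>n. f (X n)) \<longlonglongrightarrow> f x"
proof -
  have sub: "csubspace A" and cl: "closed A"
    using A by (auto simp: cstar_subalgebra_def star_subalgebra_def)
  have x: "x \<in> A"
    by (rule closed_sequentially[OF cl _ X(2)]) (use X(1) in simp)
  have "norm (f (X n) - f x) \<le> norm (X n - x)" for n
    using star_hom_on_contractive[OF A e f, of "X n - x"] star_hom_on_diff[OF f sub X(1) x]
      complex_vector.subspace_diff[OF sub X(1) x] by simp
  moreover have "(\<lambda>n. norm (X n - x)) \<longlonglongrightarrow> 0"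
    by (rule tendsto_norm_zero[OF LIM_zero[OF X(2)]])
  ultimately have "(\<lambda>n. f (X n) - f x) \<longlonglongrightarrow> 0"
    by (rule Lim_null_comparison[OF always_eventually[OF allI]])
  then show ?thesis
    by (rule LIM_zero_cancel)
qed

section \<open>Generated subalgebras and agreement on generators\<close>

lemma cstar_subalgebra_UNIV [simp]: "cstar_subalgebra UNIV"
  by (auto simp: cstar_subalgebra_def star_subalgebra_def)

lemma cstar_subalgebra_generated: "cstar_subalgebra (cstar_generated X)"
  unfolding cstar_generated_def cstar_subalgebra_def star_subalgebra_def
  by (auto intro!: closed_Inter complex_vector.subspace_Inter)

lemma cstar_generated_subset:
  "X \<subseteq> cstar_generated X" "cstar_subalgebra A \<Longrightarrow> X \<subseteq> A \<Longrightarrow> cstar_generated X \<subseteq> A"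
  unfolding cstar_generated_def by auto

text \<open>Closedness is the continuity of the two homomorphisms. Agreement on generators therefore
  extends to the C*-algebra they generate.\<close>

lemma cstar_subalgebra_equalizer:
  assumes A: "cstar_subalgebra A" and e: "local_unit e A"
    and f: "star_hom_on A f" and g: "star_hom_on A g"
  shows "cstar_subalgebra {x\<in>A. f x = g x}"
proof -
  have sub: "csubspace A" "\<And>x y. x \<in> A \<Longrightarrow> y \<in> A \<Longrightarrow> x * y \<in> A" "\<And>x. x \<in> A \<Longrightarrow> star x \<in> A"
    and cl: "closed A"
    using A by (auto simp: cstar_subalgebra_def star_subalgebra_def)
  have "csubspace {x\<in>A. f x = g x}"
    using sub(1) star_hom_onD[OF f] star_hom_onD[OF g] star_hom_on_0[OF f sub(1)]
      star_hom_on_0[OF g sub(1)]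
    unfolding complex_vector.subspace_def by auto
  moreover have "closed {x\<in>A. f x = g x}"
    unfolding closed_sequential_limits
  proof (intro allI impI, elim conjE)
    fix X x assume X: "\<forall>n. X n \<in> {x\<in>A. f x = g x}" "X \<longlonglongrightarrow> x"
    then have "(\<lambda>n. f (X n)) \<longlonglongrightarrow> f x" "(\<lambda>n. g (X n)) \<longlonglongrightarrow> g x"
      using star_hom_on_tendsto[OF A e f, of X] star_hom_on_tendsto[OF A e g, of X] by simp_all
    moreover have "(\<lambda>n. f (X n)) = (\<lambda>n. g (X n))"
      using X(1) by auto
    ultimately have "f x = g x"
      using LIMSEQ_unique by metis
    moreover have "x \<in> A"
      by (rule closed_sequentially[OF cl _ X(2)]) (use X(1) in simp)
    ultimately show "x \<in> {x\<in>A. f x = g x}"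
      by simp
  qed
  ultimately show ?thesis
    using sub star_hom_onD[OF f] star_hom_onD[OF g]
    by (auto simp: cstar_subalgebra_def star_subalgebra_def)
qed

lemma star_subalgebra_closure:
  assumes "star_subalgebra A"
  shows "cstar_subalgebra (closure A)"
proof -
  have A: "csubspace A" "\<And>x y. x \<in> A \<Longrightarrow> y \<in> A \<Longrightarrow> x * y \<in> A" "\<And>x. x \<in> A \<Longrightarrow> star x \<in> A"
    using assms by (auto simp: star_subalgebra_def)
  have *: "z \<in> closure A" if "\<And>n. Z n \<in> A" "Z \<longlonglongrightarrow> z" for Z z
    using that by (auto simp: closure_sequential)
  have add: "x + y \<in> closure A" "x * y \<in> closure A" "star x \<in> closure A" "c *\<^sub>C x \<in> closure A"
    if xy: "x \<in> closure A" "y \<in> closure A" for x y c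
  proof -
    obtain X Y where X: "\<And>n. X n \<in> A" "X \<longlonglongrightarrow> x" and Y: "\<And>n. Y n \<in> A" "Y \<longlonglongrightarrow> y"
      using xy by (auto simp: closure_sequential)
    show "x + y \<in> closure A"
      by (rule *[of "\<lambda>n. X n + Y n"]) (intro tendsto_intros X Y complex_vector.subspace_add A)+
    show "x * y \<in> closure A"
      by (rule *[of "\<lambda>n. X n * Y n"]) (intro tendsto_intros X Y A)+
    show "star x \<in> closure A"
      by (rule *[of "\<lambda>n. star (X n)"]) (intro tendsto_intros X A)+
    show "c *\<^sub>C x \<in> closure A"
      by (rule *[of "\<lambda>n. c *\<^sub>C X n"]) (intro tendsto_intros X complex_vector.subspace_scale A)+
  qed
  have "0 \<in> closure A"
    using complex_vector.subspace_0[OF A(1)] closure_subset by auto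
  then show ?thesis
    unfolding cstar_subalgebra_def star_subalgebra_def complex_vector.subspace_def
    using add by auto
qed

section \<open>Spectral subspaces of a circle action\<close>

text \<open>The Cauchy form of the epsilon/3 argument, for limits that are not known in advance;
  completeness of the target provides them.\<close>

lemma closed_convergent:
  fixes L :: "nat \<Rightarrow> 'a::cstar_algebra \<Rightarrow> 'b::cstar_algebra"
  assumes diff: "\<And>n x y. L n (x - y) = L n x - L n y" and le: "\<And>n x. norm (L n x) \<le> norm x"
  shows "closed {x. convergent (\<lambda>n. L n x)}"
  unfolding closed_sequential_limits
proof (intro allI impI, elim conjE)
  fix X x assume X: "\<forall>i. X i \<in> {x. convergent (\<lambda>n. L n x)}" "X \<longlonglongrightarrow> x"
  have "Cauchy (\<lambda>n. L n x)"
  proof (rule CauchyI)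
    fix r :: real assume "r > 0"
    then obtain i where i: "norm (X i - x) < r / 3"
      using LIMSEQ_D[OF X(2), of "r / 3"] by auto
    have "Cauchy (\<lambda>n. L n (X i))"
      using X(1) by (auto intro: convergent_Cauchy)
    from CauchyD[OF this, of "r / 3"] obtain n0
      where n0: "\<And>m n. m \<ge> n0 \<Longrightarrow> n \<ge> n0 \<Longrightarrow> norm (L m (X i) - L n (X i)) < r / 3"
      using \<open>r > 0\<close> by auto
    have "norm (L m x - L n x) < r" if "m \<ge> n0" "n \<ge> n0" for m n
    proof -
      have "L m x - L n x = (L m (X i) - L n (X i)) + L n (X i - x) - L m (X i - x)"
        by (simp add: diff)
      then have "norm (L m x - L n x) \<le> norm (L m (X i) - L n (X i)) + norm (L n (X i - x)) + norm (L m (X i - x))"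
        using norm_triangle_ineq4[of "(L m (X i) - L n (X i)) + L n (X i - x)" "L m (X i - x)"]
          norm_triangle_ineq[of "L m (X i) - L n (X i)" "L n (X i - x)"] by simp
      then show ?thesis
        using n0[OF that] i le[of n "X i - x"] le[of m "X i - x"] by linarith
    qed
    then show "\<exists>n0. \<forall>m\<ge>n0. \<forall>n\<ge>n0. norm (L m x - L n x) < r"
      by blast
  qed
  then show "x \<in> {x. convergent (\<lambda>n. L n x)}"
    by (simp add: Cauchy_convergent)
qed

section \<open>Roots of unity and counting of diagonals\<close>

definition root_unity :: "nat \<Rightarrow> nat \<Rightarrow> complex" where
  "root_unity M j = cis (2 * pi * real j / real M)"

lemma cmod_root_unity [simp]: "cmod (root_unity M j) = 1"
  by (simp add: root_unity_def)

text \<open>A geometric sum whose ratio \<open>q\<close> is an M-th root of unity. The bound on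
  \<open>l\<close> excludes the nonzero multiples of \<open>M\<close>, for which the ratio would be
  1.\<close>

lemma sum_root_unity_powi:
  assumes "\<bar>l\<bar> < int M"
  shows "(\<Sum>j<M. root_unity M j powi l) = (if l = 0 then of_nat M else 0)"
proof (cases "l = 0")
  case False
  have M: "M > 0"
    using assms by simp
  define q where "q = cis (2 * pi * of_int l / real M)"
  have pow: "root_unity M j powi l = q ^ j" for j
  proof -
    have "q ^ j = cis (real j * (2 * pi * of_int l / real M))"
      by (simp only: q_def Complex.DeMoivre)
    moreover have "root_unity M j powi l = cis (of_int l * (2 * pi * real j / real M))"
      by (simp only: root_unity_def cis_power_int)
    ultimately show ?thesis
      by (simp add: mult_ac)
  qed
  have "q \<noteq> 1"
  proof
    assume "q = 1"
    then have "cos (2 * pi * of_int l / real M) = 1"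
      by (simp add: q_def complex_eq_iff)
    then obtain n :: int where n: "2 * pi * of_int l / real M = of_int n * 2 * pi"
      using cos_one_2pi_int by blast
    have "2 * pi * of_int l = 2 * pi * (of_int n * real M)"
      using n M by (simp add: field_simps)
    then have "real_of_int l = real_of_int (n * int M)"
      by simp
    then have "l = n * int M"
      by (simp only: of_int_eq_iff)
    then show False
      using assms False by (auto simp: abs_mult)
  qed
  moreover have "q ^ M = cis (2 * pi * of_int l)"
    using M by (simp add: q_def Complex.DeMoivre)
  then have "q ^ M = 1"
    by (simp add: cis_multiple_2pi)
  ultimately show ?thesis
    using False by (simp add: pow sum_gp_strict)
qed (use assms in auto)

lemma inverse_unimodular: "cmod z = 1 \<Longrightarrow> inverse z = cnj z"
  by (rule inverse_unique) (simp flip: complex_norm_square)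

lemma powi_diff_unimodular:
  assumes "cmod z = 1"
  shows "z powi (int j - int i) = z ^ j * cnj z ^ i"
proof -
  have "z \<noteq> 0"
    using assms by auto
  then show ?thesis
    by (simp add: power_int_diff divide_inverse inverse_unimodular[OF assms] flip: power_inverse)
qed

text \<open>Counts the points of an n by n square on the diagonal shifted by \<open>m\<close>;
  truncated subtraction gives 0 when the diagonal misses the square. This is the source of the Fejer
  weights.\<close>

lemma sum_indicator_shift:
  "(\<Sum>i<n. \<Sum>j<n. if i = j + m then x else 0) = real (n - m) *\<^sub>R (x :: 'a::real_vector)"
proof -
  have "(\<Sum>i<n. \<Sum>j<n. if i = j + m then x else 0) = (\<Sum>j<n. \<Sum>i<n. if i = j + m then x else 0)"
    by (rule sum.swap)
  also have "\<dots> = (\<Sum>j<n. if j + m < n then x else 0)"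
    by (intro sum.cong refl) (simp add: sum.delta')
  also have "\<dots> = (\<Sum>j<n - m. x)"
    by (rule sum.mono_neutral_cong_right) auto
  finally show ?thesis
    by (simp add: scaleR_conv_of_real sum_constant_scaleR)
qed

lemma star_subalgebra_cspan:
  assumes mult: "\<And>x y. x \<in> X \<Longrightarrow> y \<in> X \<Longrightarrow> x * y \<in> X" and star: "\<And>x. x \<in> X \<Longrightarrow> star x \<in> X"
  shows "star_subalgebra (cspan X)"
  unfolding star_subalgebra_def
proof (intro conjI ballI complex_vector.subspace_span)
  have right: "x * y \<in> cspan X" if "x \<in> X" "y \<in> cspan X" for x y
    using that(2)
  proof (induction rule: complex_vector.span_induct_alt)
    case (step c z y)
    then show ?case
      unfolding distrib_left scaleC_mult_right
      by (intro complex_vector.span_add complex_vector.span_scale step(2)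
          complex_vector.span_base[OF mult[OF that(1) step(1)]])
  qed (simp add: complex_vector.span_zero)
  fix x y assume x: "x \<in> cspan X" and y: "y \<in> cspan X"
  from x show "x * y \<in> cspan X"
  proof (induction rule: complex_vector.span_induct_alt)
    case (step c z x)
    then show ?case
      unfolding distrib_right scaleC_mult_left
      by (intro complex_vector.span_add complex_vector.span_scale right[OF step(1) y] step(2))
  qed (simp add: complex_vector.span_zero)
next
  fix x assume "x \<in> cspan X"
  then show "star x \<in> cspan X"
  proof (induction rule: complex_vector.span_induct_alt)
    case (step c z x)
    then show ?case
      unfolding star_add star_scaleC
      by (intro complex_vector.span_add complex_vector.span_scale step(2)
          complex_vector.span_base[OF star[OF step(1)]])
  qed (simp add: complex_vector.span_zero)
qed

text \<open>Generation by homogeneous elements stands in for continuity in \<open>z\<close>: it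
  makes the span of the spectral subspaces dense.\<close>

locale circle_action =
  fixes \<gamma> :: "complex \<Rightarrow> 'o::unital_cstar_algebra \<Rightarrow> 'o"
  assumes \<gamma>_unital: "cmod z = 1 \<Longrightarrow> unital_star_hom (\<gamma> z)"
    and generated:
      "cstar_generated {x. \<exists>k::int. \<forall>z. cmod z = 1 \<longrightarrow> \<gamma> z x = (z powi k) *\<^sub>C x} = UNIV"
begin

definition spectral :: "int \<Rightarrow> 'o set" where
  "spectral k = {x. \<forall>z. cmod z = 1 \<longrightarrow> \<gamma> z x = (z powi k) *\<^sub>C x}"

lemma \<gamma>_hom: "cmod z = 1 \<Longrightarrow> star_hom_on UNIV (\<gamma> z)"
  using \<gamma>_unital by (simp add: unital_star_hom_def)

lemma \<gamma>_contractive: "cmod z = 1 \<Longrightarrow> norm (\<gamma> z x) \<le> norm x"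
  by (rule star_hom_on_contractive[OF cstar_subalgebra_UNIV local_unit_one \<gamma>_hom]) auto

lemmas \<gamma>_simps = star_hom_onD[OF \<gamma>_hom, OF _ UNIV_I] star_hom_onD(1,2)[OF \<gamma>_hom, OF _ UNIV_I UNIV_I]

lemma \<gamma>_diff: "cmod z = 1 \<Longrightarrow> \<gamma> z (x - y) = \<gamma> z x - \<gamma> z y"
  by (rule star_hom_on_diff[OF \<gamma>_hom]) auto

lemma \<gamma>_bounded_linear: 
  assumes z: "cmod z = 1"
  shows "bounded_linear (\<gamma> z)"
  by (rule bounded_linear_intro[where K=1])
    (use \<gamma>_simps[OF z] \<gamma>_contractive[OF z] in simp_all)

lemma csubspace_spectral: "csubspace (spectral k)"
  unfolding complex_vector.subspace_def spectral_def
  using star_hom_on_0[OF \<gamma>_hom]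
  by (auto simp: \<gamma>_simps scaleC_add_right scaleC_scaleC mult.commute)

lemma closed_spectral: "closed (spectral k)"
proof -
  have "spectral k = (\<Inter>z\<in>{z. cmod z = 1}. {x. \<gamma> z x = (z powi k) *\<^sub>C x})"
    by (auto simp: spectral_def)
  moreover have "closed {x. \<gamma> z x = (z powi k) *\<^sub>C x}" if "cmod z = 1" for z
    by (intro closed_Collect_eq bounded_linear.continuous_on[OF \<gamma>_bounded_linear[OF that]]
        continuous_intros)
  ultimately show ?thesis
    by (auto intro!: closed_INT)
qed

lemma one_spectral: "1 \<in> spectral 0"
  using \<gamma>_unital by (simp add: spectral_def unital_star_hom_def scaleC_one)

lemma spectral_mult:
  assumes "x \<in> spectral k" "y \<in> spectral l"
  shows "x * y \<in> spectral (k + l)"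
proof -
  have "\<gamma> z (x * y) = (z powi (k + l)) *\<^sub>C (x * y)" if z: "cmod z = 1" for z
  proof -
    have "z \<noteq> 0"
      using z by auto
    then show ?thesis
      using assms z unfolding spectral_def
      by (simp add: \<gamma>_simps scaleC_mult_left scaleC_mult_right scaleC_scaleC power_int_add)
  qed
  then show ?thesis
    by (simp add: spectral_def)
qed

lemma spectral_star:
  assumes "x \<in> spectral k"
  shows "star x \<in> spectral (- k)"
proof -
  have "\<gamma> z (star x) = (z powi (- k)) *\<^sub>C star x" if z: "cmod z = 1" for z
  proof -
    have "cnj z = inverse z"
      using z by (simp add: inverse_unimodular)
    then show ?thesis
      using assms z unfolding spectral_def
      by (simp add: \<gamma>_simps star_scaleC power_int_minus power_int_inverse)
  qed
  then show ?thesis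
    by (simp add: spectral_def)
qed

text \<open>Products and adjoints of homogeneous elements are homogeneous, so their span is a
  star-algebra and its closure is everything. A property that defines a closed subspace can then be
  checked one degree at a time.\<close>

lemma spectral_dense_induct:
  assumes "csubspace V" "closed V" "\<And>k. spectral k \<subseteq> V"
  shows "x \<in> V"
proof -
  let ?H = "{x. \<exists>k::int. \<forall>z. cmod z = 1 \<longrightarrow> \<gamma> z x = (z powi k) *\<^sub>C x}"
  have H: "?H = (\<Union>k. spectral k)"
    by (auto simp: spectral_def)
  have "star_subalgebra (cspan ?H)"
    unfolding H
  proof (rule star_subalgebra_cspan)
    fix x y assume "x \<in> (\<Union>k. spectral k)" "y \<in> (\<Union>k. spectral k)"
    then obtain k l where "x \<in> spectral k" "y \<in> spectral l"
      by auto
    then have "x * y \<in> spectral (k + l)"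
      by (rule spectral_mult)
    then show "x * y \<in> (\<Union>k. spectral k)"
      by (rule UN_I[OF UNIV_I])
  next
    fix x assume "x \<in> (\<Union>k. spectral k)"
    then obtain k where "x \<in> spectral k"
      by auto
    then have "star x \<in> spectral (- k)"
      by (rule spectral_star)
    then show "star x \<in> (\<Union>k. spectral k)"
      by (rule UN_I[OF UNIV_I])
  qed
  then have "cstar_subalgebra (closure (cspan ?H))"
    by (rule star_subalgebra_closure)
  moreover have "?H \<subseteq> closure (cspan ?H)"
    using complex_vector.span_superset closure_subset by (rule order_trans)
  ultimately have "cstar_generated ?H \<subseteq> closure (cspan ?H)"
    by (rule cstar_generated_subset(2))
  then have "x \<in> closure (cspan ?H)"
    unfolding generated by blast
  moreover have "closure (cspan ?H) \<subseteq> V"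
    unfolding H by (intro closure_minimal complex_vector.span_minimal assms UN_least)
  ultimately show ?thesis
    by blast
qed

text \<open>A Riemann sum for the k-th Fourier coefficient, the integral of
  \<open>z powi (- k)\<close> times \<open>\<gamma> z x\<close> over the circle.\<close>

definition avg :: "nat \<Rightarrow> int \<Rightarrow> 'o \<Rightarrow> 'o" where
  "avg M k x = (1 / real M) *\<^sub>R (\<Sum>j<M. (root_unity M j powi (- k)) *\<^sub>C \<gamma> (root_unity M j) x)"

lemma avg_add: "avg M k (x + y) = avg M k x + avg M k y"
  by (simp add: avg_def \<gamma>_simps scaleC_add_right sum.distrib scaleR_add_right)

lemma avg_diff: "avg M k (x - y) = avg M k x - avg M k y"
  by (simp add: avg_def \<gamma>_diff complex_vector.scale_right_diff_distrib sum_subtractf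
      scaleR_diff_right)

lemma avg_scaleC: "avg M k (c *\<^sub>C x) = c *\<^sub>C avg M k x"
proof -
  have "(r *\<^sub>R y :: 'o) = complex_of_real r *\<^sub>C y" for r y
    by (rule scaleR_scaleC)
  then show ?thesis
    by (simp add: avg_def \<gamma>_simps scaleC_scaleC complex_vector.scale_sum_right mult_ac)
qed

lemma norm_avg_le: "norm (avg M k x) \<le> norm x"
proof (cases "M = 0")
  case False
  have "norm (\<Sum>j<M. (root_unity M j powi (- k)) *\<^sub>C \<gamma> (root_unity M j) x) \<le> (\<Sum>j<M. norm x)"
    by (intro sum_norm_le) (simp add: norm_scaleC norm_power_int \<gamma>_contractive)
  then show ?thesis
    using False by (simp add: avg_def field_simps)
qed (simp add: avg_def)

text \<open>On degree \<open>l\<close> the average is a character sum over the M-th roots of unity.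
  Once \<open>M\<close> exceeds \<open>\<bar>l - k\<bar>\<close> there is no aliasing and the value
  is exact.\<close>

lemma avg_spectral:
  assumes "x \<in> spectral l" "\<bar>l - k\<bar> < int M"
  shows "avg M k x = (if l = k then x else 0)"
proof -
  have M: "M > 0"
    using assms(2) by simp
  have "(root_unity M j powi (- k)) *\<^sub>C \<gamma> (root_unity M j) x = (root_unity M j powi (l - k)) *\<^sub>C x" for j
  proof -
    have "root_unity M j \<noteq> 0"
      by (metis cmod_root_unity norm_zero zero_neq_one)
    then have "root_unity M j powi (- k) * root_unity M j powi l = root_unity M j powi (l - k)"
      by (simp flip: power_int_add)
    then show ?thesis
      using assms(1) by (simp add: spectral_def scaleC_scaleC)
  qed
  then have "avg M k x = (1 / real M) *\<^sub>R ((\<Sum>j<M. root_unity M j powi (l - k)) *\<^sub>C x)"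
    by (simp add: avg_def complex_vector.scale_sum_left)
  then show ?thesis
    using M by (simp add: sum_root_unity_powi[OF assms(2)] scaleR_scaleC scaleC_scaleC scaleC_one)
qed

definition component :: "int \<Rightarrow> 'o \<Rightarrow> 'o" where
  "component k x = lim (\<lambda>M. avg M k x)"

lemma avg_spectral_tendsto:
  assumes "x \<in> spectral l"
  shows "(\<lambda>M. avg M k x) \<longlonglongrightarrow> (if l = k then x else 0)"
proof (rule tendsto_eventually)
  show "\<forall>\<^sub>F M in sequentially. avg M k x = (if l = k then x else 0)"
    using eventually_gt_at_top[of "nat \<bar>l - k\<bar>"]
    by eventually_elim (rule avg_spectral[OF assms], linarith)
qed

text \<open>On each spectral subspace the averages are eventually constant; uniform contractivity
  carries convergence to the closure of their span.\<close>

lemma avg_tendsto: "(\<lambda>M. avg M k x) \<longlonglongrightarrow> component k x"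
proof -
  have "x \<in> {x. convergent (\<lambda>M. avg M k x)}"
  proof (rule spectral_dense_induct)
    show "csubspace {x. convergent (\<lambda>M. avg M k x)}"
      unfolding complex_vector.subspace_def
    proof (safe)
      show "convergent (\<lambda>M. avg M k 0)"
        using avg_scaleC[of _ k 0 0] by (simp add: convergent_const)
    next
      fix x y assume "convergent (\<lambda>M. avg M k x)" "convergent (\<lambda>M. avg M k y)"
      then show "convergent (\<lambda>M. avg M k (x + y))"
        unfolding avg_add by (rule convergent_add)
    next
      fix c x assume "convergent (\<lambda>M. avg M k x)"
      then show "convergent (\<lambda>M. avg M k (c *\<^sub>C x))"
        unfolding avg_scaleC convergent_def by (elim exE) (rule exI, rule tendsto_scaleC)
    qed
    show "closed {x. convergent (\<lambda>M. avg M k x)}"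
      by (rule closed_convergent[OF avg_diff norm_avg_le])
    show "spectral l \<subseteq> {x. convergent (\<lambda>M. avg M k x)}" for l
      using avg_spectral_tendsto by (auto simp: convergent_def)
  qed
  then show ?thesis
    by (simp add: component_def convergent_LIMSEQ_iff)
qed

lemma component_spectral: "x \<in> spectral l \<Longrightarrow> component k x = (if l = k then x else 0)"
  by (rule LIMSEQ_unique[OF avg_tendsto avg_spectral_tendsto])

lemma component_add: "component k (x + y) = component k x + component k y"
  by (rule LIMSEQ_unique[OF avg_tendsto])
    (simp only: avg_add tendsto_add[OF avg_tendsto avg_tendsto])

lemma component_diff: "component k (x - y) = component k x - component k y"
  by (rule LIMSEQ_unique[OF avg_tendsto])
    (simp only: avg_diff tendsto_diff[OF avg_tendsto avg_tendsto])

lemma component_scaleC: "component k (c *\<^sub>C x) = c *\<^sub>C component k x"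
  by (rule LIMSEQ_unique[OF avg_tendsto]) (simp only: avg_scaleC tendsto_scaleC[OF avg_tendsto])

lemma norm_component_le: "norm (component k x) \<le> norm x"
  by (rule LIMSEQ_le_const2[OF tendsto_norm[OF avg_tendsto]]) (use norm_avg_le in blast)

lemma component_bounded_linear: "bounded_linear (component k)"
  by (rule bounded_linear_intro[where K=1])
    (simp_all add: component_add component_scaleC scaleR_scaleC norm_component_le)

lemma component_mem_spectral: "component k x \<in> spectral k"
proof -
  have "x \<in> component k -` spectral k"
  proof (rule spectral_dense_induct)
    show "csubspace (component k -` spectral k)"
      using csubspace_spectral[of k] component_scaleC[of k 0 0]
      unfolding complex_vector.subspace_def by (simp add: component_add component_scaleC)
    show "closed (component k -` spectral k)"
      by (rule closed_vimage[OF closed_spectral])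
        (rule bounded_linear.continuous_on[OF component_bounded_linear continuous_on_id])
    show "spectral l \<subseteq> component k -` spectral k" for l
      using csubspace_spectral[of k] by (auto simp: component_spectral complex_vector.subspace_0)
  qed
  then show ?thesis
    by simp
qed

text \<open>The index \<open>k\<close> occurs \<open>n - \<bar>k\<bar>\<close> times as a
  difference, so this is the Cesaro mean with weights \<open>1 - \<bar>k\<bar> / n\<close>. The
  double sum is kept because its kernel factors as a squared modulus.\<close>

definition fejer :: "nat \<Rightarrow> 'o \<Rightarrow> 'o" where
  "fejer n x = (1 / real n) *\<^sub>R (\<Sum>i<n. \<Sum>j<n. component (int i - int j) x)"

text \<open>The Fejer kernel \<open>\<bar>\<Sum>\<^sub>i z\<^sup>i\<bar>\<^sup>2 / n\<close> is positive and has mean value 1.\<close>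

lemma norm_fejer_le: "norm (fejer n x) \<le> norm x"
proof (cases "n = 0")
  case False
  \<comment> \<open>The bound is proved for finite averages; \<open>M \<ge> n\<close> rules out
    aliasing, and \<open>M\<close> tends to infinity at the end.\<close>
  have "norm (\<Sum>i<n. \<Sum>j<n. avg M (int i - int j) x) \<le> real n * norm x" if M: "M \<ge> n" for M
  proof -
    let ?\<zeta> = "root_unity M"
    \<comment> \<open>\<open>F t\<close> is \<open>n\<close> times the Fejer kernel at the t-th root
      of unity.\<close>
    define F where "F t = (cmod (\<Sum>i<n. ?\<zeta> t ^ i))\<^sup>2" for t
    have F: "(\<Sum>i<n. \<Sum>j<n. ?\<zeta> t powi (int j - int i)) = complex_of_real (F t)" for t
    proof -
      have "(\<Sum>i<n. \<Sum>j<n. ?\<zeta> t powi (int j - int i)) = (\<Sum>i<n. \<Sum>j<n. cnj (?\<zeta> t) ^ i * ?\<zeta> t ^ j)"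
        by (intro sum.cong refl) (simp only: powi_diff_unimodular[OF cmod_root_unity] mult.commute)
      also have "\<dots> = cnj (\<Sum>i<n. ?\<zeta> t ^ i) * (\<Sum>j<n. ?\<zeta> t ^ j)"
        by (simp add: sum_product)
      also have "\<dots> = complex_of_real (F t)"
        unfolding F_def complex_norm_square by (rule mult.commute)
      finally show ?thesis .
    qed
    have "complex_of_real (\<Sum>t<M. F t) = (\<Sum>t<M. \<Sum>i<n. \<Sum>j<n. ?\<zeta> t powi (int j - int i))"
      by (simp add: F)
    also have "\<dots> = (\<Sum>i<n. \<Sum>j<n. \<Sum>t<M. ?\<zeta> t powi (int j - int i))"
      by (simp only: sum.swap[of _ "{..<M}"])
    also have "\<dots> = (\<Sum>i<n. \<Sum>j<n. if i = j + 0 then complex_of_real M else 0)"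
    proof (intro sum.cong refl)
      fix i j assume "i \<in> {..<n}" "j \<in> {..<n}"
      then have "\<bar>int j - int i\<bar> < int M"
        using M by auto
      then show "(\<Sum>t<M. ?\<zeta> t powi (int j - int i)) = (if i = j + 0 then complex_of_real M else 0)"
        by (simp add: sum_root_unity_powi)
    qed
    also have "\<dots> = complex_of_real (real n * real M)"
      by (simp only: sum_indicator_shift) (simp add: scaleR_conv_of_real)
    finally have sumF: "(\<Sum>t<M. F t) = real n * real M"
      by (simp only: of_real_eq_iff)
    have "(\<Sum>i<n. \<Sum>j<n. avg M (int i - int j) x)
        = (1 / real M) *\<^sub>R (\<Sum>i<n. \<Sum>j<n. \<Sum>t<M. (?\<zeta> t powi (int j - int i)) *\<^sub>C \<gamma> (?\<zeta> t) x)"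
      by (simp add: avg_def scaleR_sum_right)
    also have "(\<Sum>i<n. \<Sum>j<n. \<Sum>t<M. (?\<zeta> t powi (int j - int i)) *\<^sub>C \<gamma> (?\<zeta> t) x)
        = (\<Sum>t<M. \<Sum>i<n. \<Sum>j<n. (?\<zeta> t powi (int j - int i)) *\<^sub>C \<gamma> (?\<zeta> t) x)"
      by (simp only: sum.swap[of _ "{..<M}"])
    also have "\<dots> = (\<Sum>t<M. complex_of_real (F t) *\<^sub>C \<gamma> (?\<zeta> t) x)"
      by (simp only: F flip: complex_vector.scale_sum_left)
    finally have "norm (\<Sum>i<n. \<Sum>j<n. avg M (int i - int j) x)
        = (1 / real M) * norm (\<Sum>t<M. complex_of_real (F t) *\<^sub>C \<gamma> (?\<zeta> t) x)"
      by simp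
    also have "\<dots> \<le> (1 / real M) * (\<Sum>t<M. F t * norm x)"
    proof (intro mult_left_mono sum_norm_le)
      fix t
      have "F t \<ge> 0"
        by (simp add: F_def)
      then show "norm (complex_of_real (F t) *\<^sub>C \<gamma> (?\<zeta> t) x) \<le> F t * norm x"
        by (simp add: norm_scaleC mult_left_mono \<gamma>_contractive)
    qed simp
    also have "\<dots> = real n * norm x"
      using M False by (simp add: sumF flip: sum_distrib_right)
    finally show ?thesis .
  qed
  then have "norm (\<Sum>i<n. \<Sum>j<n. component (int i - int j) x) \<le> real n * norm x"
    by (intro LIMSEQ_le_const2[OF tendsto_norm[OF tendsto_sum[OF tendsto_sum[OF avg_tendsto]]]]) auto
  then show ?thesis
    using False by (simp add: fejer_def field_simps)
qed (simp add: fejer_def)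

lemma fejer_diff: "fejer n (x - y) = fejer n x - fejer n y"
  by (simp add: fejer_def component_diff sum_subtractf scaleR_diff_right)

lemma fejer_add: "fejer n (x + y) = fejer n x + fejer n y"
  by (simp add: fejer_def component_add sum.distrib scaleR_add_right)

lemma fejer_scaleC: "fejer n (c *\<^sub>C x) = c *\<^sub>C fejer n x"
proof -
  have "(r *\<^sub>R y :: 'o) = complex_of_real r *\<^sub>C y" for r y
    by (rule scaleR_scaleC)
  then show ?thesis
    by (simp add: fejer_def component_scaleC scaleC_scaleC complex_vector.scale_sum_right mult_ac)
qed

lemma fejer_tendsto: "(\<lambda>n. fejer n x) \<longlonglongrightarrow> x"
proof -
  have "x \<in> {x. (\<lambda>n. fejer n x) \<longlonglongrightarrow> x}"
  proof (rule spectral_dense_induct)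
    show "csubspace {x. (\<lambda>n. fejer n x) \<longlonglongrightarrow> x}"
      unfolding complex_vector.subspace_def
    proof safe
      show "(\<lambda>n. fejer n 0) \<longlonglongrightarrow> 0"
        using fejer_scaleC[of _ 0 0] by simp
    next
      fix x y assume "(\<lambda>n. fejer n x) \<longlonglongrightarrow> x" "(\<lambda>n. fejer n y) \<longlonglongrightarrow> y"
      then show "(\<lambda>n. fejer n (x + y)) \<longlonglongrightarrow> x + y"
        unfolding fejer_add by (rule tendsto_add)
    next
      fix c x assume "(\<lambda>n. fejer n x) \<longlonglongrightarrow> x"
      then show "(\<lambda>n. fejer n (c *\<^sub>C x)) \<longlonglongrightarrow> c *\<^sub>C x"
        unfolding fejer_scaleC by (rule tendsto_scaleC)
    qed
    show "closed {x. (\<lambda>n. fejer n x) \<longlonglongrightarrow> x}"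
      by (rule closed_tendsto_id[OF fejer_diff norm_fejer_le])
    show "spectral l \<subseteq> {x. (\<lambda>n. fejer n x) \<longlonglongrightarrow> x}" for l
    proof safe
      fix x assume x: "x \<in> spectral l"
      define m where "m = nat \<bar>l\<bar>"
      \<comment> \<open>Only the pairs with \<open>i - j = l\<close> contribute; for
        \<open>n \<le> m\<close> there are none and both sides vanish.\<close>
      have "(\<Sum>i<n. \<Sum>j<n. component (int i - int j) x) = real (n - m) *\<^sub>R x" for n
      proof (cases "l \<ge> 0")
        case True
        have "(\<Sum>i<n. \<Sum>j<n. component (int i - int j) x) = (\<Sum>i<n. \<Sum>j<n. if i = j + m then x else 0)"
          using True by (intro sum.cong refl) (auto simp: component_spectral[OF x] m_def)
        then show ?thesis
          by (simp only: sum_indicator_shift)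
      next
        case False
        have "(\<Sum>i<n. \<Sum>j<n. component (int i - int j) x) = (\<Sum>i<n. \<Sum>j<n. if j = i + m then x else 0)"
          using False by (intro sum.cong refl) (auto simp: component_spectral[OF x] m_def)
        also have "\<dots> = (\<Sum>j<n. \<Sum>i<n. if j = i + m then x else 0)"
          by (rule sum.swap)
        finally show ?thesis
          by (simp only: sum_indicator_shift)
      qed
      then have fej: "fejer n x = (real (n - m) / real n) *\<^sub>R x" for n
        by (simp add: fejer_def)
      have "(\<lambda>n. 1 - real m / real n) \<longlonglongrightarrow> 1 - 0"
        by (intro tendsto_diff tendsto_const lim_const_over_n)
      moreover have "\<forall>\<^sub>F n in sequentially. 1 - real m / real n = real (n - m) / real n"
        using eventually_gt_at_top[of m] by eventually_elim (simp add: field_simps of_nat_diff)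
      ultimately have "(\<lambda>n. real (n - m) / real n) \<longlonglongrightarrow> 1"
        using Lim_transform_eventually by fastforce
      then have "(\<lambda>n. (real (n - m) / real n) *\<^sub>R x) \<longlonglongrightarrow> 1 *\<^sub>R x"
        by (intro tendsto_scaleR tendsto_const)
      then show "(\<lambda>n. fejer n x) \<longlonglongrightarrow> x"
        by (simp add: fej)
    qed
  qed
  then show ?thesis
    by simp
qed

text \<open>The averages are linear combinations of elements \<open>\<gamma> z x\<close> of
  \<open>A\<close>, and \<open>A\<close> is closed. This is why gauge invariance of the fixed
  algebra has to be proved.\<close>

lemma component_mem_invariant:
  assumes "csubspace A" "closed A" "\<And>z x. cmod z = 1 \<Longrightarrow> x \<in> A \<Longrightarrow> \<gamma> z x \<in> A" "x \<in> A"
  shows "component k x \<in> A"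
proof -
  have "avg M k x \<in> A" for M
    unfolding avg_def
    by (intro csubspace_scaleR complex_vector.subspace_sum complex_vector.subspace_scale assms
        cmod_root_unity)
  then show ?thesis
    by (rule closed_sequentially[OF assms(2) _ avg_tendsto])
qed

lemma fejer_mem_span:
  assumes "\<And>k. component k x \<in> A"
  shows "fejer n x \<in> cspan (\<Union>k. A \<inter> spectral k)"
proof -
  have "component k x \<in> cspan (\<Union>k. A \<inter> spectral k)" for k
    using assms component_mem_spectral by (blast intro: complex_vector.span_base)
  then show ?thesis
    unfolding fejer_def
    by (intro csubspace_scaleR complex_vector.subspace_sum complex_vector.subspace_span)
qed

end

section \<open>Algebras graded by an isometry\<close>

text \<open>Uniform continuity extends \<open>f\<close>, and the algebraic identities pass to
  limits. Contractivity is assumed because \<open>P\<close> need not be closed, so that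
  \<open>star_hom_on_contractive\<close> does not apply.\<close>

lemma star_hom_extend_closure:
  assumes P: "star_subalgebra P" and f: "star_hom_on P f" and le: "\<And>x. x \<in> P \<Longrightarrow> norm (f x) \<le> norm x"
  obtains g where "star_hom_on (closure P) g" "\<And>x. x \<in> P \<Longrightarrow> g x = f x"
proof -
  have sub: "csubspace P" "\<And>x y. x \<in> P \<Longrightarrow> y \<in> P \<Longrightarrow> x * y \<in> P" "\<And>x. x \<in> P \<Longrightarrow> star x \<in> P"
    using P by (auto simp: star_subalgebra_def)
  have "1-lipschitz_on P f"
  proof (rule lipschitz_onI)
    fix x y assume "x \<in> P" "y \<in> P"
    then show "dist (f x) (f y) \<le> 1 * dist x y"
      using le[of "x - y"] complex_vector.subspace_diff[OF sub(1), of x y]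
      by (simp add: dist_norm star_hom_on_diff[OF f sub(1)])
  qed simp
  then obtain g where g: "1-lipschitz_on (closure P) g" "\<And>x. x \<in> P \<Longrightarrow> g x = f x"
    using lipschitz_extend_closure by metis
  have lim: "(\<lambda>n. f (X n)) \<longlonglongrightarrow> g x" if "\<And>n. X n \<in> P" "X \<longlonglongrightarrow> x" for X x
  proof -
    have "x \<in> closure P"
      using that by (auto simp: closure_sequential)
    moreover have "continuous_on (closure P) g"
      by (rule lipschitz_on_continuous_on[OF g(1)])
    moreover have "X n \<in> closure P" for n
      using that(1) closure_subset by blast
    ultimately have "(\<lambda>n. g (X n)) \<longlonglongrightarrow> g x"
      using that(2) by (auto simp: continuous_on_sequentially comp_def)
    then show ?thesis
      using that(1) by (simp add: g(2))
  qed
  have "star_hom_on (closure P) g"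
    unfolding star_hom_on_def
  proof (intro conjI ballI allI)
    fix x y assume "x \<in> closure P" "y \<in> closure P"
    then obtain X Y where X: "\<And>n. X n \<in> P" "X \<longlonglongrightarrow> x" and Y: "\<And>n. Y n \<in> P" "Y \<longlonglongrightarrow> y"
      by (auto simp: closure_sequential)
    have "(\<lambda>n. f (X n + Y n)) \<longlonglongrightarrow> g (x + y)"
      by (intro lim tendsto_add complex_vector.subspace_add[OF sub(1)] X Y)
    moreover have "(\<lambda>n. f (X n) + f (Y n)) \<longlonglongrightarrow> g x + g y"
      by (intro lim tendsto_add X Y)
    ultimately show "g (x + y) = g x + g y"
      using X(1) Y(1) by (simp add: star_hom_onD[OF f] LIMSEQ_unique)
    have "(\<lambda>n. f (X n * Y n)) \<longlonglongrightarrow> g (x * y)"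
      by (intro lim tendsto_mult sub X Y)
    moreover have "(\<lambda>n. f (X n) * f (Y n)) \<longlonglongrightarrow> g x * g y"
      by (intro lim tendsto_mult X Y)
    ultimately show "g (x * y) = g x * g y"
      using X(1) Y(1) by (simp add: star_hom_onD[OF f] LIMSEQ_unique)
  next
    fix x c assume "x \<in> closure P"
    then obtain X where X: "\<And>n. X n \<in> P" "X \<longlonglongrightarrow> x"
      by (auto simp: closure_sequential)
    have "(\<lambda>n. f (c *\<^sub>C X n)) \<longlonglongrightarrow> g (c *\<^sub>C x)"
      by (intro lim tendsto_scaleC complex_vector.subspace_scale[OF sub(1)] X)
    moreover have "(\<lambda>n. c *\<^sub>C f (X n)) \<longlonglongrightarrow> c *\<^sub>C g x"
      by (intro lim tendsto_scaleC X)
    ultimately show "g (c *\<^sub>C x) = c *\<^sub>C g x"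
      using X(1) by (simp add: star_hom_onD[OF f] LIMSEQ_unique)
  next
    fix x assume "x \<in> closure P"
    then obtain X where X: "\<And>n. X n \<in> P" "X \<longlonglongrightarrow> x"
      by (auto simp: closure_sequential)
    have "(\<lambda>n. f (star (X n))) \<longlonglongrightarrow> g (star x)"
      by (intro lim tendsto_star sub X)
    moreover have "(\<lambda>n. star (f (X n))) \<longlonglongrightarrow> star (g x)"
      by (intro lim tendsto_star X)
    ultimately show "g (star x) = star (g x)"
      using X(1) by (simp add: star_hom_onD[OF f] LIMSEQ_unique)
  qed
  then show ?thesis
    using g(2) by (rule that)
qed

text \<open>A linear factor is negligible after taking roots: if \<open>q = a / b > 1\<close>, then
  \<open>q ^ n\<close> would outgrow it. The exponents are powers of two because the C*-identity
  squares norms.\<close>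

lemma le_if_powers_le_linear:
  fixes a b C :: real
  assumes "0 \<le> a" "0 \<le> b" and le: "\<And>m. a ^ (2 ^ m) \<le> (C * 2 ^ m + 1) * b ^ (2 ^ m)"
  shows "a \<le> b"
proof (rule ccontr)
  assume "\<not> a \<le> b"
  then have ab: "b < a" by simp
  show False
  proof (cases "b = 0")
    case True
    then show False
      using le[of 0] ab by simp
  next
    case False
    then have b: "b > 0" using assms(2) by simp
    define q where "q = a / b"
    have q: "q > 1"
      using ab b by (simp add: q_def)
    have "q ^ (2 ^ m) \<le> C * 2 ^ m + 1" for m
      using le[of m] b by (simp add: q_def power_divide field_simps)
    then have bound: "1 \<le> C * (real (2 ^ m) / q ^ (2 ^ m)) + 1 / q ^ (2 ^ m)" for m
      using q by (simp add: field_simps)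
    have lim: "(\<lambda>n. C * (real n / q ^ n) + 1 / q ^ n) \<longlonglongrightarrow> C * 0 + 0"
    proof (intro tendsto_intros)
      show "(\<lambda>n. real n / q ^ n) \<longlonglongrightarrow> 0"
        using powser_times_n_limit_0[of "1 / q"] q by (simp add: power_divide)
      show "(\<lambda>n. 1 / q ^ n) \<longlonglongrightarrow> 0"
        using LIMSEQ_divide_realpow_zero[OF q, of 1] by simp
    qed
    have "strict_mono (\<lambda>m. 2 ^ m :: nat)"
      by (auto simp: strict_mono_def)
    from LIMSEQ_subseq_LIMSEQ[OF lim this]
    have "(\<lambda>m. C * (real (2 ^ m) / q ^ (2 ^ m)) + 1 / q ^ (2 ^ m)) \<longlonglongrightarrow> 0"
      by (simp add: comp_def)
    then have "1 \<le> (0 :: real)"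
      by (rule LIMSEQ_le_const) (use bound in blast)
    then show False by simp
  qed
qed

text \<open>\<open>A\<close> stands for the invariant algebra. The results of this locale are
  independent of Cuntz algebras and quantum groups.\<close>

locale graded_isometry = circle_action +
  fixes A :: "'a set" and \<nu> :: 'a
  assumes A: "cstar_subalgebra A" and one_A: "1 \<in> A"
    and \<gamma>_A: "cmod z = 1 \<Longrightarrow> x \<in> A \<Longrightarrow> \<gamma> z x \<in> A"
    and \<nu>_A: "\<nu> \<in> A" and \<nu>_spectral: "\<nu> \<in> spectral 1" and isometry: "star \<nu> * \<nu> = 1"
begin

section \<open>The graded algebra and its trigonometric polynomials\<close>

definition homog :: "int \<Rightarrow> 'a set" where
  "homog k = A \<inter> spectral k"

lemma A_closed: "csubspace A" "x \<in> A \<Longrightarrow> y \<in> A \<Longrightarrow> x * y \<in> A" "x \<in> A \<Longrightarrow> star x \<in> A" "closed A"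
  using A by (auto simp: cstar_subalgebra_def star_subalgebra_def)

lemma homog_mult: "x \<in> homog k \<Longrightarrow> y \<in> homog l \<Longrightarrow> x * y \<in> homog (k + l)"
  by (simp add: homog_def A_closed spectral_mult)

lemma homog_star: "x \<in> homog k \<Longrightarrow> star x \<in> homog (- k)"
  by (simp add: homog_def A_closed spectral_star)

lemma csubspace_homog: "csubspace (homog k)"
  unfolding homog_def by (rule complex_vector.subspace_inter[OF A_closed(1) csubspace_spectral])

lemma cstar_subalgebra_homog_0: "cstar_subalgebra (homog 0)"
  unfolding cstar_subalgebra_def star_subalgebra_def
  using csubspace_homog homog_mult[of _ 0 _ 0] homog_star[of _ 0]
    closed_Int[OF A_closed(4) closed_spectral[of 0]]
  by (auto simp: homog_def)

lemma one_homog: "1 \<in> homog 0"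
  by (simp add: homog_def one_A one_spectral)

lemma \<nu>_power_homog: "\<nu> ^ n \<in> homog (int n)"
proof (induction n)
  case (Suc n)
  have "\<nu> * \<nu> ^ n \<in> homog (1 + int n)"
    by (rule homog_mult[OF _ Suc]) (simp add: homog_def \<nu>_A \<nu>_spectral)
  then show ?case
    by simp
qed (simp add: one_homog)

lemma \<nu>_power_isometry: "star (\<nu> ^ n) * \<nu> ^ n = 1"
proof (induction n)
  case (Suc n)
  have "star (\<nu> ^ Suc n) * \<nu> ^ Suc n = star (\<nu> ^ n) * (star \<nu> * \<nu>) * \<nu> ^ n"
    by (simp add: star_mult mult.assoc)
  then show ?case
    using Suc by (simp add: isometry)
qed simp

text \<open>The degrees add up to \<open>n + k - m = 0\<close>. As \<open>\<nu>\<close> is an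
  isometry, multiplying by \<open>star (\<nu> ^ n)\<close> and \<open>\<nu> ^ m\<close> recovers
  \<open>x\<close>: every homogeneous element is encoded in degree 0.\<close>

lemma shift_homog:
  assumes "x \<in> homog k" "k = int m - int n"
  shows "\<nu> ^ n * x * star (\<nu> ^ m) \<in> homog 0"
proof -
  have "\<nu> ^ n * x * star (\<nu> ^ m) \<in> homog (int n + k + (- int m))"
    by (intro homog_mult homog_star \<nu>_power_homog assms)
  then show ?thesis
    using assms(2) by simp
qed

lemma component_homog: "x \<in> A \<Longrightarrow> component k x \<in> homog k"
  unfolding homog_def using component_mem_invariant[OF A_closed(1,4) \<gamma>_A] component_mem_spectral by blast

lemma component_of_homog: "x \<in> homog k \<Longrightarrow> component l x = (if k = l then x else 0)"
  by (simp add: homog_def component_spectral)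

lemma component_sum: "component k (\<Sum>i\<in>I. f i) = (\<Sum>i\<in>I. component k (f i))"
  by (rule bounded_linear.linear[OF component_bounded_linear, THEN linear_sum])

text \<open>Trigonometric polynomials of degree at most \<open>n\<close>, described by a fixed point
  equation: the decomposition into homogeneous parts is then canonical.\<close>

definition poly_deg :: "nat \<Rightarrow> 'a set" where
  "poly_deg n = {x \<in> A. x = (\<Sum>k\<in>{- int n..int n}. component k x)}"

lemma component_poly_deg:
  assumes "x \<in> poly_deg n" "k \<notin> {- int n..int n}"
  shows "component k x = 0"
proof -
  have "x = (\<Sum>l\<in>{- int n..int n}. component l x)"
    using assms(1) by (simp add: poly_deg_def)
  then have "component k x = (\<Sum>l\<in>{- int n..int n}. component k (component l x))"
    by (metis component_sum)
  also have "\<dots> = 0"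
    using assms(2) by (intro sum.neutral) (auto simp: component_spectral[OF component_mem_spectral])
  finally show ?thesis .
qed

lemma homog_poly_deg:
  assumes "x \<in> homog k" "\<bar>k\<bar> \<le> int n"
  shows "x \<in> poly_deg n"
proof -
  have "(\<Sum>l\<in>{- int n..int n}. component l x) = (\<Sum>l\<in>{- int n..int n}. if k = l then x else 0)"
    by (simp add: component_of_homog[OF assms(1)])
  also have "\<dots> = x"
    using assms(2) by (auto simp: abs_le_iff)
  finally show ?thesis
    using assms(1) by (simp add: poly_deg_def homog_def)
qed

lemma csubspace_poly_deg: "csubspace (poly_deg n)"
  using A_closed(1) component_scaleC[of _ 0 0] unfolding complex_vector.subspace_def poly_deg_def
  by (auto simp: component_add component_scaleC sum.distrib simp flip: complex_vector.scale_sum_right)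

lemma poly_deg_mono:
  assumes "x \<in> poly_deg n" "n \<le> m"
  shows "x \<in> poly_deg m"
proof -
  have "(\<Sum>k\<in>{- int n..int n}. component k x) \<in> poly_deg m"
  proof (rule complex_vector.subspace_sum[OF csubspace_poly_deg])
    fix k assume "k \<in> {- int n..int n}"
    then show "component k x \<in> poly_deg m"
      using assms by (intro homog_poly_deg[OF component_homog]) (auto simp: poly_deg_def)
  qed
  then show ?thesis
    using assms(1) by (simp add: poly_deg_def)
qed

lemma poly_deg_mult:
  assumes x: "x \<in> poly_deg n" and y: "y \<in> poly_deg m"
  shows "x * y \<in> poly_deg (n + m)"
proof -
  have xy: "x = (\<Sum>k\<in>{- int n..int n}. component k x)" "y = (\<Sum>l\<in>{- int m..int m}. component l y)" "x \<in> A" "y \<in> A"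
    using x y by (auto simp: poly_deg_def)
  have "(\<Sum>k\<in>{- int n..int n}. component k x) * (\<Sum>l\<in>{- int m..int m}. component l y) \<in> poly_deg (n + m)"
    unfolding sum_product
  proof (intro complex_vector.subspace_sum[OF csubspace_poly_deg])
    fix k l assume kl: "k \<in> {- int n..int n}" "l \<in> {- int m..int m}"
    show "component k x * component l y \<in> poly_deg (n + m)"
      by (rule homog_poly_deg[OF homog_mult[OF component_homog[OF xy(3)] component_homog[OF xy(4)]]])
        (use kl in auto)
  qed
  then show ?thesis
    using xy(1,2) by simp
qed

lemma poly_deg_star:
  assumes x: "x \<in> poly_deg n"
  shows "star x \<in> poly_deg n"
proof -
  have xy: "x = (\<Sum>k\<in>{- int n..int n}. component k x)" "x \<in> A"
    using x by (auto simp: poly_deg_def)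
  have "star (\<Sum>k\<in>{- int n..int n}. component k x) \<in> poly_deg n"
    unfolding star_sum
  proof (intro complex_vector.subspace_sum[OF csubspace_poly_deg])
    fix k assume "k \<in> {- int n..int n}"
    then show "star (component k x) \<in> poly_deg n"
      by (intro homog_poly_deg[OF homog_star[OF component_homog[OF xy(2)]]]) auto
  qed
  then show ?thesis
    using xy(1) by simp
qed

definition polys :: "'a set" where
  "polys = (\<Union>n. poly_deg n)"

lemma poly_deg_polys: "x \<in> poly_deg n \<Longrightarrow> x \<in> polys"
  by (auto simp: polys_def)

lemma polys_pair:
  assumes "x \<in> polys" "y \<in> polys"
  obtains n where "x \<in> poly_deg n" "y \<in> poly_deg n"
proof -
  obtain n m where "x \<in> poly_deg n" "y \<in> poly_deg m"
    using assms by (auto simp: polys_def)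
  then show ?thesis
    using poly_deg_mono[of x n "max n m"] poly_deg_mono[of y m "max n m"] that by simp
qed

lemma csubspace_polys: "csubspace polys"
  unfolding complex_vector.subspace_def
proof (intro conjI ballI allI)
  show "0 \<in> polys"
    using complex_vector.subspace_0[OF csubspace_poly_deg[of 0]] by (auto simp: polys_def)
next
  fix x y assume "x \<in> polys" "y \<in> polys"
  then obtain n where "x \<in> poly_deg n" "y \<in> poly_deg n"
    by (rule polys_pair)
  then show "x + y \<in> polys"
    by (intro poly_deg_polys complex_vector.subspace_add[OF csubspace_poly_deg])
next
  fix c x assume "x \<in> polys"
  then show "c *\<^sub>C x \<in> polys"
    using complex_vector.subspace_scale[OF csubspace_poly_deg] by (auto simp: polys_def)
qed

lemma star_subalgebra_polys: "star_subalgebra polys"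
  unfolding star_subalgebra_def
proof (intro conjI ballI csubspace_polys)
  fix x y assume "x \<in> polys" "y \<in> polys"
  then obtain n where "x \<in> poly_deg n" "y \<in> poly_deg n"
    by (rule polys_pair)
  then show "x * y \<in> polys"
    by (rule poly_deg_polys[OF poly_deg_mult])
next
  fix x assume "x \<in> polys"
  then show "star x \<in> polys"
    unfolding polys_def using poly_deg_star by blast
qed

lemma homog_polys: "x \<in> homog k \<Longrightarrow> x \<in> polys"
  using homog_poly_deg[of x k "nat \<bar>k\<bar>"] by (auto simp: polys_def)

text \<open>The homogeneous components of an element of \<open>A\<close> lie in \<open>A\<close>, so
  its Fejer means are polynomials, and they converge to it.\<close>

lemma closure_polys: "closure polys = A"
proof
  show "closure polys \<subseteq> A"
    by (rule closure_minimal) (auto simp: polys_def poly_deg_def A_closed)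
  show "A \<subseteq> closure polys"
  proof
    fix x assume x: "x \<in> A"
    have "fejer n x \<in> cspan (\<Union>k. A \<inter> spectral k)" for n
      by (rule fejer_mem_span) (use component_homog[OF x] in \<open>simp add: homog_def\<close>)
    moreover have "cspan (\<Union>k. A \<inter> spectral k) \<subseteq> polys"
      by (rule complex_vector.span_minimal[OF _ csubspace_polys])
        (use homog_polys in \<open>auto simp: homog_def\<close>)
    ultimately have "fejer n x \<in> polys" for n
      by blast
    then show "x \<in> closure polys"
      unfolding closure_sequential using fejer_tendsto[of x] by (intro exI[of _ "\<lambda>n. fejer n x"] conjI allI)
  qed
qed

end

section \<open>Extension of covariant representations\<close>

text \<open>\<open>w\<close> is the intended image of \<open>star \<nu>\<close>. Its first condition
  is the image of \<open>star \<nu> * \<nu> = 1\<close>, the second that of the trivial identity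
  \<open>star (star \<nu>) * a * star \<nu> = \<nu> * a * star \<nu>\<close>.\<close>

locale corner_rep = graded_isometry +
  fixes \<rho> :: "'a \<Rightarrow> 'b::cstar_algebra" and w :: 'b
  assumes \<rho>: "star_hom_on (homog 0) \<rho>"
    and w_star: "w * star w = \<rho> 1"
    and covariance: "a \<in> homog 0 \<Longrightarrow> star w * \<rho> a * w = \<rho> (\<nu> * a * star \<nu>)"
begin

lemmas \<rho>_simps = star_hom_onD[OF \<rho>]

lemma homog_0_mult: "a \<in> homog 0 \<Longrightarrow> b \<in> homog 0 \<Longrightarrow> a * b \<in> homog 0"
  using homog_mult[of a 0 b 0] by simp

lemma unit_\<rho>: "a \<in> homog 0 \<Longrightarrow> \<rho> 1 * \<rho> a = \<rho> a" "a \<in> homog 0 \<Longrightarrow> \<rho> a * \<rho> 1 = \<rho> a"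
  using \<rho>_simps(2)[OF one_homog] \<rho>_simps(2)[OF _ one_homog] by simp_all

lemma star_unit: "star (\<rho> 1) = \<rho> 1"
  using \<rho>_simps(4)[OF one_homog] by simp

text \<open>With \<open>p = \<rho> 1\<close>, the product \<open>(1 - p) w star w (1 - p)\<close> is
  0 since \<open>w * star w = p\<close>, and the C*-identity gives \<open>w = p w\<close>. The
  formal 1 is multiplied out because the target may have no unit.\<close>

lemma unit_w: "\<rho> 1 * w = w"
proof -
  have ee: "\<rho> 1 * \<rho> 1 = \<rho> 1"
    using unit_\<rho>(1)[OF one_homog] .
  define u where "u = star (w - \<rho> 1 * w)"
  have u: "u = star w - star w * \<rho> 1"
    by (simp add: u_def star_diff star_mult star_unit)
  have su: "star u = w - \<rho> 1 * w"
    by (simp add: u_def star_star)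
  have "star u * u = (w - \<rho> 1 * w) * (star w - star w * \<rho> 1)"
    unfolding su by (simp only: u)
  also have "\<dots> = w * star w - (w * star w) * \<rho> 1 - \<rho> 1 * (w * star w) + \<rho> 1 * (w * star w) * \<rho> 1"
    by (simp add: algebra_simps)
  also have "\<dots> = 0"
    by (simp only: w_star ee) simp
  finally have "u = 0"
    by (simp only: star_mult_self_eq_0)
  then have "w - \<rho> 1 * w = 0"
    unfolding u_def by (metis star_star star_zero)
  then show ?thesis
    by simp
qed

text \<open>\<open>star w * w\<close> is \<open>\<rho>\<close> of the projection
  \<open>\<nu> * star \<nu>\<close> and so absorbs \<open>\<rho> 1\<close>; moreover
  \<open>w = w * (star w * w)\<close>.\<close>

lemma w_unit: "w * \<rho> 1 = w"
proof -
  have h: "\<nu> * 1 * star \<nu> \<in> homog 0"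
    using shift_homog[OF one_homog, of 1 1] by simp
  have "w = w * star w * w"
    by (simp only: w_star unit_w)
  also have "\<dots> = w * \<rho> (\<nu> * 1 * star \<nu>)"
  proof -
    have "star w * w = star w * \<rho> 1 * w"
      by (simp only: mult.assoc unit_w)
    then show ?thesis
      by (simp only: covariance[OF one_homog] mult.assoc[of w])
  qed
  finally have "w = w * \<rho> (\<nu> * 1 * star \<nu>)" .
  then show ?thesis
    by (metis mult.assoc unit_\<rho>(2)[OF h])
qed

abbreviation W :: "nat \<Rightarrow> 'b" where
  "W \<equiv> unit_power (\<rho> 1) w"

lemma unit_W: "\<rho> 1 * W n = W n" "W n * \<rho> 1 = W n"
proof -
  show "\<rho> 1 * W n = W n"
    by (cases n) (simp_all add: unit_\<rho>(1)[OF one_homog] unit_w flip: mult.assoc)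
  show "W n * \<rho> 1 = W n"
    by (induction n) (simp_all add: unit_\<rho>(1)[OF one_homog] mult.assoc)
qed

lemma W_Suc2: "W (Suc n) = W n * w"
proof (induction n)
  case (Suc n)
  have "W (Suc (Suc n)) = w * W (Suc n)"
    by (rule unit_power.simps)
  also have "\<dots> = w * W n * w"
    unfolding Suc by (simp only: mult.assoc)
  finally show ?case
    by simp
qed (simp add: w_unit unit_w)

lemma W_covariance:
  assumes a: "a \<in> homog 0"
  shows "star (W n) * \<rho> a * W n = \<rho> (\<nu> ^ n * a * star (\<nu> ^ n))"
proof (induction n)
  case (Suc n)
  have "star (W (Suc n)) * \<rho> a * W (Suc n) = star w * (star (W n) * \<rho> a * W n) * w"
    unfolding W_Suc2 by (simp add: star_mult mult.assoc)
  also have "\<dots> = \<rho> (\<nu> * (\<nu> ^ n * a * star (\<nu> ^ n)) * star \<nu>)"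
    unfolding Suc by (rule covariance[OF shift_homog[OF a]]) simp
  finally show ?case
    by (simp add: star_mult mult.assoc power_commutes)
qed (simp add: star_unit unit_\<rho>[OF a])

text \<open>The encoding of \<open>x\<close> in degree 0, decoded with \<open>w\<close> in place of
  \<open>star \<nu>\<close>.\<close>

definition shifted :: "nat \<Rightarrow> nat \<Rightarrow> 'a \<Rightarrow> 'b" where
  "shifted n m x = W n * \<rho> (\<nu> ^ n * x * star (\<nu> ^ m)) * star (W m)"

text \<open>Independence of the exponents: raising both by one replaces \<open>\<rho> a\<close> by
  \<open>star w * \<rho> a * w\<close>, and the factors \<open>w * star w\<close> that arise on
  either side collapse to \<open>\<rho> 1\<close>.\<close>

lemma shifted_Suc:
  assumes "x \<in> homog k" "k = int m - int n"
  shows "shifted (Suc n) (Suc m) x = shifted n m x"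
proof -
  define a where "a = \<nu> ^ n * x * star (\<nu> ^ m)"
  have a: "a \<in> homog 0"
    unfolding a_def by (rule shift_homog[OF assms])
  have "\<nu> ^ Suc n * x * star (\<nu> ^ Suc m) = \<nu> * a * star \<nu>"
    by (simp add: a_def star_mult mult.assoc)
  then have "shifted (Suc n) (Suc m) x = W n * w * (star w * \<rho> a * w) * star (W m * w)"
    unfolding shifted_def by (simp only: W_Suc2 covariance[OF a])
  also have "\<dots> = W n * (w * star w) * \<rho> a * (w * star w) * star (W m)"
    by (simp only: star_mult mult.assoc)
  also have "\<dots> = W n * \<rho> a * \<rho> 1 * star (W m)"
    by (simp only: w_star unit_W)
  also have "\<dots> = shifted n m x"
    unfolding mult.assoc[of "W n" "\<rho> a" "\<rho> 1"] unit_\<rho>(2)[OF a] by (simp only: shifted_def a_def)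
  finally show ?thesis .
qed

lemma shifted_add:
  assumes "x \<in> homog k" "k = int m - int n"
  shows "shifted (n + j) (m + j) x = shifted n m x"
proof (induction j)
  case (Suc j)
  have "shifted (Suc (n + j)) (Suc (m + j)) x = shifted (n + j) (m + j) x"
    by (rule shifted_Suc[OF assms(1)]) (simp add: assms(2))
  then show ?case
    using Suc by simp
qed simp

text \<open>The factors share the exponent \<open>m\<close>, so \<open>star (W m) * W m\<close>
  stands in the middle. It is \<open>\<rho>\<close> of the range projection of
  \<open>\<nu> ^ m\<close>, which disappears between the two encodings.\<close>

lemma shifted_mult:
  assumes x: "x \<in> homog k" "k = int m - int n" and y: "y \<in> homog l" "l = int p - int m"
  shows "shifted n m x * shifted m p y = shifted n p (x * y)"
proof -
  define a where "a = \<nu> ^ n * x * star (\<nu> ^ m)"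
  define b where "b = \<nu> ^ m * y * star (\<nu> ^ p)"
  have a: "a \<in> homog 0" and b: "b \<in> homog 0"
    unfolding a_def b_def by (rule shift_homog[OF x] shift_homog[OF y])+
  have h: "\<nu> ^ m * 1 * star (\<nu> ^ m) \<in> homog 0"
    by (rule shift_homog[OF one_homog]) simp
  have "star (W m) * W m = star (W m) * \<rho> 1 * W m"
    by (simp only: mult.assoc unit_W)
  then have WW: "star (W m) * W m = \<rho> (\<nu> ^ m * 1 * star (\<nu> ^ m))"
    by (simp only: W_covariance[OF one_homog])
  have "shifted n m x * shifted m p y = W n * (\<rho> a * (star (W m) * W m) * \<rho> b) * star (W p)"
    unfolding shifted_def a_def b_def by (simp only: mult.assoc)
  also have "\<rho> a * (star (W m) * W m) * \<rho> b = \<rho> (a * (\<nu> ^ m * 1 * star (\<nu> ^ m)) * b)"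
    unfolding WW by (simp only: \<rho>_simps(2) a b h homog_0_mult)
  also have "a * (\<nu> ^ m * 1 * star (\<nu> ^ m)) * b
      = \<nu> ^ n * x * (star (\<nu> ^ m) * \<nu> ^ m) * (star (\<nu> ^ m) * \<nu> ^ m) * y * star (\<nu> ^ p)"
    unfolding a_def b_def by (simp only: mult.assoc mult_1_left mult_1_right)
  also have "\<dots> = \<nu> ^ n * (x * y) * star (\<nu> ^ p)"
    by (simp only: \<nu>_power_isometry mult_1_right mult.assoc)
  finally show ?thesis
    by (simp only: shifted_def)
qed

lemma shifted_star:
  assumes x: "x \<in> homog k" "k = int m - int n"
  shows "star (shifted n m x) = shifted m n (star x)"
proof -
  have "star (shifted n m x) = W m * star (\<rho> (\<nu> ^ n * x * star (\<nu> ^ m))) * star (W n)"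
    by (simp add: shifted_def star_mult star_star mult.assoc)
  also have "star (\<rho> (\<nu> ^ n * x * star (\<nu> ^ m))) = \<rho> (star (\<nu> ^ n * x * star (\<nu> ^ m)))"
    by (simp only: \<rho>_simps(4)[OF shift_homog[OF x]])
  also have "star (\<nu> ^ n * x * star (\<nu> ^ m)) = \<nu> ^ m * star x * star (\<nu> ^ n)"
    by (simp only: star_mult star_star mult.assoc)
  finally show ?thesis
    by (simp only: shifted_def)
qed

text \<open>The least exponents with difference \<open>k\<close>: \<open>nat\<close> truncates, so
  one of them is 0.\<close>

definition ext_homog :: "int \<Rightarrow> 'a \<Rightarrow> 'b" where
  "ext_homog k x = shifted (nat (- k)) (nat k) x"

lemma ext_homog_eq:
  assumes "x \<in> homog k" "k = int m - int n"
  shows "ext_homog k x = shifted n m x"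
proof -
  define j where "j = min n m"
  have "n = nat (- k) + j" "m = nat k + j"
    using assms(2) by (auto simp: j_def)
  then show ?thesis
    using shifted_add[OF assms(1), of "nat k" "nat (- k)" j] by (simp add: ext_homog_def)
qed

lemma ext_homog_mult:
  assumes "x \<in> homog k" "y \<in> homog l"
  shows "ext_homog k x * ext_homog l y = ext_homog (k + l) (x * y)"
proof -
  \<comment> \<open>Large enough that \<open>n + k\<close> and \<open>n + k + l\<close> are natural
    numbers; both factors can then share the exponent \<open>m\<close>.\<close>
  define n where "n = nat (\<bar>k\<bar> + \<bar>l\<bar>)"
  define m where "m = nat (int n + k)"
  define p where "p = nat (int n + k + l)"
  have k: "k = int m - int n" and l: "l = int p - int m" and kl: "k + l = int p - int n"
    by (auto simp: m_def p_def n_def)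
  show ?thesis
    using shifted_mult[OF assms(1) k assms(2) l]
    by (simp only: ext_homog_eq[OF assms(1) k] ext_homog_eq[OF assms(2) l]
        ext_homog_eq[OF homog_mult[OF assms] kl])
qed

lemma ext_homog_star:
  assumes "x \<in> homog k"
  shows "star (ext_homog k x) = ext_homog (- k) (star x)"
  using shifted_star[OF assms, of "nat k" "nat (- k)"] by (simp add: ext_homog_def)

lemma ext_homog_add:
  assumes "x \<in> homog k" "y \<in> homog k"
  shows "ext_homog k (x + y) = ext_homog k x + ext_homog k y"
proof -
  have k: "k = int (nat k) - int (nat (- k))"
    by simp
  show ?thesis
    using \<rho>_simps(1)[OF shift_homog[OF assms(1) k] shift_homog[OF assms(2) k]]
    by (simp add: ext_homog_def shifted_def distrib_left distrib_right)
qed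

lemma ext_homog_scaleC:
  assumes "x \<in> homog k"
  shows "ext_homog k (c *\<^sub>C x) = c *\<^sub>C ext_homog k x"
proof -
  have k: "k = int (nat k) - int (nat (- k))"
    by simp
  show ?thesis
    using \<rho>_simps(3)[OF shift_homog[OF assms(1) k]]
    by (simp add: ext_homog_def shifted_def scaleC_mult_left scaleC_mult_right)
qed

lemma ext_homog_0: "ext_homog k 0 = 0"
  using ext_homog_scaleC[OF complex_vector.subspace_0[OF csubspace_homog], of k 0] by simp

lemma ext_homog_\<rho>: "a \<in> homog 0 \<Longrightarrow> ext_homog 0 a = \<rho> a"
  by (simp add: ext_homog_def shifted_def star_unit unit_\<rho>)

lemma norm_\<rho>_le: "a \<in> homog 0 \<Longrightarrow> norm (\<rho> a) \<le> norm a"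
  by (rule star_hom_on_contractive[OF cstar_subalgebra_homog_0 local_unit_one[OF one_homog] \<rho>])

text \<open>The C*-identity reduces this to \<open>star x * x\<close>, which has degree 0, where
  \<open>\<rho>\<close> is contractive.\<close>

lemma norm_ext_homog_le:
  assumes "x \<in> homog k"
  shows "norm (ext_homog k x) \<le> norm x"
proof -
  have h: "star x * x \<in> homog 0"
    using homog_mult[OF homog_star[OF assms] assms] by simp
  have "star (ext_homog k x) * ext_homog k x = \<rho> (star x * x)"
    using ext_homog_mult[OF homog_star[OF assms] assms]
    by (simp add: ext_homog_star[OF assms] ext_homog_\<rho>[OF h])
  then have "(norm (ext_homog k x))\<^sup>2 \<le> (norm x)\<^sup>2"
    using norm_\<rho>_le[OF h] by (metis cstar_identity)
  then show ?thesis
    by (rule power2_le_imp_le) simp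
qed

text \<open>Summing over the support avoids a choice of degree. An infinite support would give the
  default value 0, but polynomials have finite support.\<close>

definition ext_poly :: "'a \<Rightarrow> 'b" where
  "ext_poly x = (\<Sum>k | component k x \<noteq> 0. ext_homog k (component k x))"

lemma ext_poly_eq:
  assumes "x \<in> poly_deg n"
  shows "ext_poly x = (\<Sum>k\<in>{- int n..int n}. ext_homog k (component k x))"
  unfolding ext_poly_def
proof (rule sum.mono_neutral_left)
  show "{k. component k x \<noteq> 0} \<subseteq> {- int n..int n}"
    using component_poly_deg[OF assms] by blast
qed (auto simp: ext_homog_0)

lemma ext_poly_add:
  assumes "x \<in> poly_deg n" "y \<in> poly_deg n"
  shows "ext_poly (x + y) = ext_poly x + ext_poly y"
proof -
  have xy: "x \<in> A" "y \<in> A"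
    using assms by (auto simp: poly_deg_def)
  show ?thesis
    using ext_poly_eq[OF assms(1)] ext_poly_eq[OF assms(2)]
      ext_poly_eq[OF complex_vector.subspace_add[OF csubspace_poly_deg assms]]
    by (simp add: component_add ext_homog_add[OF component_homog[OF xy(1)] component_homog[OF xy(2)]] sum.distrib)
qed

lemma ext_poly_scaleC:
  assumes "x \<in> poly_deg n"
  shows "ext_poly (c *\<^sub>C x) = c *\<^sub>C ext_poly x"
proof -
  have x: "x \<in> A"
    using assms by (auto simp: poly_deg_def)
  show ?thesis
    using ext_poly_eq[OF assms(1)]
      ext_poly_eq[OF complex_vector.subspace_scale[OF csubspace_poly_deg assms]]
    by (simp add: component_scaleC ext_homog_scaleC[OF component_homog[OF x]] complex_vector.scale_sum_right)
qed

lemma ext_poly_sum: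
  assumes "\<And>i. i \<in> I \<Longrightarrow> f i \<in> poly_deg n"
  shows "ext_poly (\<Sum>i\<in>I. f i) = (\<Sum>i\<in>I. ext_poly (f i))"
  using assms
proof (induction I rule: infinite_finite_induct)
  case (insert i I)
  then have "(\<Sum>i\<in>I. f i) \<in> poly_deg n"
    by (intro complex_vector.subspace_sum[OF csubspace_poly_deg]) auto
  then show ?case
    using insert ext_poly_add[of "f i" n "sum f I"] by simp
qed (use ext_poly_scaleC[OF complex_vector.subspace_0[OF csubspace_poly_deg], of 0] in auto)

lemma ext_poly_homog:
  assumes "x \<in> homog k"
  shows "ext_poly x = ext_homog k x"
proof (cases "x = 0")
  case True
  then show ?thesis
    using component_scaleC[of _ 0 0] by (simp add: ext_poly_def ext_homog_0)
next
  case False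
  then have "{l. component l x \<noteq> 0} = {k}"
    by (auto simp: component_of_homog[OF assms])
  then show ?thesis
    by (simp add: ext_poly_def component_of_homog[OF assms])
qed

lemma ext_poly_mult:
  assumes x: "x \<in> poly_deg n" and y: "y \<in> poly_deg m"
  shows "ext_poly (x * y) = ext_poly x * ext_poly y"
proof -
  have xy: "x = (\<Sum>k\<in>{- int n..int n}. component k x)" "y = (\<Sum>l\<in>{- int m..int m}. component l y)"
    and xyA: "x \<in> A" "y \<in> A"
    using x y by (auto simp: poly_deg_def)
  have deg: "component k x * component l y \<in> poly_deg (n + m)"
    if "k \<in> {- int n..int n}" "l \<in> {- int m..int m}" for k l
    by (rule homog_poly_deg[OF homog_mult[OF component_homog[OF xyA(1)] component_homog[OF xyA(2)]]])
      (use that in auto)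
  have "ext_poly (x * y)
      = ext_poly (\<Sum>k\<in>{- int n..int n}. \<Sum>l\<in>{- int m..int m}. component k x * component l y)"
    using xy by (simp flip: sum_product)
  also have "\<dots> = (\<Sum>k\<in>{- int n..int n}. ext_poly (\<Sum>l\<in>{- int m..int m}. component k x * component l y))"
    by (rule ext_poly_sum[OF complex_vector.subspace_sum[OF csubspace_poly_deg deg]])
  also have "\<dots> = (\<Sum>k\<in>{- int n..int n}. \<Sum>l\<in>{- int m..int m}. ext_poly (component k x * component l y))"
    by (intro sum.cong refl ext_poly_sum[OF deg])
  also have "\<dots> = (\<Sum>k\<in>{- int n..int n}. \<Sum>l\<in>{- int m..int m}.
      ext_homog k (component k x) * ext_homog l (component l y))"
    by (simp only: ext_homog_mult[OF component_homog[OF xyA(1)] component_homog[OF xyA(2)]]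
        ext_poly_homog[OF homog_mult[OF component_homog[OF xyA(1)] component_homog[OF xyA(2)]]])
  also have "\<dots> = ext_poly x * ext_poly y"
    by (simp only: ext_poly_eq[OF x] ext_poly_eq[OF y] sum_product)
  finally show ?thesis .
qed

lemma ext_poly_star:
  assumes x: "x \<in> poly_deg n"
  shows "ext_poly (star x) = star (ext_poly x)"
proof -
  have xe: "x = (\<Sum>k\<in>{- int n..int n}. component k x)" and xA: "x \<in> A"
    using x by (auto simp: poly_deg_def)
  have deg: "star (component k x) \<in> poly_deg n" if "k \<in> {- int n..int n}" for k
    by (rule homog_poly_deg[OF homog_star[OF component_homog[OF xA]]]) (use that in auto)
  have "ext_poly (star x) = ext_poly (\<Sum>k\<in>{- int n..int n}. star (component k x))"
    using xe by (simp flip: star_sum)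
  also have "\<dots> = (\<Sum>k\<in>{- int n..int n}. ext_poly (star (component k x)))"
    by (rule ext_poly_sum[OF deg])
  also have "\<dots> = (\<Sum>k\<in>{- int n..int n}. star (ext_homog k (component k x)))"
    by (simp only: ext_poly_homog[OF homog_star[OF component_homog[OF xA]]]
        ext_homog_star[OF component_homog[OF xA]])
  finally show ?thesis
    by (simp only: ext_poly_eq[OF x] star_sum)
qed

lemma norm_ext_poly_le_linear:
  assumes x: "x \<in> poly_deg n"
  shows "norm (ext_poly x) \<le> (2 * real n + 1) * norm x"
proof -
  have xA: "x \<in> A"
    using x by (auto simp: poly_deg_def)
  have "norm (ext_poly x) \<le> (\<Sum>k\<in>{- int n..int n}. norm x)"
    unfolding ext_poly_eq[OF x]
    by (intro sum_norm_le order_trans[OF norm_ext_homog_le[OF component_homog[OF xA]] norm_component_le])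
  also have "\<dots> = (2 * real n + 1) * norm x"
    by (simp add: nat_add_distrib)
  finally show ?thesis .
qed

text \<open>The bound by the degree is improved by applying it to the powers
  \<open>x\<^bsup>2\<^sup>m\<^esup>\<close>, whose degree only grows linearly in the exponent.\<close>

lemma norm_ext_poly_power_le:
  assumes "x \<in> poly_deg n" "star x = x"
  shows "norm (ext_poly x) ^ (2 ^ m) \<le> (2 * real n * 2 ^ m + 1) * norm x ^ (2 ^ m)"
  using assms
proof (induction m arbitrary: x n)
  case 0
  then show ?case
    using norm_ext_poly_le_linear[of x n] by simp
next
  case (Suc m)
  \<comment> \<open>Passing to \<open>x * x\<close> doubles the degree and squares both norms, so
    the factor for \<open>m\<close> becomes the one for \<open>Suc m\<close>.\<close>
  have xx: "x * x \<in> poly_deg (n + n)" "star (x * x) = x * x"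
    using poly_deg_mult Suc.prems by (auto simp: star_mult)
  have nx: "norm (x * x) = (norm x)\<^sup>2"
    using cstar_identity[of x] Suc.prems by simp
  have "star (ext_poly x) = ext_poly x"
    using ext_poly_star[OF Suc.prems(1)] Suc.prems(2) by simp
  then have ne: "norm (ext_poly (x * x)) = (norm (ext_poly x))\<^sup>2"
    using cstar_identity[of "ext_poly x"] ext_poly_mult[OF Suc.prems(1,1)] by simp
  have "norm (ext_poly (x * x)) ^ (2 ^ m)
      \<le> (2 * real (n + n) * 2 ^ m + 1) * norm (x * x) ^ (2 ^ m)"
    by (rule Suc.IH[OF xx])
  then show ?case
    unfolding nx ne by (simp add: algebra_simps flip: power_mult)
qed

lemma norm_ext_poly_le:
  assumes x: "x \<in> poly_deg n"
  shows "norm (ext_poly x) \<le> norm x"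
proof -
  have y: "star x * x \<in> poly_deg (n + n)" "star (star x * x) = star x * x"
    using poly_deg_mult[OF poly_deg_star[OF x] x] by (auto simp: star_mult star_star)
  have "norm (ext_poly (star x * x)) \<le> norm (star x * x)"
    by (rule le_if_powers_le_linear[OF _ _ norm_ext_poly_power_le[OF y]]) auto
  moreover have "ext_poly (star x * x) = star (ext_poly x) * ext_poly x"
    by (simp only: ext_poly_mult[OF poly_deg_star[OF x] x] ext_poly_star[OF x])
  ultimately have "(norm (ext_poly x))\<^sup>2 \<le> (norm x)\<^sup>2"
    by (simp only: cstar_identity)
  then show ?thesis
    by (rule power2_le_imp_le) simp
qed

lemma star_hom_ext_poly: "star_hom_on polys ext_poly"
  unfolding star_hom_on_def
proof (intro conjI ballI allI)
  fix x y assume "x \<in> polys" "y \<in> polys"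
  then obtain n where n: "x \<in> poly_deg n" "y \<in> poly_deg n"
    by (rule polys_pair)
  show "ext_poly (x + y) = ext_poly x + ext_poly y" "ext_poly (x * y) = ext_poly x * ext_poly y"
    using ext_poly_add[OF n] ext_poly_mult[OF n] by simp_all
next
  fix x c assume "x \<in> polys"
  then obtain n where n: "x \<in> poly_deg n"
    by (auto simp: polys_def)
  show "ext_poly (c *\<^sub>C x) = c *\<^sub>C ext_poly x" "ext_poly (star x) = star (ext_poly x)"
    by (rule ext_poly_scaleC[OF n] ext_poly_star[OF n])+
qed

theorem extension:
  obtains g where "star_hom_on A g" "\<And>a. a \<in> homog 0 \<Longrightarrow> g a = \<rho> a" "g (star \<nu>) = w"
proof -
  have le: "norm (ext_poly x) \<le> norm x" if "x \<in> polys" for x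
    using that norm_ext_poly_le by (auto simp: polys_def)
  obtain g where g: "star_hom_on A g" "\<And>x. x \<in> polys \<Longrightarrow> g x = ext_poly x"
    by (rule star_hom_extend_closure[OF star_subalgebra_polys star_hom_ext_poly le,
          unfolded closure_polys]) (assumption, rule that)
  have "g a = \<rho> a" if "a \<in> homog 0" for a
    by (simp only: g(2)[OF homog_polys[OF that]] ext_poly_homog[OF that] ext_homog_\<rho>[OF that])
  moreover have "g (star \<nu>) = w"
  proof -
    have h: "star \<nu> \<in> homog (- 1)"
      by (rule homog_star) (simp add: homog_def \<nu>_A \<nu>_spectral)
    have h2: "\<nu> * star \<nu> \<in> homog 0"
      using shift_homog[OF one_homog, of 1 1] by simp
    \<comment> \<open>The encoding of \<open>star \<nu>\<close> is
      \<open>\<nu> * star \<nu>\<close>, which decodes to \<open>w * star w * w = w\<close>.\<close>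
    have "g (star \<nu>) = ext_homog (- 1) (star \<nu>)"
      by (simp only: g(2)[OF homog_polys[OF h]] ext_poly_homog[OF h])
    also have "\<dots> = w * \<rho> (\<nu> * star \<nu>)"
      by (simp add: ext_homog_def shifted_def star_unit w_unit mult.assoc unit_\<rho>(2)[OF h2])
    also have "\<rho> (\<nu> * star \<nu>) = star w * (\<rho> 1 * w)"
      using covariance[OF one_homog] by (simp add: mult.assoc)
    also have "w * (star w * (\<rho> 1 * w)) = w * star w * w"
      by (simp only: unit_w mult.assoc)
    finally show ?thesis
      by (simp only: w_star unit_w)
  qed
  ultimately show ?thesis
    using g(1) that by blast
qed

end

section \<open>The action on the Cuntz algebra\<close>

locale min_tensor =
  fixes m :: "'o::unital_cstar_algebra \<Rightarrow> 'g::unital_cstar_algebra \<Rightarrow> 'og::unital_cstar_algebra"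
  assumes min_tensor: "min_tensor_product m"
begin

section \<open>Elementary tensors and the maps g \<otimes> id\<close>

lemma tensor_simps:
  shows tensor_add_left: "m (a + a') b = m a b + m a' b"
    and tensor_add_right: "m a (b + b') = m a b + m a b'"
    and tensor_scaleC_left: "m (c *\<^sub>C a) b = c *\<^sub>C m a b"
    and tensor_scaleC_right: "m a (c *\<^sub>C b) = c *\<^sub>C m a b"
    and tensor_mult: "m a b * m a' b' = m (a * a') (b * b')"
    and tensor_star: "star (m a b) = m (star a) (star b)"
  using min_tensor by (simp_all add: min_tensor_product_def)

lemma tensor_independent:
  assumes "finite F" "\<not> cdependent F" "(\<Sum>a\<in>F. m a (b a)) = 0" "a \<in> F"
  shows "b a = 0"
  using min_tensor assms unfolding min_tensor_product_def by blast

lemma tensor_dense: "closure (cspan (range (\<lambda>(a, b). m a b))) = UNIV"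
  using min_tensor unfolding min_tensor_product_def by blast

lemma tensor_norm_le:
  assumes "cstar_norm_on (cspan (range (\<lambda>(a, b). m a b))) p" "x \<in> cspan (range (\<lambda>(a, b). m a b))"
  shows "norm x \<le> p x"
  using min_tensor assms unfolding min_tensor_product_def by blast

lemma tensor_0_left [simp]: "m 0 b = 0"
  using tensor_scaleC_left[of 0 0 b] by simp

lemma tensor_0_right [simp]: "m a 0 = 0"
  using tensor_scaleC_right[of a 0 0] by simp

lemma tensor_sum_left: "m (\<Sum>i\<in>I. f i) b = (\<Sum>i\<in>I. m (f i) b)"
  by (induction I rule: infinite_finite_induct) (auto simp: tensor_add_left)

lemma tensor_sum_right: "m a (\<Sum>i\<in>I. f i) = (\<Sum>i\<in>I. m a (f i))"
  by (induction I rule: infinite_finite_induct) (auto simp: tensor_add_right)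

text \<open>\<open>m 1 1\<close> acts as the identity on elementary tensors, hence on the closure of
  their span, which contains \<open>1\<close>.\<close>

lemma tensor_one: "m 1 1 = 1"
proof -
  let ?V = "{x. m 1 1 * x = x}"
  have "csubspace ?V"
    by (simp add: complex_vector.subspace_def distrib_left scaleC_mult_right)
  moreover have "closed ?V"
    by (intro closed_Collect_eq continuous_intros)
  moreover have "range (\<lambda>(a, b). m a b) \<subseteq> ?V"
    by (auto simp: tensor_mult)
  ultimately have "closure (cspan (range (\<lambda>(a, b). m a b))) \<subseteq> ?V"
    by (intro closure_minimal complex_vector.span_minimal)
  then have "1 \<in> ?V"
    unfolding tensor_dense by blast
  then show ?thesis
    by simp
qed

lemma star_hom_tensor_left: "star_hom_on UNIV (\<lambda>a. m a 1)"
  by (auto simp: star_hom_on_def tensor_simps)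

text \<open>A list of pairs represents the sum of the corresponding elementary tensors, and
  \<open>tsum g\<close> applies \<open>g \<otimes> id\<close> to it.\<close>

definition tsum :: "('o \<Rightarrow> 'o) \<Rightarrow> ('o \<times> 'g) list \<Rightarrow> 'og" where
  "tsum g xs = (\<Sum>(a, b)\<leftarrow>xs. m (g a) b)"

lemma tsum_append: "tsum g (xs @ ys) = tsum g xs + tsum g ys"
  by (simp add: tsum_def)

lemma tsum_Nil [simp]: "tsum g [] = 0" and tsum_Cons [simp]: "tsum g ((a, b) # xs) = m (g a) b + tsum g xs"
  by (simp_all add: tsum_def)

lemma tsum_scale: "tsum g (map (\<lambda>(a, b). (a, c *\<^sub>C b)) xs) = c *\<^sub>C tsum g xs"
  by (induction xs) (auto simp: tensor_scaleC_right scaleC_add_right)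

lemma tsum_mem: "tsum g xs \<in> cspan (range (\<lambda>(a, b). m a b))"
proof (induction xs)
  case (Cons x xs)
  obtain a b where x: "x = (a, b)"
    by (cases x)
  have "m (g a) b \<in> range (\<lambda>(a, b). m a b)"
    by (rule range_eqI[of _ _ "(g a, b)"]) simp
  then show ?case
    using Cons by (simp add: x complex_vector.span_add complex_vector.span_base)
qed (simp add: complex_vector.span_zero)

lemma ex_tsum:
  assumes "x \<in> cspan (range (\<lambda>(a, b). m a b))"
  shows "\<exists>xs. x = tsum (\<lambda>a. a) xs"
  using assms
proof (induction rule: complex_vector.span_induct_alt)
  case base
  show ?case
    by (rule exI[of _ "[]"]) simp
next
  case (step c y x)
  then obtain a b xs where "y = m a b" "x = tsum (\<lambda>a. a) xs"
    by auto
  then show ?case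
    by (intro exI[of _ "(a, c *\<^sub>C b) # xs"]) (simp add: tensor_scaleC_right)
qed

lemma tsum_star:
  assumes g: "star_hom_on UNIV g"
  shows "tsum g (map (\<lambda>(a, b). (star a, star b)) xs) = star (tsum g xs)"
  by (induction xs) (auto simp: tensor_star star_add star_hom_onD[OF g])

definition tlist_mult :: "('o \<times> 'g) list \<Rightarrow> ('o \<times> 'g) list \<Rightarrow> ('o \<times> 'g) list" where
  "tlist_mult xs ys = map (\<lambda>((a, b), (a', b')). (a * a', b * b')) (List.product xs ys)"

lemma tsum_mult:
  assumes g: "star_hom_on UNIV g"
  shows "tsum g (tlist_mult xs ys) = tsum g xs * tsum g ys"
proof (induction xs)
  case (Cons x xs)
  obtain a b where x: "x = (a, b)"
    by (cases x)
  have "tsum g (map (\<lambda>(a', b'). (a * a', b * b')) ys) = m (g a) b * tsum g ys"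
    by (induction ys) (auto simp: distrib_left tensor_mult star_hom_onD[OF g])
  moreover have "tlist_mult (x # xs) ys = map (\<lambda>(a', b'). (a * a', b * b')) ys @ tlist_mult xs ys"
    by (auto simp: tlist_mult_def x)
  ultimately show ?case
    using Cons by (simp add: tsum_append x distrib_right)
qed (simp add: tlist_mult_def)

text \<open>Well-definedness of \<open>g \<otimes> id\<close> on the algebraic tensor product: after
  expanding the left factors in a basis \<open>B\<close>, independence makes every right coefficient
  vanish, whatever \<open>g\<close> does to \<open>B\<close>.\<close>

lemma tsum_eq_0:
  assumes g: "star_hom_on UNIV g" and 0: "tsum (\<lambda>a. a) xs = 0"
  shows "tsum g xs = 0"
proof -
  obtain B where B: "B \<subseteq> fst ` set xs" "\<not> cdependent B" "fst ` set xs \<subseteq> cspan B"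
    by (rule complex_vector.maximal_independent_subset)
  have fin: "finite B"
    using B(1) by (rule finite_subset) simp
  define c where "c a = (SOME u. a = (\<Sum>v\<in>B. u v *\<^sub>C v))" for a
  have c: "a = (\<Sum>v\<in>B. c a v *\<^sub>C v)" if "a \<in> cspan B" for a
  proof -
    have "\<exists>u. a = (\<Sum>v\<in>B. u v *\<^sub>C v)"
      using that unfolding complex_vector.span_finite[OF fin] by (rule rangeE) (rule exI)
    then show ?thesis
      unfolding c_def by (rule someI_ex)
  qed
  define b where "b ys v = (\<Sum>(a, b)\<leftarrow>ys. c a v *\<^sub>C b)" for ys :: "('o \<times> 'g) list" and v
  \<comment> \<open>The coefficients \<open>b ys v\<close> do not depend on \<open>h\<close>, so the
    expansions for the identity and for \<open>g\<close> have the same right factors.\<close>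
  have expand: "tsum h ys = (\<Sum>v\<in>B. m (h v) (b ys v))"
    if "fst ` set ys \<subseteq> cspan B" and h: "star_hom_on UNIV h" for h ys
    using that(1)
  proof (induction ys)
    case (Cons y ys)
    obtain a x where y: "y = (a, x)"
      by (cases y)
    have "h a = h (\<Sum>v\<in>B. c a v *\<^sub>C v)"
      using c[of a] Cons.prems y by simp
    also have "\<dots> = (\<Sum>v\<in>B. c a v *\<^sub>C h v)"
      by (subst star_hom_on_sum[OF h]) (simp_all add: star_hom_onD[OF h])
    finally have "m (h a) x = (\<Sum>v\<in>B. m (h v) (c a v *\<^sub>C x))"
      by (simp add: tensor_sum_left tensor_scaleC_left tensor_scaleC_right)
    then show ?case
      using Cons by (simp add: y b_def tensor_add_right sum.distrib)
  qed (simp add: b_def)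
  have "star_hom_on UNIV (\<lambda>a. a :: 'o)"
    by (simp add: star_hom_on_def)
  then have "(\<Sum>v\<in>B. m v (b xs v)) = 0"
    using expand[OF B(3)] 0 by simp
  then have "b xs v = 0" if "v \<in> B" for v
    using tensor_independent[OF fin B(2) _ that] by blast
  then show ?thesis
    using expand[OF B(3) g] by simp
qed

lemma tsum_cong:
  assumes g: "star_hom_on UNIV g" and eq: "tsum (\<lambda>a. a) xs = tsum (\<lambda>a. a) ys"
  shows "tsum g xs = tsum g ys"
proof -
  let ?zs = "xs @ map (\<lambda>(a, b). (a, (- 1) *\<^sub>C b)) ys"
  have "tsum (\<lambda>a. a) ?zs = 0"
    unfolding tsum_append tsum_scale eq by simp
  then have "tsum g ?zs = 0"
    by (rule tsum_eq_0[OF g])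
  then show ?thesis
    unfolding tsum_append tsum_scale by simp
qed

text \<open>By minimality, the norm is dominated by its pullback along the injective map
  \<open>g' \<otimes> id\<close>.\<close>

lemma norm_tsum_le:
  assumes g: "star_hom_on UNIV g" and g': "star_hom_on UNIV g'"
    and inverse: "\<And>a. g' (g a) = a" "\<And>a. g (g' a) = a"
  shows "norm (tsum g xs) \<le> norm (tsum (\<lambda>a. a) xs)"
proof -
  let ?D = "cspan (range (\<lambda>(a, b). m a b))"
  have id: "star_hom_on UNIV (\<lambda>a. a :: 'o)"
    by (simp add: star_hom_on_def)
  define r where "r x = (SOME ys. x = tsum (\<lambda>a. a) ys)" for x
  have r: "x = tsum (\<lambda>a. a) (r x)" if "x \<in> ?D" for x
    unfolding r_def by (rule someI_ex[OF ex_tsum[OF that]])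
  \<comment> \<open>The norm pulled back along \<open>g' \<otimes> id\<close>; by
    \<open>tsum_cong\<close> the choice of the representing list does not matter.\<close>
  define p where "p x = norm (tsum g' (r x))" for x
  have p: "p (tsum (\<lambda>a. a) ys) = norm (tsum g' ys)" for ys
    unfolding p_def by (rule arg_cong[OF tsum_cong[OF g' r[OF tsum_mem, symmetric]]])
  have map: "tsum h (map (\<lambda>(a, b). (f a, b)) ys) = tsum (\<lambda>a. h (f a)) ys" for h f ys
    by (induction ys) auto
  have "cstar_norm_on ?D p"
    unfolding cstar_norm_on_def
  proof (intro conjI ballI allI impI)
    fix x y assume "x \<in> ?D" "y \<in> ?D"
    then obtain xs ys where x: "x = tsum (\<lambda>a. a) xs" and y: "y = tsum (\<lambda>a. a) ys"
      using ex_tsum by metis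
    show "p (x + y) \<le> p x + p y"
      unfolding x y tsum_append[symmetric] p unfolding tsum_append by (rule norm_triangle_ineq)
    show "p (x * y) \<le> p x * p y"
      unfolding x y tsum_mult[OF id, symmetric] p unfolding tsum_mult[OF g'] by (rule norm_mult_ineq)
  next
    fix c x assume "x \<in> ?D"
    then obtain xs where x: "x = tsum (\<lambda>a. a) xs"
      using ex_tsum by metis
    show "p (c *\<^sub>C x) = cmod c * p x"
      unfolding x tsum_scale[symmetric] p unfolding tsum_scale by (rule norm_scaleC)
  next
    fix x assume "x \<in> ?D"
    then obtain xs where x: "x = tsum (\<lambda>a. a) xs"
      using ex_tsum by metis
    show "p (star x * x) = (p x)\<^sup>2"
      unfolding x tsum_star[OF id, symmetric] tsum_mult[OF id, symmetric] p
      unfolding tsum_mult[OF g'] tsum_star[OF g'] by (rule cstar_identity)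
    \<comment> \<open>Definiteness of \<open>p\<close>: applying \<open>g \<otimes> id\<close>
      undoes \<open>g' \<otimes> id\<close>.\<close>
    assume "p x = 0"
    then have "tsum (\<lambda>a. a) (map (\<lambda>(a, b). (g' a, b)) xs) = 0"
      unfolding x p map by simp
    from tsum_eq_0[OF g this] show "x = 0"
      unfolding map inverse x .
  qed
  \<comment> \<open>Minimality is evaluated at the image of the given tensor under
    \<open>g \<otimes> id\<close>, where \<open>p\<close> takes the norm of the tensor
    itself.\<close>
  from tensor_norm_le[OF this tsum_mem[of "\<lambda>a. a" "map (\<lambda>(a, b). (g a, b)) xs"]]
  show ?thesis
    unfolding p unfolding map inverse .
qed

end

locale cuntz_coaction = min_tensor m
  for m :: "'o::unital_cstar_algebra \<Rightarrow> 'g::unital_cstar_algebra \<Rightarrow> 'og::unital_cstar_algebra" +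
  fixes S :: "nat \<Rightarrow> 'o" and \<alpha> :: "nat \<Rightarrow> nat \<Rightarrow> 'g" and d :: nat
  assumes cuntz_O: "cuntz_algebra TYPE('o) d S" and cuntz_OG: "cuntz_algebra TYPE('og) d S"
    and unitary1: "i < d \<Longrightarrow> j < d \<Longrightarrow> (\<Sum>k<d. star (\<alpha> k i) * \<alpha> k j) = (if i = j then 1 else 0)"
    and unitary2: "i < d \<Longrightarrow> j < d \<Longrightarrow> (\<Sum>k<d. \<alpha> i k * star (\<alpha> j k)) = (if i = j then 1 else 0)"
begin

section \<open>The coaction and the gauge action\<close>

lemma S_star_S: "i < d \<Longrightarrow> j < d \<Longrightarrow> star (S i) * S j = (if i = j then 1 else 0)"
  and sum_S_star: "(\<Sum>j<d. S j * star (S j)) = 1"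
  and generated_S: "cstar_generated (S ` {..<d}) = UNIV"
  using cuntz_O by (auto simp: cuntz_algebra_def cuntz_family_def)

abbreviation "\<delta> \<equiv> cuntz_action m d S \<alpha>"
abbreviation "\<gamma> \<equiv> gauge_action d S"

text \<open>Orthonormality of the columns of \<open>\<alpha>\<close> makes the images isometries
  with orthogonal ranges; orthonormality of the rows makes their range projections sum to 1.\<close>

lemma action_family: "cuntz_family d (\<lambda>i. \<Sum>j<d. m (S j) (\<alpha> j i))"
  unfolding cuntz_family_def
proof (intro conjI allI impI)
  fix i j assume ij: "i < d" "j < d"
  have "star (\<Sum>k<d. m (S k) (\<alpha> k i)) * (\<Sum>l<d. m (S l) (\<alpha> l j))
      = (\<Sum>k<d. \<Sum>l<d. m (star (S k) * S l) (star (\<alpha> k i) * \<alpha> l j))"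
    by (simp only: star_sum tensor_star sum_product tensor_mult)
  also have "\<dots> = (\<Sum>k<d. \<Sum>l<d. if k = l then m 1 (star (\<alpha> k i) * \<alpha> l j) else 0)"
    by (intro sum.cong refl) (auto simp: S_star_S)
  also have "\<dots> = (\<Sum>k<d. m 1 (star (\<alpha> k i) * \<alpha> k j))"
    by simp
  also have "\<dots> = m 1 (\<Sum>k<d. star (\<alpha> k i) * \<alpha> k j)"
    by (simp only: tensor_sum_right)
  finally show "star (\<Sum>k<d. m (S k) (\<alpha> k i)) * (\<Sum>l<d. m (S l) (\<alpha> l j)) = (if i = j then 1 else 0)"
    by (simp add: unitary1[OF ij] tensor_one)
next
  have "(\<Sum>i<d. (\<Sum>j<d. m (S j) (\<alpha> j i)) * star (\<Sum>k<d. m (S k) (\<alpha> k i)))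
      = (\<Sum>i<d. \<Sum>j<d. \<Sum>k<d. m (S j * star (S k)) (\<alpha> j i * star (\<alpha> k i)))"
    by (simp only: star_sum tensor_star sum_product tensor_mult)
  also have "\<dots> = (\<Sum>j<d. \<Sum>i<d. \<Sum>k<d. m (S j * star (S k)) (\<alpha> j i * star (\<alpha> k i)))"
    by (rule sum.swap)
  also have "\<dots> = (\<Sum>j<d. \<Sum>k<d. \<Sum>i<d. m (S j * star (S k)) (\<alpha> j i * star (\<alpha> k i)))"
    by (intro sum.cong refl sum.swap)
  also have "\<dots> = (\<Sum>j<d. \<Sum>k<d. if j = k then m (S j * star (S k)) 1 else 0)"
    by (intro sum.cong refl) (simp add: unitary2 flip: tensor_sum_right)
  also have "\<dots> = m (\<Sum>j<d. S j * star (S j)) 1"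
    by (simp add: tensor_sum_left)
  finally show "(\<Sum>i<d. (\<Sum>j<d. m (S j) (\<alpha> j i)) * star (\<Sum>j<d. m (S j) (\<alpha> j i))) = 1"
    by (simp add: sum_S_star tensor_one)
qed

lemma action: "unital_star_hom \<delta>" and action_S: "i < d \<Longrightarrow> \<delta> (S i) = (\<Sum>j<d. m (S j) (\<alpha> j i))"
proof -
  have "\<exists>!\<phi>. unital_star_hom \<phi> \<and> (\<forall>i<d. \<phi> (S i) = (\<Sum>j<d. m (S j) (\<alpha> j i)))"
    using cuntz_OG action_family unfolding cuntz_algebra_def by blast
  from theI'[OF this, folded cuntz_action_def]
  show "unital_star_hom \<delta>" "i < d \<Longrightarrow> \<delta> (S i) = (\<Sum>j<d. m (S j) (\<alpha> j i))"
    by auto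
qed

lemma action_hom: "star_hom_on UNIV \<delta>" and action_one: "\<delta> 1 = 1"
  using action by (auto simp: unital_star_hom_def)

lemma gauge_family: 
  assumes "cmod z = 1"
  shows "cuntz_family d (\<lambda>i. z *\<^sub>C S i)"
proof -
  have "cnj z * z = 1" "z * cnj z = 1"
    using assms by (simp_all add: mult.commute flip: complex_norm_square)
  then show ?thesis
    using S_star_S sum_S_star unfolding cuntz_family_def
    by (simp add: star_scaleC scaleC_mult_left scaleC_mult_right scaleC_scaleC scaleC_one)
qed

lemma gauge: "cmod z = 1 \<Longrightarrow> unital_star_hom (\<gamma> z)"
  and gauge_S: "cmod z = 1 \<Longrightarrow> j < d \<Longrightarrow> \<gamma> z (S j) = z *\<^sub>C S j"
proof -
  assume "cmod z = 1"
  then have "\<exists>!\<phi>. unital_star_hom \<phi> \<and> (\<forall>i<d. \<phi> (S i) = z *\<^sub>C S i)"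
    using cuntz_O gauge_family unfolding cuntz_algebra_def by blast
  from theI'[OF this, folded gauge_action_def]
  show "unital_star_hom (\<gamma> z)" "j < d \<Longrightarrow> \<gamma> z (S j) = z *\<^sub>C S j"
    by auto
qed

lemma gauge_hom: "cmod z = 1 \<Longrightarrow> star_hom_on UNIV (\<gamma> z)"
  using gauge by (auto simp: unital_star_hom_def)

text \<open>Both sides are homomorphisms that agree on the generators. This provides the inverse
  pair that \<open>norm_tsum_le\<close> requires.\<close>

lemma gauge_inverse:
  assumes z: "cmod z = 1"
  shows "\<gamma> (cnj z) (\<gamma> z x) = x"
proof -
  have z': "cmod (cnj z) = 1"
    using z by simp
  note homs = star_hom_onD[OF gauge_hom[OF z], OF UNIV_I] star_hom_onD[OF gauge_hom[OF z'], OF UNIV_I]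
    star_hom_onD(1,2)[OF gauge_hom[OF z], OF UNIV_I UNIV_I]
    star_hom_onD(1,2)[OF gauge_hom[OF z'], OF UNIV_I UNIV_I]
  have "star_hom_on UNIV (\<lambda>x. \<gamma> (cnj z) (\<gamma> z x))" "star_hom_on UNIV (\<lambda>x. x :: 'o)"
    by (simp_all add: star_hom_on_def homs)
  then have "cstar_subalgebra {x\<in>UNIV. \<gamma> (cnj z) (\<gamma> z x) = x}"
    by (rule cstar_subalgebra_equalizer[OF cstar_subalgebra_UNIV local_unit_one[OF UNIV_I]])
  moreover have "z * cnj z = 1"
    using z by (simp flip: complex_norm_square)
  then have "S ` {..<d} \<subseteq> {x\<in>UNIV. \<gamma> (cnj z) (\<gamma> z x) = x}"
    using z z' by (auto simp: gauge_S homs scaleC_scaleC scaleC_one mult.commute)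
  ultimately have "cstar_generated (S ` {..<d}) \<subseteq> {x\<in>UNIV. \<gamma> (cnj z) (\<gamma> z x) = x}"
    by (rule cstar_generated_subset(2))
  then show ?thesis
    unfolding generated_S by blast
qed

sublocale circle_action \<gamma>
proof
  show "unital_star_hom (\<gamma> z)" if "cmod z = 1" for z
    using that by (rule gauge)
  let ?H = "{x. \<exists>k::int. \<forall>z. cmod z = 1 \<longrightarrow> \<gamma> z x = (z powi k) *\<^sub>C x}"
  have "S ` {..<d} \<subseteq> ?H"
    by (auto intro!: exI[of _ 1] simp: gauge_S)
  then have "S ` {..<d} \<subseteq> cstar_generated ?H"
    using cstar_generated_subset(1) by (rule order_trans)
  from cstar_generated_subset(2)[OF cstar_subalgebra_generated this]
  show "cstar_generated ?H = UNIV"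
    unfolding generated_S by blast
qed

text \<open>The relation \<open>\<delta> \<circ> \<gamma> z = (\<gamma> z \<otimes> id) \<circ>
  \<delta>\<close> at \<open>y\<close>, expressed through a common list of pairs because
  \<open>\<gamma> z \<otimes> id\<close> is only available on finite sums of elementary
  tensors.\<close>

definition tensorial :: "complex \<Rightarrow> 'o set" where
  "tensorial z = {y. \<exists>xs. \<delta> y = tsum (\<lambda>a. a) xs \<and> \<delta> (\<gamma> z y) = tsum (\<gamma> z) xs}"

lemma star_subalgebra_tensorial:
  assumes z: "cmod z = 1"
  shows "star_subalgebra (tensorial z)"
proof -
  note g = gauge_hom[OF z]
  have id: "star_hom_on UNIV (\<lambda>a. a :: 'o)"
    by (simp add: star_hom_on_def)
  note homs = star_hom_onD[OF g, OF UNIV_I] star_hom_onD[OF action_hom, OF UNIV_I]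
    star_hom_onD(1,2)[OF g, OF UNIV_I UNIV_I] star_hom_onD(1,2)[OF action_hom, OF UNIV_I UNIV_I]
  have 0: "\<delta> 0 = 0" "\<gamma> z 0 = 0"
    using star_hom_on_0[OF g] star_hom_on_0[OF action_hom] by simp_all
  show ?thesis
    unfolding star_subalgebra_def complex_vector.subspace_def
  proof (intro conjI ballI allI)
    show "0 \<in> tensorial z"
      unfolding tensorial_def by (intro CollectI exI[of _ "[]"]) (simp add: 0)
  next
    fix x y assume "x \<in> tensorial z" "y \<in> tensorial z"
    then obtain xs ys where x: "\<delta> x = tsum (\<lambda>a. a) xs" "\<delta> (\<gamma> z x) = tsum (\<gamma> z) xs"
      and y: "\<delta> y = tsum (\<lambda>a. a) ys" "\<delta> (\<gamma> z y) = tsum (\<gamma> z) ys"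
      unfolding tensorial_def by blast
    show "x + y \<in> tensorial z"
      unfolding tensorial_def
      by (intro CollectI exI[of _ "xs @ ys"]) (simp add: homs x y tsum_append)
    show "x * y \<in> tensorial z"
      unfolding tensorial_def
      by (intro CollectI exI[of _ "tlist_mult xs ys"]) (simp add: homs x y tsum_mult[OF id] tsum_mult[OF g])
  next
    fix c x assume "x \<in> tensorial z"
    then obtain xs where x: "\<delta> x = tsum (\<lambda>a. a) xs" "\<delta> (\<gamma> z x) = tsum (\<gamma> z) xs"
      unfolding tensorial_def by blast
    show "c *\<^sub>C x \<in> tensorial z"
      unfolding tensorial_def
      by (intro CollectI exI[of _ "map (\<lambda>(a, b). (a, c *\<^sub>C b)) xs"]) (simp add: homs x tsum_scale)
    show "star x \<in> tensorial z"
      unfolding tensorial_def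
      by (intro CollectI exI[of _ "map (\<lambda>(a, b). (star a, star b)) xs"])
        (simp add: homs x tsum_star[OF id] tsum_star[OF g])
  qed
qed

lemma closure_tensorial:
  assumes z: "cmod z = 1"
  shows "closure (tensorial z) = UNIV"
proof -
  have "S i \<in> tensorial z" if i: "i < d" for i
  proof -
    have upt: "tsum h (map (\<lambda>j. (S j, \<alpha> j i)) [0..<k]) = (\<Sum>j<k. m (h (S j)) (\<alpha> j i))" for h k
      by (induction k) (simp_all add: tsum_append)
    have "\<delta> (\<gamma> z (S i)) = z *\<^sub>C (\<Sum>j<d. m (S j) (\<alpha> j i))"
      using star_hom_onD(3)[OF action_hom UNIV_I] by (simp add: gauge_S[OF z i] action_S[OF i])
    also have "\<dots> = tsum (\<gamma> z) (map (\<lambda>j. (S j, \<alpha> j i)) [0..<d])"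
      unfolding upt
      by (simp add: gauge_S[OF z] complex_vector.scale_sum_right tensor_scaleC_left)
    finally show ?thesis
      unfolding tensorial_def
      by (intro CollectI exI[of _ "map (\<lambda>j. (S j, \<alpha> j i)) [0..<d]"]) (simp add: upt action_S[OF i])
  qed
  then have "S ` {..<d} \<subseteq> closure (tensorial z)"
    using closure_subset by blast
  from cstar_generated_subset(2)[OF star_subalgebra_closure[OF star_subalgebra_tensorial[OF z]] this]
  show ?thesis
    unfolding generated_S by blast
qed

section \<open>Gauge invariance of the fixed algebra\<close>

abbreviation "O\<alpha> \<equiv> fixed_algebra m d S \<alpha>"

lemma cstar_subalgebra_fixed: "cstar_subalgebra O\<alpha>"
proof -
  have "O\<alpha> = {x\<in>UNIV. \<delta> x = m x 1}"
    by (auto simp: fixed_algebra_def)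
  then show ?thesis
    using cstar_subalgebra_equalizer[OF cstar_subalgebra_UNIV local_unit_one[OF UNIV_I]
        action_hom star_hom_tensor_left] by simp
qed

lemma one_fixed: "1 \<in> O\<alpha>"
  by (simp add: fixed_algebra_def action_one tensor_one)

text \<open>Formally \<open>\<gamma> z \<otimes> id\<close> maps \<open>\<delta> x - m x 1\<close>
  to \<open>\<delta> (\<gamma> z x) - m (\<gamma> z x) 1\<close> without increasing the norm. As it
  acts on finite sums only, the inequality is proved for tensorial \<open>Y n\<close> and passed to
  the limit \<open>x\<close>.\<close>

lemma gauge_fixed:
  assumes z: "cmod z = 1" and x: "x \<in> O\<alpha>"
  shows "\<gamma> z x \<in> O\<alpha>"
proof -
  note cont = star_hom_on_tendsto[OF cstar_subalgebra_UNIV local_unit_one[OF UNIV_I] _ UNIV_I]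
  note cont_left = cont[OF star_hom_tensor_left] and cont_action = cont[OF action_hom]
  have "x \<in> closure (tensorial z)"
    unfolding closure_tensorial[OF z] by (rule UNIV_I)
  then obtain Y where Y: "\<And>n. Y n \<in> tensorial z" "Y \<longlonglongrightarrow> x"
    unfolding closure_sequential by auto
  have z': "cmod (cnj z) = 1"
    using z by simp
  have "norm (\<delta> (\<gamma> z (Y n)) - m (\<gamma> z (Y n)) 1) \<le> norm (\<delta> (Y n) - m (Y n) 1)" for n
  proof -
    obtain xs where xs: "\<delta> (Y n) = tsum (\<lambda>a. a) xs" "\<delta> (\<gamma> z (Y n)) = tsum (\<gamma> z) xs"
      using Y(1)[of n] unfolding tensorial_def by blast
    let ?xs = "xs @ map (\<lambda>(a, b). (a, (- 1) *\<^sub>C b)) [(Y n, 1)]"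
    have "tsum h ?xs = tsum h xs - m (h (Y n)) 1" for h
      unfolding tsum_append tsum_scale by simp
    then show ?thesis
      using norm_tsum_le[OF gauge_hom[OF z] gauge_hom[OF z'] gauge_inverse[OF z], of ?xs]
        gauge_inverse[OF z'] by (simp add: xs)
  qed
  moreover have "(\<lambda>n. norm (\<delta> (Y n) - m (Y n) 1)) \<longlonglongrightarrow> norm (\<delta> x - m x 1)"
    by (intro tendsto_norm tendsto_diff cont_left[OF Y(2)] cont_action[OF Y(2)])
  moreover have "(\<lambda>n. norm (\<delta> (\<gamma> z (Y n)) - m (\<gamma> z (Y n)) 1))
      \<longlonglongrightarrow> norm (\<delta> (\<gamma> z x) - m (\<gamma> z x) 1)"
    by (intro tendsto_norm tendsto_diff cont_left[OF cont[OF gauge_hom[OF z] Y(2)]]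
        cont_action[OF cont[OF gauge_hom[OF z] Y(2)]])
  ultimately have "norm (\<delta> (\<gamma> z x) - m (\<gamma> z x) 1) \<le> norm (\<delta> x - m x 1)"
    by (intro LIMSEQ_le) auto
  also have "\<dots> = 0"
    using x by (simp add: fixed_algebra_def)
  finally have "norm (\<delta> (\<gamma> z x) - m (\<gamma> z x) 1) \<le> 0" .
  then show ?thesis
    by (simp add: fixed_algebra_def)
qed

end

section \<open>The invariant isometry\<close>

lemma cstar_subalgebra_Int:
  "cstar_subalgebra A \<Longrightarrow> cstar_subalgebra B \<Longrightarrow> cstar_subalgebra (A \<inter> B)"
  by (auto simp: cstar_subalgebra_def star_subalgebra_def complex_vector.subspace_inter)

text \<open>With \<open>c\<close> below \<open>1 / \<parallel>T'\<parallel>\<^sup>2\<close>, the positive elements \<open>1 - t T\<^sup>*T\<close> and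
  \<open>t (T\<^sup>*T - c)\<close> have square roots \<open>k\<close> and \<open>g\<close>, and add up to \<open>1 - t c\<close>.
  The isometries \<open>S0\<close>, \<open>S1\<close> turn the pair \<open>(k, g)\<close> into the single element
  \<open>S0 k + S1 g\<close>, so that \<open>\<parallel>k\<parallel>\<^sup>2 \<le> 1 - t c\<close>.\<close>

lemma ex_norm_one_minus_less:
  fixes T T' S0 S1 :: "'a::unital_cstar_algebra"
  assumes T': "T' * T = 1"
    and S: "star S0 * S0 = 1" "star S1 * S1 = 1" "star S0 * S1 = 0"
  shows "\<exists>t>0. norm (1 - t *\<^sub>R (star T * T)) < 1"
proof -
  note UNIV_unit = cstar_subalgebra_UNIV local_unit_one[OF UNIV_I]
  \<comment> \<open>The summand 1 keeps the denominators positive and the norms of \<open>x\<close>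
    and \<open>y\<close> strictly below 1, as the binomial series requires.\<close>
  define t where "t = 1 / ((norm T)\<^sup>2 + 1)"
  define c where "c = 1 / ((norm T')\<^sup>2 + 1)"
  have pos: "(norm T)\<^sup>2 + 1 > 0" "(norm T')\<^sup>2 + 1 > 0"
    by (simp_all add: add_nonneg_pos)
  have t: "t > 0" "t \<le> 1" and c: "c > 0" "c \<le> 1"
    using pos by (simp_all add: t_def c_def)
  define x where "x = t *\<^sub>R (star T * T)"
  define y where "y = c *\<^sub>R (star T' * T')"
  have x: "norm x < 1" "star x = x"
    using pos by (simp_all add: x_def t_def cstar_identity star_scaleR star_mult star_star)
  have y: "norm y < 1" "star y = y"
    using pos by (simp_all add: y_def c_def cstar_identity star_scaleR star_mult star_star)
  define k where "k = binom_series 1 (1 / 2) x"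
  define q where "q = binom_series 1 (1 / 2) y"
  have k: "star k = k" "k * k = 1 - x"
    unfolding k_def using binom_series_star[OF UNIV_unit x(1) UNIV_I x(2)]
      binom_series_add[OF UNIV_unit x(1) UNIV_I, of "1/2" "1/2"] binom_series_1[OF UNIV_unit UNIV_I]
    by simp_all
  have q: "star q = q" "q * q = 1 - y"
    unfolding q_def using binom_series_star[OF UNIV_unit y(1) UNIV_I y(2)]
      binom_series_add[OF UNIV_unit y(1) UNIV_I, of "1/2" "1/2"] binom_series_1[OF UNIV_unit UNIV_I]
    by simp_all
  have "star T * y * T = c *\<^sub>R (star (T' * T) * (T' * T))"
    by (simp add: y_def star_mult mult.assoc)
  then have yT: "star T * (y * T) = c *\<^sub>R 1"
    by (simp add: T' mult.assoc)
  \<comment> \<open>\<open>star g * g\<close> is \<open>t\<close> times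
    \<open>star T * (1 - y) * T\<close>, and \<open>star T * y * T\<close> is the scalar
    \<open>c\<close> because \<open>T' * T = 1\<close>: this is how the left inverse bounds
    \<open>star T * T\<close> from below.\<close>
  define g where "g = sqrt t *\<^sub>R (q * T)"
  have "star g * g = t *\<^sub>R (star T * ((q * q) * T))"
    using t by (simp add: g_def star_scaleR star_mult q(1) mult.assoc)
  also have "\<dots> = x - (t * c) *\<^sub>R 1"
    unfolding q(2) by (simp add: x_def yT left_diff_distrib right_diff_distrib scaleR_diff_right)
  finally have g: "star g * g = x - (t * c) *\<^sub>R 1" .
  define X where "X = S0 * k + S1 * g"
  have S10: "star S1 * S0 = 0"
    using S(3) by (metis star_mult star_star star_zero)
  have S0k: "star S0 * X = k"
    by (simp add: X_def distrib_left S flip: mult.assoc)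
  have S1g: "star S1 * X = g"
    by (simp add: X_def distrib_left S S10 flip: mult.assoc)
  have "star X * X = star k * (star S0 * X) + star g * (star S1 * X)"
    unfolding mult.assoc[symmetric] star_mult[symmetric] distrib_right[symmetric]
      star_add[symmetric] X_def[symmetric] by (rule refl)
  also have "\<dots> = (1 - t * c) *\<^sub>R 1"
    by (simp add: S0k S1g k g scaleR_left_diff_distrib)
  finally have "(norm X)\<^sup>2 = \<bar>1 - t * c\<bar> * norm (1 :: 'a)"
    using cstar_identity[of X] by simp
  also have "\<dots> \<le> \<bar>1 - t * c\<bar>"
    using mult_left_mono[OF norm_one_le[where 'a='a], of "\<bar>1 - t * c\<bar>"] by simp
  also have "\<dots> < 1"
    using t c mult_le_one[of t c] by simp
  finally have X: "(norm X)\<^sup>2 < 1" .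
  have "norm k \<le> norm (star S0) * norm X"
    using norm_mult_ineq[of "star S0" X] S0k by simp
  also have "\<dots> \<le> norm X"
    using mult_right_mono[OF norm_isometry_le[OF S(1)], of "norm X"] by simp
  finally have "(norm k)\<^sup>2 < 1"
    using power_mono[of "norm k" "norm X" 2] X by (meson norm_ge_zero order_le_less_trans)
  moreover have "norm (1 - x) = (norm k)\<^sup>2"
    using cstar_identity[of k] by (simp add: k)
  ultimately show ?thesis
    using t unfolding x_def by auto
qed

text \<open>Polar decomposition: \<open>t *\<^sub>R (star T * T) = 1 - y\<close>, so the inverse
  square root is the binomial series in \<open>y\<close> with exponent -1/2. It lies in
  \<open>A\<close> because \<open>A\<close> is closed, and it commutes with
  \<open>star T * T\<close>.\<close>

lemma ex_inverse_sqrt: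
  fixes T :: "'a::unital_cstar_algebra"
  assumes A: "cstar_subalgebra A" "1 \<in> A" "star T * T \<in> A"
    and t: "t > 0" "norm (1 - t *\<^sub>R (star T * T)) < 1"
  shows "\<exists>r\<in>A. star (T * r) * (T * r) = 1"
proof -
  note unit = A(1) local_unit_one[OF A(2)]
  define h where "h = star T * T"
  define y where "y = 1 - t *\<^sub>R h"
  have sub: "csubspace A"
    using A(1) by (auto simp: cstar_subalgebra_def star_subalgebra_def)
  have h: "star h = h"
    by (simp add: h_def star_mult star_star)
  have y: "norm y < 1" "y \<in> A" "star y = y"
    using t A(3) h unfolding y_def h_def
    by (auto intro!: complex_vector.subspace_diff[OF sub] A(2) csubspace_scaleR[OF sub]
        simp: star_diff star_scaleR)
  have hA: "h \<in> A" and comm: "y * h = h * y"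
    using A(3) by (simp_all add: h_def y_def algebra_simps)
  define r where "r = binom_series 1 (- 1 / 2) y"
  have r: "r \<in> A" "star r = r" "r * h = h * r"
    unfolding r_def using binom_series_mem[OF unit y(1,2)] binom_series_star[OF unit y]
      binom_series_commute[OF unit y(1,2) hA comm] by simp_all
  have "r * r * (1 - y) = binom_series 1 (- 1) y * binom_series 1 1 y"
    unfolding r_def binom_series_add[OF unit y(1,2)] binom_series_1[OF unit y(2)] by simp
  also have "\<dots> = 1"
    unfolding binom_series_add[OF unit y(1,2)] by (simp add: binom_series_0[OF unit])
  finally have rr: "t *\<^sub>R (r * r * h) = 1"
    by (simp add: y_def)
  have "star (T * (sqrt t *\<^sub>R r)) * (T * (sqrt t *\<^sub>R r)) = t *\<^sub>R (r * (h * r))"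
    using t by (simp add: star_mult star_scaleR r(2) h_def mult.assoc)
  also have "\<dots> = 1"
    using rr by (simp add: r(3)[symmetric] mult.assoc)
  finally show ?thesis
    using csubspace_scaleR[OF sub r(1)] by blast
qed

text \<open>\<open>W\<close> is the product of \<open>F\<close> and \<open>U\<close>, and
  \<open>W'\<close> that of \<open>V\<close> and the adjoint of \<open>F\<close>. As the equivalence
  \<open>U\<close> need not be unitary, \<open>W\<close> is only left invertible; hence the later
  passage to an isometry.\<close>

lemma contained_in_intertwiner:
  assumes "contained_in J \<beta> I \<gamma>" "finite I" "finite J"
  obtains W W' where
    "\<And>j k. j \<in> J \<Longrightarrow> k \<in> J \<Longrightarrow> (\<Sum>i\<in>I. W' j i * W i k) = (if j = k then 1 else 0 :: complex)"
    "\<And>i k. i \<in> I \<Longrightarrow> k \<in> J \<Longrightarrow> (\<Sum>v\<in>I. W v k *\<^sub>C \<gamma> i v) = (\<Sum>u\<in>J. W i u *\<^sub>C \<beta> u k)"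
proof -
  obtain M :: "nat set" and F \<sigma>
    where sub: "subrepresentation I \<gamma> M F \<sigma>" and eq: "equivalent_reps J \<beta> M \<sigma>"
    using assms(1) unfolding contained_in_def by (elim exE conjE)
  have M: "finite M"
    and F: "\<And>m n. m \<in> M \<Longrightarrow> n \<in> M \<Longrightarrow> (\<Sum>i\<in>I. cnj (F i m) * F i n) = (if m = n then 1 else 0)"
    and F\<sigma>: "\<And>i n. i \<in> I \<Longrightarrow> n \<in> M \<Longrightarrow> (\<Sum>j\<in>I. F j n *\<^sub>C \<gamma> i j) = (\<Sum>m\<in>M. F i m *\<^sub>C \<sigma> m n)"
    using sub by (simp_all only: subrepresentation_def)
  obtain U V
    where VU: "\<forall>j\<in>J. \<forall>k\<in>J. (\<Sum>m\<in>M. V j m * U m k) = (if j = k then 1 else 0 :: complex)"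
    and U\<beta>: "\<forall>m\<in>M. \<forall>j\<in>J. (\<Sum>k\<in>J. U m k *\<^sub>C \<beta> k j) = (\<Sum>n\<in>M. U n j *\<^sub>C \<sigma> m n)"
    using eq unfolding equivalent_reps_def by (elim exE conjE)
  define W where "W i k = (\<Sum>m\<in>M. F i m * U m k)" for i k
  define W' where "W' j i = (\<Sum>m\<in>M. V j m * cnj (F i m))" for j i
  show ?thesis
  proof (rule that[of W' W])
    fix j k assume jk: "j \<in> J" "k \<in> J"
    have "(\<Sum>i\<in>I. W' j i * W i k)
        = (\<Sum>i\<in>I. \<Sum>m\<in>M. \<Sum>n\<in>M. V j m * (cnj (F i m) * F i n) * U n k)"
      unfolding W_def W'_def sum_product by (simp add: mult_ac)
    also have "\<dots> = (\<Sum>m\<in>M. \<Sum>i\<in>I. \<Sum>n\<in>M. V j m * (cnj (F i m) * F i n) * U n k)"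
      by (rule sum.swap)
    also have "\<dots> = (\<Sum>m\<in>M. \<Sum>n\<in>M. \<Sum>i\<in>I. V j m * (cnj (F i m) * F i n) * U n k)"
      by (intro sum.cong refl sum.swap)
    also have "\<dots> = (\<Sum>m\<in>M. \<Sum>n\<in>M. if m = n then V j m * U n k else 0)"
      by (intro sum.cong refl) (simp add: F flip: sum_distrib_left sum_distrib_right)
    also have "\<dots> = (\<Sum>m\<in>M. V j m * U m k)"
      using M by simp
    finally show "(\<Sum>i\<in>I. W' j i * W i k) = (if j = k then 1 else 0)"
      by (simp add: VU jk)
  next
    fix i k assume ik: "i \<in> I" "k \<in> J"
    have "(\<Sum>v\<in>I. W v k *\<^sub>C \<gamma> i v) = (\<Sum>v\<in>I. \<Sum>m\<in>M. U m k *\<^sub>C F v m *\<^sub>C \<gamma> i v)"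
      by (simp add: W_def complex_vector.scale_sum_left scaleC_scaleC mult.commute)
    also have "\<dots> = (\<Sum>m\<in>M. \<Sum>v\<in>I. U m k *\<^sub>C F v m *\<^sub>C \<gamma> i v)"
      by (rule sum.swap)
    also have "\<dots> = (\<Sum>m\<in>M. U m k *\<^sub>C (\<Sum>v\<in>I. F v m *\<^sub>C \<gamma> i v))"
      by (simp only: complex_vector.scale_sum_right)
    also have "\<dots> = (\<Sum>m\<in>M. U m k *\<^sub>C (\<Sum>n\<in>M. F i n *\<^sub>C \<sigma> n m))"
      by (intro sum.cong refl) (simp add: F\<sigma>[OF ik(1)])
    also have "\<dots> = (\<Sum>m\<in>M. \<Sum>n\<in>M. F i n *\<^sub>C U m k *\<^sub>C \<sigma> n m)"
      by (simp add: complex_vector.scale_sum_right scaleC_scaleC mult.commute)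
    also have "\<dots> = (\<Sum>n\<in>M. \<Sum>m\<in>M. F i n *\<^sub>C U m k *\<^sub>C \<sigma> n m)"
      by (rule sum.swap)
    also have "\<dots> = (\<Sum>n\<in>M. F i n *\<^sub>C (\<Sum>m\<in>M. U m k *\<^sub>C \<sigma> n m))"
      by (simp only: complex_vector.scale_sum_right)
    also have "\<dots> = (\<Sum>n\<in>M. F i n *\<^sub>C (\<Sum>u\<in>J. U n u *\<^sub>C \<beta> u k))"
      by (intro sum.cong refl) (simp add: U\<beta> ik(2))
    also have "\<dots> = (\<Sum>n\<in>M. \<Sum>u\<in>J. (F i n * U n u) *\<^sub>C \<beta> u k)"
      by (simp add: complex_vector.scale_sum_right scaleC_scaleC)
    also have "\<dots> = (\<Sum>u\<in>J. \<Sum>n\<in>M. (F i n * U n u) *\<^sub>C \<beta> u k)"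
      by (rule sum.swap)
    finally show "(\<Sum>v\<in>I. W v k *\<^sub>C \<gamma> i v) = (\<Sum>u\<in>J. W i u *\<^sub>C \<beta> u k)"
      by (simp add: W_def complex_vector.scale_sum_left)
  qed
qed

section \<open>Words and scalars\<close>

lemma finite_words: "finite (words d n)"
proof -
  have "words d n = {w. set w \<subseteq> {..<d} \<and> length w = n}"
    by (auto simp: words_def)
  then show ?thesis
    by (simp add: finite_lists_length_eq)
qed

lemma words_0 [simp]: "words d 0 = {[]}"
  by (auto simp: words_def)

lemma words_Suc: "words d (Suc n) = (\<lambda>(i, w). i # w) ` ({..<d} \<times> words d n)"
  by (auto simp: words_def length_Suc_conv image_iff)

lemma sum_words_Suc: "(\<Sum>w\<in>words d (Suc n). f w) = (\<Sum>i<d. \<Sum>w\<in>words d n. f (i # w))"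
proof -
  have "inj_on (\<lambda>(i, w). i # w) ({..<d} \<times> words d n)"
    by (auto simp: inj_on_def)
  then show ?thesis
    by (simp add: words_Suc sum.reindex sum.cartesian_product case_prod_unfold)
qed

lemma rep_power_simps [simp]:
  "rep_power \<alpha> [] [] = 1" "rep_power \<alpha> (i # v) (j # w) = \<alpha> i j * rep_power \<alpha> v w"
  by (simp_all add: rep_power_def)

definition scalars :: "'a::unital_cstar_algebra set" where
  "scalars = range (\<lambda>c. c *\<^sub>C 1)"

lemma scalars_mem [simp, intro]: "c *\<^sub>C 1 \<in> scalars"
  unfolding scalars_def by (rule rangeI)

lemma csubspace_scalars: "csubspace scalars"
  unfolding complex_vector.subspace_def scalars_def
proof (intro conjI ballI allI)
  show "0 \<in> range (\<lambda>c. c *\<^sub>C (1 :: 'a))"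
    by (rule range_eqI[of _ _ 0]) simp
  show "x + y \<in> range (\<lambda>c. c *\<^sub>C 1)"
    if "x \<in> range (\<lambda>c. c *\<^sub>C 1)" "y \<in> range (\<lambda>c. c *\<^sub>C 1)" for x y :: 'a
    using that by (auto simp flip: scaleC_add_left)
  show "c *\<^sub>C x \<in> range (\<lambda>c. c *\<^sub>C 1)" if "x \<in> range (\<lambda>c. c *\<^sub>C 1)" for c and x :: 'a
    using that by (auto simp: scaleC_scaleC)
qed

lemma closed_scalars: "closed (scalars :: 'a::unital_cstar_algebra set)"
proof (cases "(1 :: 'a) = 0")
  case True
  then have "range (\<lambda>c. c *\<^sub>C (1 :: 'a)) = {0}"
    by auto
  then show ?thesis
    unfolding scalars_def by simp
next
  case False
  have "norm (1 :: 'a) = (norm (1 :: 'a))\<^sup>2"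
    using cstar_identity[of "1 :: 'a"] by simp
  then have norm: "norm (1 :: 'a) = 1"
    using False by (simp add: power2_eq_square)
  have lin: "bounded_linear (\<lambda>c. c *\<^sub>C (1 :: 'a))"
    by (rule bounded_linear_intro[where K=1])
      (auto simp: scaleC_add_left scaleR_scaleC scaleC_scaleC norm_scaleC norm scaleR_conv_of_real)
  have "complete (range (\<lambda>c. c *\<^sub>C (1 :: 'a)))"
    by (rule complete_isometric_image[of 1 UNIV, OF _ _ lin])
      (auto simp: norm_scaleC norm complete_UNIV)
  then show ?thesis
    unfolding scalars_def by (rule complete_imp_closed)
qed

context cuntz_coaction
begin

section \<open>The bimodules described by matrix coefficients\<close>

definition Sw :: "nat list \<Rightarrow> 'o" where
  "Sw w = prod_list (map S w)"

lemma Sw_simps [simp]: "Sw [] = 1" "Sw (i # w) = S i * Sw w"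
  by (simp_all add: Sw_def)

lemma star_Sw: "star (Sw w) = prod_list (map (\<lambda>j. star (S j)) (rev w))"
  by (induction w) (simp_all add: star_mult)

lemma Sw_star_Sw:
  "v \<in> words d n \<Longrightarrow> w \<in> words d n \<Longrightarrow> star (Sw v) * Sw w = (if v = w then 1 else 0)"
proof (induction n arbitrary: v w)
  case (Suc n)
  then obtain i v' j w' where v: "v = i # v'" "i < d" "v' \<in> words d n"
    and w: "w = j # w'" "j < d" "w' \<in> words d n"
    by (auto simp: words_Suc)
  have "star (Sw v) * Sw w = star (Sw v') * (star (S i) * S j) * Sw w'"
    by (simp add: v w star_mult mult.assoc)
  also have "\<dots> = (if i = j then star (Sw v') * Sw w' else 0)"
    by (simp add: S_star_S[OF v(2) w(2)])
  also have "\<dots> = (if v = w then 1 else 0)"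
    unfolding Suc.IH[OF v(3) w(3)] by (simp add: v(1) w(1))
  finally show ?case .
qed simp

lemma sum_Sw_star: "(\<Sum>w\<in>words d n. Sw w * star (Sw w)) = 1"
proof (induction n)
  case (Suc n)
  have "(\<Sum>w\<in>words d (Suc n). Sw w * star (Sw w))
      = (\<Sum>i<d. S i * (\<Sum>w\<in>words d n. Sw w * star (Sw w)) * star (S i))"
    by (simp add: sum_words_Suc star_mult sum_distrib_left sum_distrib_right mult.assoc)
  then show ?case
    by (simp add: Suc sum_S_star)
qed simp

lemma expand_right: "x = (\<Sum>w\<in>words d n. x * Sw w * star (Sw w))"
  using sum_Sw_star[of n] by (simp add: mult.assoc flip: sum_distrib_left)

lemma expand_left: "x = (\<Sum>w\<in>words d n. Sw w * (star (Sw w) * x))"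
  using sum_Sw_star[of n] by (simp flip: sum_distrib_right mult.assoc)

lemma action_Sw:
  "v \<in> words d n \<Longrightarrow> \<delta> (Sw v) = (\<Sum>w\<in>words d n. m (Sw w) (rep_power \<alpha> w v))"
proof (induction n arbitrary: v)
  case 0
  then show ?case
    by (simp add: action_one tensor_one)
next
  case (Suc n)
  then obtain i v' where v: "v = i # v'" "i < d" "v' \<in> words d n"
    by (auto simp: words_Suc)
  have "\<delta> (Sw v) = (\<Sum>j<d. m (S j) (\<alpha> j i)) * (\<Sum>w\<in>words d n. m (Sw w) (rep_power \<alpha> w v'))"
    by (simp add: v(1) star_hom_onD(2)[OF action_hom UNIV_I UNIV_I] action_S[OF v(2)] Suc.IH[OF v(3)])
  then show ?case
    by (simp add: sum_words_Suc sum_product tensor_mult v(1))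
qed

text \<open>The products \<open>Sw v\<close> obey the relations of an orthonormal basis, so these
  are the matrix coefficients of \<open>x\<close>. The criterion gives closedness, products and
  adjoints of the bimodules without induction over spans.\<close>

lemma bimodule_iff:
  "x \<in> cuntz_bimodule d S l k \<longleftrightarrow>
    (\<forall>v\<in>words d l. \<forall>w\<in>words d k. star (Sw v) * x * Sw w \<in> scalars)"
proof
  assume x: "x \<in> cuntz_bimodule d S l k"
  show "\<forall>v\<in>words d l. \<forall>w\<in>words d k. star (Sw v) * x * Sw w \<in> scalars"
  proof (intro ballI)
    fix v w assume vw: "v \<in> words d l" "w \<in> words d k"
    let ?V = "{x. star (Sw v) * x * Sw w \<in> scalars}"
    have "csubspace ?V"
      using csubspace_scalars[where 'a='o]
      unfolding complex_vector.subspace_def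
      by (simp add: distrib_left distrib_right scaleC_mult_left scaleC_mult_right)
    moreover have "{prod_list (map S v) * prod_list (map (\<lambda>j. star (S j)) w) |v w.
        v \<in> words d l \<and> w \<in> words d k} \<subseteq> ?V"
    proof safe
      fix v' w' assume v': "v' \<in> words d l" and w': "w' \<in> words d k"
      \<comment> \<open>\<open>star\<close> reverses words, while the definition of the bimodule
        lists the letters of \<open>w'\<close> in their given order.\<close>
      have rw': "rev w' \<in> words d k"
        using w' by (simp add: words_def)
      have "star (Sw v) * (prod_list (map S v') * prod_list (map (\<lambda>j. star (S j)) w')) * Sw w
          = (star (Sw v) * Sw v') * (star (Sw (rev w')) * Sw w)"
        by (simp add: star_Sw mult.assoc flip: Sw_def)
      also have "\<dots> = (if v = v' \<and> rev w' = w then 1 else 0) *\<^sub>C 1"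
        using Sw_star_Sw[OF vw(1) v'] Sw_star_Sw[OF rw' vw(2)] by (simp add: scaleC_one)
      finally show "star (Sw v) * (prod_list (map S v') * prod_list (map (\<lambda>j. star (S j)) w')) * Sw w \<in> scalars"
        by (simp only: scalars_mem)
    qed
    ultimately have "cuntz_bimodule d S l k \<subseteq> ?V"
      unfolding cuntz_bimodule_def by (rule complex_vector.span_minimal[rotated])
    then show "star (Sw v) * x * Sw w \<in> scalars"
      using x by blast
  qed
next
  assume "\<forall>v\<in>words d l. \<forall>w\<in>words d k. star (Sw v) * x * Sw w \<in> scalars"
  then have ex: "\<exists>c. star (Sw v) * x * Sw w = c *\<^sub>C 1" if "v \<in> words d l" "w \<in> words d k" for v w
    using that unfolding scalars_def by blast
  define c where "c v w = (SOME c. star (Sw v) * x * Sw w = c *\<^sub>C 1)" for v w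
  have c: "star (Sw v) * x * Sw w = c v w *\<^sub>C 1" if "v \<in> words d l" "w \<in> words d k" for v w
    unfolding c_def by (rule someI_ex[OF ex[OF that]])
  have "x = (\<Sum>v\<in>words d l. Sw v * (star (Sw v) * x))"
    by (rule expand_left)
  also have "\<dots> = (\<Sum>v\<in>words d l. Sw v * (star (Sw v) * (\<Sum>w\<in>words d k. x * Sw w * star (Sw w))))"
    by (simp only: expand_right[of x k, symmetric])
  also have "\<dots> = (\<Sum>v\<in>words d l. \<Sum>w\<in>words d k. Sw v * (star (Sw v) * x * Sw w) * star (Sw w))"
    by (simp add: sum_distrib_left mult.assoc)
  also have "\<dots> = (\<Sum>v\<in>words d l. \<Sum>w\<in>words d k. c v w *\<^sub>C (Sw v * star (Sw w)))"
    by (intro sum.cong refl) (simp add: c scaleC_mult_left scaleC_mult_right)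
  also have "\<dots> \<in> cuntz_bimodule d S l k"
    unfolding cuntz_bimodule_def
  proof (intro complex_vector.span_sum complex_vector.span_scale complex_vector.span_base CollectI exI conjI)
    fix v w assume "v \<in> words d l" "w \<in> words d k"
    then show "v \<in> words d l" "rev w \<in> words d k"
      by (auto simp: words_def)
    show "Sw v * star (Sw w) = prod_list (map S v) * prod_list (map (\<lambda>j. star (S j)) (rev w))"
      by (simp add: star_Sw) (simp add: Sw_def)
  qed
  finally show "x \<in> cuntz_bimodule d S l k" .
qed

lemma csubspace_bimodule: "csubspace (cuntz_bimodule d S l k)"
  by (simp add: cuntz_bimodule_def complex_vector.subspace_span)

lemma closed_bimodule: "closed (cuntz_bimodule d S l k)"
proof -
  have "cuntz_bimodule d S l k
      = (\<Inter>v\<in>words d l. \<Inter>w\<in>words d k. {x. star (Sw v) * x * Sw w \<in> scalars})"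
    using bimodule_iff[of _ l k] by blast
  moreover have "closed {x. star (Sw v) * x * Sw w \<in> scalars}" for v w
  proof -
    have "closed ((\<lambda>x. star (Sw v) * x * Sw w) -` scalars)"
      by (rule closed_vimage[OF closed_scalars]) (intro continuous_intros)
    then show ?thesis
      by (simp add: vimage_def)
  qed
  ultimately show ?thesis
    by (auto intro!: closed_INT)
qed

lemma bimodule_mult:
  assumes x: "x \<in> cuntz_bimodule d S l k" and y: "y \<in> cuntz_bimodule d S k p"
  shows "x * y \<in> cuntz_bimodule d S l p"
  unfolding bimodule_iff
proof (intro ballI)
  fix v w assume v: "v \<in> words d l" and w: "w \<in> words d p"
  have "\<forall>u\<in>words d k. \<exists>c. star (Sw v) * x * Sw u = c *\<^sub>C 1"
    using x v unfolding bimodule_iff scalars_def by blast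
  then obtain f where f: "\<forall>u\<in>words d k. star (Sw v) * x * Sw u = f u *\<^sub>C 1"
    unfolding bchoice_iff by (rule exE)
  have "\<forall>u\<in>words d k. \<exists>c. star (Sw u) * y * Sw w = c *\<^sub>C 1"
    using y w unfolding bimodule_iff scalars_def by blast
  then obtain g where g: "\<forall>u\<in>words d k. star (Sw u) * y * Sw w = g u *\<^sub>C 1"
    unfolding bchoice_iff by (rule exE)
  have "star (Sw v) * (x * y) * Sw w = star (Sw v) * x * (y * Sw w)"
    by (simp only: mult.assoc)
  also have "star (Sw v) * x = (\<Sum>u\<in>words d k. star (Sw v) * x * Sw u * star (Sw u))"
    by (rule expand_right)
  also have "(\<Sum>u\<in>words d k. star (Sw v) * x * Sw u * star (Sw u)) * (y * Sw w)
      = (\<Sum>u\<in>words d k. (star (Sw v) * x * Sw u) * (star (Sw u) * (y * Sw w)))"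
    by (simp only: sum_distrib_right mult.assoc)
  also have "\<dots> = (\<Sum>u\<in>words d k. (star (Sw v) * x * Sw u) * (star (Sw u) * y * Sw w))"
    by (simp only: mult.assoc)
  also have "\<dots> = (\<Sum>u\<in>words d k. f u * g u) *\<^sub>C 1"
    by (simp add: f g scaleC_mult_left scaleC_scaleC complex_vector.scale_sum_left)
  finally show "star (Sw v) * (x * y) * Sw w \<in> scalars"
    by (simp only: scalars_mem)
qed

lemma bimodule_star:
  assumes x: "x \<in> cuntz_bimodule d S l k"
  shows "star x \<in> cuntz_bimodule d S k l"
  unfolding bimodule_iff
proof (intro ballI)
  fix v w assume "v \<in> words d k" "w \<in> words d l"
  then obtain c where c: "star (Sw w) * x * Sw v = c *\<^sub>C 1"
    using x unfolding bimodule_iff scalars_def by blast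
  have "star (Sw v) * star x * Sw w = star (star (Sw w) * x * Sw v)"
    by (simp add: star_mult star_star mult.assoc)
  also have "\<dots> = cnj c *\<^sub>C 1"
    by (simp add: c star_scaleC)
  finally show "star (Sw v) * star x * Sw w \<in> scalars"
    by (simp only: scalars_mem)
qed

lemma one_bimodule: "1 \<in> cuntz_bimodule d S k k"
  unfolding bimodule_iff
proof (intro ballI)
  fix v w assume "v \<in> words d k" "w \<in> words d k"
  then have "star (Sw v) * 1 * Sw w = (if v = w then 1 else 0) *\<^sub>C 1"
    by (simp add: Sw_star_Sw scaleC_one)
  then show "star (Sw v) * 1 * Sw w \<in> scalars"
    by (simp only: scalars_mem)
qed

text \<open>Spanned by matrix units indexed by words of length \<open>k\<close>. The inverse square
  root is taken in here, so that multiplying by it preserves the bimodule.\<close>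

lemma cstar_subalgebra_bimodule: "cstar_subalgebra (cuntz_bimodule d S k k)"
  unfolding cstar_subalgebra_def star_subalgebra_def
  using csubspace_bimodule closed_bimodule bimodule_mult bimodule_star by blast

lemma S_spectral: "i < d \<Longrightarrow> S i \<in> spectral 1"
  by (simp add: spectral_def gauge_S)

lemma Sw_spectral: "w \<in> words d n \<Longrightarrow> Sw w \<in> spectral (int n)"
proof (induction n arbitrary: w)
  case 0
  then show ?case
    by (simp add: one_spectral)
next
  case (Suc n)
  then obtain i w' where w: "w = i # w'" "i < d" "w' \<in> words d n"
    by (auto simp: words_Suc)
  show ?case
    using spectral_mult[OF S_spectral[OF w(2)] Suc.IH[OF w(3)]] by (simp add: w(1))
qed

lemma bimodule_spectral: "cuntz_bimodule d S l k \<subseteq> spectral (int l - int k)"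
  unfolding cuntz_bimodule_def
proof (rule complex_vector.span_minimal[OF _ csubspace_spectral], safe)
  fix v w assume v: "v \<in> words d l" and w: "w \<in> words d k"
  have rw: "rev w \<in> words d k"
    using w by (simp add: words_def)
  have "Sw v * star (Sw (rev w)) \<in> spectral (int l + - int k)"
    by (rule spectral_mult[OF Sw_spectral[OF v] spectral_star[OF Sw_spectral[OF rw]]])
  then show "prod_list (map S v) * prod_list (map (\<lambda>j. star (S j)) w) \<in> spectral (int l - int k)"
    by (simp add: star_Sw) (simp add: Sw_def)
qed

definition word_mat :: "nat \<Rightarrow> nat \<Rightarrow> (nat list \<Rightarrow> nat list \<Rightarrow> complex) \<Rightarrow> 'o" where
  "word_mat l k C = (\<Sum>w\<in>words d k. (\<Sum>v\<in>words d l. C v w *\<^sub>C Sw v) * star (Sw w))"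

lemma word_mat_Sw:
  assumes "u \<in> words d k"
  shows "word_mat l k C * Sw u = (\<Sum>v\<in>words d l. C v u *\<^sub>C Sw v)"
proof -
  have "word_mat l k C * Sw u
      = (\<Sum>w\<in>words d k. (\<Sum>v\<in>words d l. C v w *\<^sub>C Sw v) * (star (Sw w) * Sw u))"
    by (simp add: word_mat_def sum_distrib_right mult.assoc)
  also have "\<dots> = (\<Sum>w\<in>words d k. if w = u then \<Sum>v\<in>words d l. C v w *\<^sub>C Sw v else 0)"
    by (intro sum.cong refl) (simp add: Sw_star_Sw assms)
  finally show ?thesis
    using assms finite_words by simp
qed

lemma word_mat_bimodule: "word_mat l k C \<in> cuntz_bimodule d S l k"
  unfolding bimodule_iff
proof (intro ballI)
  fix v w assume v: "v \<in> words d l" and w: "w \<in> words d k"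
  have "star (Sw v) * word_mat l k C * Sw w = (\<Sum>u\<in>words d l. C u w *\<^sub>C (star (Sw v) * Sw u))"
    by (simp add: mult.assoc word_mat_Sw[OF w] sum_distrib_left scaleC_mult_right)
  also have "\<dots> = (\<Sum>u\<in>words d l. if v = u then C u w *\<^sub>C 1 else 0)"
    by (intro sum.cong refl) (simp add: Sw_star_Sw[OF v])
  also have "\<dots> = C v w *\<^sub>C 1"
    using v finite_words by simp
  finally show "star (Sw v) * word_mat l k C * Sw w \<in> scalars"
    by (simp only: scalars_mem)
qed

lemma word_mat_left_inverse:
  assumes "\<And>j k. j \<in> words d k' \<Longrightarrow> k \<in> words d k' \<Longrightarrow>
    (\<Sum>i\<in>words d l. W' j i * W i k) = (if j = k then 1 else 0)"
  shows "word_mat k' l W' * word_mat l k' W = 1"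
proof -
  have "word_mat k' l W' * word_mat l k' W * Sw u = Sw u" if u: "u \<in> words d k'" for u
  proof -
    have "word_mat k' l W' * word_mat l k' W * Sw u
        = (\<Sum>v\<in>words d l. W v u *\<^sub>C (\<Sum>w\<in>words d k'. W' w v *\<^sub>C Sw w))"
      by (simp add: mult.assoc word_mat_Sw[OF u] sum_distrib_left scaleC_mult_right word_mat_Sw)
    also have "\<dots> = (\<Sum>v\<in>words d l. \<Sum>w\<in>words d k'. (W' w v * W v u) *\<^sub>C Sw w)"
      by (simp add: complex_vector.scale_sum_right scaleC_scaleC mult.commute)
    also have "\<dots> = (\<Sum>w\<in>words d k'. \<Sum>v\<in>words d l. (W' w v * W v u) *\<^sub>C Sw w)"
      by (rule sum.swap)
    also have "\<dots> = (\<Sum>w\<in>words d k'. if w = u then Sw w else 0)"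
      by (intro sum.cong refl)
        (simp add: assms[OF _ u] scaleC_one flip: complex_vector.scale_sum_left)
    finally show ?thesis
      using u finite_words by simp
  qed
  then have "word_mat k' l W' * word_mat l k' W = (\<Sum>u\<in>words d k'. Sw u * star (Sw u))"
    using expand_right[of "word_mat k' l W' * word_mat l k' W" k'] by simp
  then show ?thesis
    by (simp add: sum_Sw_star)
qed

text \<open>\<open>W\<close> intertwines the two tensor powers, so \<open>\<delta> T\<close> and
  \<open>m T 1\<close> have the same product with every \<open>\<delta> (Sw u)\<close>. The range
  projections of the latter sum to 1, so these factors can be cancelled.\<close>

lemma word_mat_fixed:
  assumes W: "\<And>i u. i \<in> words d l \<Longrightarrow> u \<in> words d k \<Longrightarrow>
    (\<Sum>v\<in>words d l. W v u *\<^sub>C rep_power \<alpha> i v) = (\<Sum>u'\<in>words d k. W i u' *\<^sub>C rep_power \<alpha> u' u)"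
  shows "word_mat l k W \<in> O\<alpha>"
proof -
  let ?T = "word_mat l k W"
  note hom_sum = star_hom_on_sum[OF action_hom complex_vector.subspace_UNIV UNIV_I]
  note hom = star_hom_onD[OF action_hom, OF UNIV_I] star_hom_onD(2)[OF action_hom UNIV_I UNIV_I]
  have *: "\<delta> (?T * Sw u) = m ?T 1 * \<delta> (Sw u)" if u: "u \<in> words d k" for u
  proof -
    have "\<delta> (?T * Sw u) = (\<Sum>v\<in>words d l. \<Sum>i\<in>words d l. m (Sw i) (W v u *\<^sub>C rep_power \<alpha> i v))"
      by (simp add: word_mat_Sw[OF u] hom_sum hom action_Sw complex_vector.scale_sum_right
          tensor_scaleC_right)
    also have "\<dots> = (\<Sum>i\<in>words d l. \<Sum>v\<in>words d l. m (Sw i) (W v u *\<^sub>C rep_power \<alpha> i v))"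
      by (rule sum.swap)
    also have "\<dots> = (\<Sum>i\<in>words d l. m (Sw i) (\<Sum>v\<in>words d l. W v u *\<^sub>C rep_power \<alpha> i v))"
      by (simp only: tensor_sum_right)
    also have "\<dots> = (\<Sum>i\<in>words d l. m (Sw i) (\<Sum>u'\<in>words d k. W i u' *\<^sub>C rep_power \<alpha> u' u))"
      by (intro sum.cong refl) (simp add: W[OF _ u])
    also have "\<dots> = (\<Sum>i\<in>words d l. \<Sum>u'\<in>words d k. m (W i u' *\<^sub>C Sw i) (rep_power \<alpha> u' u))"
      by (simp add: tensor_sum_right tensor_scaleC_left tensor_scaleC_right)
    also have "\<dots> = (\<Sum>u'\<in>words d k. \<Sum>i\<in>words d l. m (W i u' *\<^sub>C Sw i) (rep_power \<alpha> u' u))"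
      by (rule sum.swap)
    also have "\<dots> = (\<Sum>u'\<in>words d k. m (?T * Sw u') (rep_power \<alpha> u' u))"
      by (intro sum.cong refl) (simp add: word_mat_Sw tensor_sum_left)
    also have "\<dots> = m ?T 1 * \<delta> (Sw u)"
      by (simp add: action_Sw[OF u] sum_distrib_left tensor_mult)
    finally show ?thesis .
  qed
  have "\<delta> ?T = (\<Sum>u\<in>words d k. \<delta> (?T * Sw u) * star (\<delta> (Sw u)))"
    by (subst expand_right[of ?T k]) (simp add: hom_sum hom)
  also have "\<dots> = (\<Sum>u\<in>words d k. m ?T 1 * \<delta> (Sw u) * star (\<delta> (Sw u)))"
    by (intro sum.cong refl) (simp only: *)
  also have "\<dots> = m ?T 1 * (\<Sum>u\<in>words d k. \<delta> (Sw u * star (Sw u)))"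
    by (simp add: hom sum_distrib_left mult.assoc)
  also have "(\<Sum>u\<in>words d k. \<delta> (Sw u * star (Sw u))) = 1"
    by (simp add: sum_Sw_star action_one flip: hom_sum)
  finally show ?thesis
    by (simp add: fixed_algebra_def)
qed

text \<open>For \<open>d = 1\<close> there is no room for two isometries with orthogonal ranges, but then
  \<open>T\<^sup>*T\<close> is a scalar.\<close>

lemma ex_norm_one_minus_less_bimodule:
  assumes T: "T \<in> cuntz_bimodule d S l k" and T': "T' * T = 1"
  shows "\<exists>t>0. norm (1 - t *\<^sub>R (star T * T)) < 1"
proof -
  consider "d = 0" | "d = 1" | "d \<ge> 2"
    by linarith
  then show ?thesis
  proof cases
    case 1
    \<comment> \<open>For \<open>d = 0\<close> the sum of range projections is empty, so the algebra
      is zero.\<close>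
    then have "(1 :: 'o) = 0"
      using sum_S_star by simp
    then have "x = 0" for x :: 'o
      by (metis mult_1_left mult_zero_left)
    then show ?thesis
      by (metis norm_zero zero_less_one)
  next
    case 2
    define v w where "v = replicate l (0 :: nat)" and "w = replicate k (0 :: nat)"
    have words1: "words d n = {replicate n 0}" for n
      by (induction n) (auto simp: words_Suc 2)
    have v: "v \<in> words d l" and w: "w \<in> words d k"
      by (simp_all add: words1 v_def w_def)
    obtain c where c: "star (Sw v) * T * Sw w = c *\<^sub>C 1"
      using T v w unfolding bimodule_iff scalars_def by blast
    \<comment> \<open>With a single generator there is one word of each length, so
      \<open>Sw v\<close> and \<open>Sw w\<close> are unitary.\<close>
    have v1: "Sw v * (star (Sw v) * x) = x" for x
      using expand_left[of x l] by (simp add: words1 v_def)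
    have w1: "x * Sw w * star (Sw w) = x" for x
      using expand_right[of x k] by (simp add: words1 w_def)
    have "T = Sw v * (star (Sw v) * T * Sw w) * star (Sw w)"
      using v1[of "T * Sw w"] w1[of T] by (simp add: mult.assoc)
    then have T_eq: "T = c *\<^sub>C (Sw v * star (Sw w))"
      by (simp add: c scaleC_mult_left scaleC_mult_right)
    have "star T * T = (cnj c * c) *\<^sub>C (Sw w * (star (Sw v) * Sw v) * star (Sw w))"
      by (simp add: T_eq star_scaleC star_mult star_star scaleC_mult_left scaleC_mult_right
          scaleC_scaleC mult.assoc)
    also have "\<dots> = (cnj c * c) *\<^sub>C 1"
      using w1[of 1] by (simp add: Sw_star_Sw[OF v v])
    also have "cnj c * c = complex_of_real ((cmod c)\<^sup>2)"
      by (simp only: complex_norm_square mult.commute)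
    finally have TT: "star T * T = (cmod c)\<^sup>2 *\<^sub>R 1"
      by (simp only: scaleR_scaleC)
    show ?thesis
    proof (cases "c = 0")
      case True
      then have "(1 :: 'o) = 0"
        using T' T_eq by simp
      then show ?thesis
        by (intro exI[of _ 1]) (simp add: TT True)
    next
      case False
      then show ?thesis
        by (intro exI[of _ "1 / (cmod c)\<^sup>2"]) (simp add: TT)
    qed
  next
    case 3
    then show ?thesis
      by (intro ex_norm_one_minus_less[OF T', of "S 0" "S 1"]) (simp_all add: S_star_S)
  qed
qed

lemma ex_isometry:
  assumes "contained_in (words d n) (rep_power \<alpha>) (words d l) (rep_power \<alpha>)"
  shows "\<exists>\<nu>\<in>cuntz_bimodule d S l n \<inter> O\<alpha>. star \<nu> * \<nu> = 1"
proof -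
  obtain W W' where
    W: "\<And>j k. j \<in> words d n \<Longrightarrow> k \<in> words d n \<Longrightarrow>
        (\<Sum>i\<in>words d l. W' j i * W i k) = (if j = k then 1 else 0)"
      "\<And>i k. i \<in> words d l \<Longrightarrow> k \<in> words d n \<Longrightarrow>
        (\<Sum>v\<in>words d l. W v k *\<^sub>C rep_power \<alpha> i v) = (\<Sum>u\<in>words d n. W i u *\<^sub>C rep_power \<alpha> u k)"
    by (rule contained_in_intertwiner[OF assms finite_words finite_words]) (rule that)
  define T where "T = word_mat l n W"
  have T: "T \<in> cuntz_bimodule d S l n" "T \<in> O\<alpha>" "word_mat n l W' * T = 1"
    unfolding T_def by (rule word_mat_bimodule) (rule word_mat_fixed[OF W(2)] word_mat_left_inverse[OF W(1)], assumption+)+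
  have closed: "x * y \<in> O\<alpha>" "star x \<in> O\<alpha>" if "x \<in> O\<alpha>" "y \<in> O\<alpha>" for x y
    using that cstar_subalgebra_fixed by (auto simp: cstar_subalgebra_def star_subalgebra_def)
  obtain t where t: "t > 0" "norm (1 - t *\<^sub>R (star T * T)) < 1"
    using ex_norm_one_minus_less_bimodule[OF T(1,3)] by blast
  have TT: "star T * T \<in> cuntz_bimodule d S n n \<inter> O\<alpha>"
    by (intro IntI bimodule_mult[OF bimodule_star[OF T(1)] T(1)] closed(1)[OF closed(2)[OF T(2,2)] T(2)])
  \<comment> \<open>The inverse square root is formed in the intersection, so \<open>T * r\<close>
    stays both invariant and in the bimodule.\<close>
  obtain r where r: "r \<in> cuntz_bimodule d S n n \<inter> O\<alpha>" "star (T * r) * (T * r) = 1"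
    using ex_inverse_sqrt[OF cstar_subalgebra_Int[OF cstar_subalgebra_bimodule cstar_subalgebra_fixed]
        IntI[OF one_bimodule one_fixed] TT t] by (rule bexE)
  have "T * r \<in> cuntz_bimodule d S l n \<inter> O\<alpha>"
    by (intro IntI bimodule_mult[OF T(1) IntD1[OF r(1)]] closed(1)[OF T(2) IntD2[OF r(1)]])
  with r(2) show ?thesis
    by (rule bexI)
qed

end

section \<open>Pimsner algebras\<close>

text \<open>Serves to see that a homomorphism maps a generated algebra into \<open>P\<close> once it
  does so on the generators.\<close>

lemma cstar_subalgebra_vimage:
  assumes A: "cstar_subalgebra A" and e: "local_unit e A" and f: "star_hom_on A f" and P: "cstar_subalgebra P"
  shows "cstar_subalgebra {x\<in>A. f x \<in> P}"
proof -
  have sub: "csubspace A" "\<And>x y. x \<in> A \<Longrightarrow> y \<in> A \<Longrightarrow> x * y \<in> A" "\<And>x. x \<in> A \<Longrightarrow> star x \<in> A"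
    and cl: "closed A"
    using A by (auto simp: cstar_subalgebra_def star_subalgebra_def)
  have P': "csubspace P" "\<And>x y. x \<in> P \<Longrightarrow> y \<in> P \<Longrightarrow> x * y \<in> P" "\<And>x. x \<in> P \<Longrightarrow> star x \<in> P"
    and cl': "closed P"
    using P by (auto simp: cstar_subalgebra_def star_subalgebra_def)
  have "csubspace {x\<in>A. f x \<in> P}"
    using sub(1) P'(1) star_hom_onD[OF f] star_hom_on_0[OF f sub(1)]
    unfolding complex_vector.subspace_def by auto
  moreover have "closed {x\<in>A. f x \<in> P}"
    unfolding closed_sequential_limits
  proof (intro allI impI, elim conjE)
    fix X x assume X: "\<forall>n. X n \<in> {x\<in>A. f x \<in> P}" "X \<longlonglongrightarrow> x"
    have lim: "(\<lambda>n. f (X n)) \<longlonglongrightarrow> f x"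
      by (rule star_hom_on_tendsto[OF A e f _ X(2)]) (use X(1) in simp)
    have "f x \<in> P"
      by (rule closed_sequentially[OF cl' _ lim]) (use X(1) in simp)
    moreover have "x \<in> A"
      by (rule closed_sequentially[OF cl _ X(2)]) (use X(1) in simp)
    ultimately show "x \<in> {x\<in>A. f x \<in> P}"
      by simp
  qed
  ultimately show ?thesis
    using sub P' star_hom_onD[OF f] by (auto simp: cstar_subalgebra_def star_subalgebra_def)
qed

text \<open>The elements on which \<open>e\<close> acts as a unit form a C*-subalgebra. This turns
  \<open>\<pi> 1\<close> into a unit of an abstract Pimsner algebra, whose type may have
  none.\<close>

lemma local_unit_generated:
  assumes P: "cstar_subalgebra P" "cstar_generated X = P"
    and e: "e \<in> P" "star e = e" and X: "\<And>x. x \<in> X \<Longrightarrow> e * x = x \<and> x * e = x"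
  shows "local_unit e P"
proof -
  let ?Q = "{x\<in>P. e * x = x \<and> x * e = x}"
  have sub: "csubspace P" "\<And>x y. x \<in> P \<Longrightarrow> y \<in> P \<Longrightarrow> x * y \<in> P" "\<And>x. x \<in> P \<Longrightarrow> star x \<in> P"
    and cl: "closed P"
    using P(1) by (auto simp: cstar_subalgebra_def star_subalgebra_def)
  have "csubspace ?Q"
    using sub(1) unfolding complex_vector.subspace_def
    by (auto simp: distrib_left distrib_right scaleC_mult_left scaleC_mult_right)
  moreover have "?Q = P \<inter> ({x. e * x = x} \<inter> {x. x * e = x})"
    by blast
  then have "closed ?Q"
    by (simp only:) (intro closed_Int cl closed_Collect_eq continuous_intros)
  moreover have "x * y \<in> ?Q" if "x \<in> ?Q" "y \<in> ?Q" for x y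
    using that sub(2) by (simp add: mult.assoc) (simp flip: mult.assoc)
  moreover have "star x \<in> ?Q" if "x \<in> ?Q" for x
    using that sub(3) e(2) by (metis (mono_tags, lifting) mem_Collect_eq star_mult)
  ultimately have "cstar_subalgebra ?Q"
    by (simp only: cstar_subalgebra_def star_subalgebra_def) blast
  moreover have "X \<subseteq> ?Q"
    using cstar_generated_subset(1)[of X] P(2) X by blast
  ultimately have "P \<subseteq> ?Q"
    unfolding P(2)[symmetric] by (rule cstar_generated_subset(2))
  then show ?thesis
    using e(1) by (auto simp: local_unit_def)
qed

context graded_isometry
begin

section \<open>The correspondence and its universal property\<close>

abbreviation E :: "('a, 'a) correspondence" where
  "E \<equiv> isometry_correspondence (homog 0) \<nu>"

text \<open>The module of all \<open>star \<nu> * a\<close> with \<open>a\<close> of degree 0: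
  membership becomes a condition on \<open>\<nu> * \<xi>\<close>, from which
  \<open>\<xi> = star \<nu> * (\<nu> * \<xi>)\<close> is recovered.\<close>

definition vecs :: "'a set" where
  "vecs = {\<xi>. \<nu> * \<xi> \<in> homog 0}"

lemma isometry_left: "star \<nu> * (\<nu> * x) = x"
  by (simp add: isometry flip: mult.assoc)

lemma homog_0_closed:
  shows "a \<in> homog 0 \<Longrightarrow> b \<in> homog 0 \<Longrightarrow> a * b \<in> homog 0"
    and "a \<in> homog 0 \<Longrightarrow> star a \<in> homog 0"
    and "a \<in> homog 0 \<Longrightarrow> \<nu> * a * star \<nu> \<in> homog 0"
  using homog_mult[of a 0 b 0] homog_star[of a 0] shift_homog[of a 0 1 1] by simp_all

lemma vectors_E: "vectors E = vecs"
proof -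
  have "star \<nu> * a \<in> vecs" if "a \<in> homog 0" for a
    using homog_0_closed(1)[OF homog_0_closed(3)[OF one_homog] that] by (simp add: vecs_def mult.assoc)
  moreover have "\<xi> \<in> (\<lambda>T. star \<nu> * T) ` homog 0" if "\<xi> \<in> vecs" for \<xi>
    using that by (intro image_eqI[of _ _ "\<nu> * \<xi>"]) (simp_all add: vecs_def isometry_left)
  ultimately show ?thesis
    unfolding isometry_correspondence_def by auto
qed

lemma E_simps: "coeffs E = homog 0" "right_act E = (*)" "inner_prod E = (\<lambda>\<xi> \<eta>. star \<xi> * \<eta>)"
    "left_act E = (*)"
  by (simp_all add: isometry_correspondence_def)

lemma star_\<nu>_vecs: "star \<nu> \<in> vecs"
  using homog_0_closed(3)[OF one_homog] by (simp add: vecs_def)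

lemma vecs_subset: "\<xi> \<in> vecs \<Longrightarrow> \<xi> \<in> A"
proof -
  assume "\<xi> \<in> vecs"
  then have "star \<nu> * (\<nu> * \<xi>) \<in> A"
    by (intro A_closed(2)[OF A_closed(3)[OF \<nu>_A]]) (simp add: vecs_def homog_def)
  then show ?thesis
    by (simp only: isometry_left)
qed

lemma csubspace_vecs: "csubspace vecs"
  using csubspace_homog[of 0] unfolding complex_vector.subspace_def vecs_def
  by (simp add: distrib_left scaleC_mult_right)

lemma closed_vecs: "closed vecs"
proof -
  have "closed ((\<lambda>\<xi>. \<nu> * \<xi>) -` homog 0)"
    using cstar_subalgebra_homog_0 unfolding cstar_subalgebra_def
    by (intro closed_vimage) (auto intro: continuous_intros)
  then show ?thesis
    by (simp add: vecs_def vimage_def)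
qed

lemma vecs_right: "\<xi> \<in> vecs \<Longrightarrow> a \<in> homog 0 \<Longrightarrow> \<xi> * a \<in> vecs"
  using homog_0_closed(1)[of "\<nu> * \<xi>" a] by (simp add: vecs_def mult.assoc)

lemma vecs_left: 
  assumes "a \<in> homog 0" "\<xi> \<in> vecs"
  shows "a * \<xi> \<in> vecs"
proof -
  have "\<nu> * a * star \<nu> * (\<nu> * \<xi>) \<in> homog 0"
    using assms by (intro homog_0_closed(1)[OF homog_0_closed(3)]) (simp_all add: vecs_def)
  then show ?thesis
    by (simp add: vecs_def mult.assoc isometry_left)
qed

lemma vecs_inner: 
  assumes "\<xi> \<in> vecs" "\<eta> \<in> vecs"
  shows "star \<xi> * \<eta> \<in> homog 0"
proof -
  have "star (\<nu> * \<xi>) * (\<nu> * \<eta>) \<in> homog 0"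
    using assms by (intro homog_0_closed(1)[OF homog_0_closed(2)]) (simp_all add: vecs_def)
  then show ?thesis
    by (simp add: star_mult mult.assoc isometry_left)
qed

text \<open>The vector itself has degree -1, whereas the positivity witness must lie in the
  coefficient algebra; \<open>\<nu> * \<xi>\<close> does.\<close>

lemma vecs_inner_self: "\<xi> \<in> vecs \<Longrightarrow> \<exists>a\<in>homog 0. star \<xi> * \<xi> = star a * a"
  by (rule bexI[of _ "\<nu> * \<xi>"]) (simp_all add: vecs_def star_mult mult.assoc isometry_left)

text \<open>By the C*-identity the module norm is the norm of the algebra, so completeness follows
  from closedness of \<open>vecs\<close>.\<close>

lemma vecs_complete:
  assumes x: "\<And>n. x n \<in> vecs"
    and cauchy: "\<forall>e>0. \<exists>k::nat. \<forall>m\<ge>k. \<forall>n\<ge>k. sqrt (norm (star (x m - x n) * (x m - x n))) < e"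
  shows "\<exists>\<xi>\<in>vecs. (\<lambda>n. sqrt (norm (star (x n - \<xi>) * (x n - \<xi>)))) \<longlonglongrightarrow> 0"
proof -
  have [simp]: "sqrt (norm (star u * u)) = norm u" for u :: 'a
    by (simp add: cstar_identity)
  have "Cauchy x"
    using cauchy by (intro CauchyI) simp
  then obtain \<xi> where \<xi>: "x \<longlonglongrightarrow> \<xi>"
    by (auto simp: Cauchy_convergent_iff convergent_def)
  have "\<xi> \<in> vecs"
    by (rule closed_sequentially[OF closed_vecs _ \<xi>]) (rule x)
  moreover have "(\<lambda>n. sqrt (norm (star (x n - \<xi>) * (x n - \<xi>)))) \<longlonglongrightarrow> 0"
    using tendsto_norm_zero[OF LIM_zero[OF \<xi>]] by simp
  ultimately show ?thesis
    by (rule bexI[rotated])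
qed

lemma cstar_correspondence_E: "cstar_correspondence E"
  unfolding cstar_correspondence_def Let_def vectors_E E_simps
  apply (intro conjI)
                      apply (rule cstar_subalgebra_homog_0)
                     apply (rule one_homog)
                    apply (rule csubspace_vecs)
                   apply (intro ballI vecs_right; assumption)
                  apply (intro ballI distrib_right)
                 apply (intro ballI conjI distrib_left mult.assoc[symmetric])
                apply (intro allI ballI conjI scaleC_mult_left scaleC_mult_right)
               apply (intro ballI mult_1_right)
              apply (intro ballI conjI vecs_inner; (assumption | simp add: star_mult star_star))
             apply (intro ballI distrib_left)
            apply (intro allI ballI scaleC_mult_right)
           apply (intro ballI mult.assoc[symmetric])
          apply (intro ballI vecs_inner_self; assumption)
         apply (simp add: star_mult_self_eq_0)
        apply (intro allI impI vecs_complete; blast)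
       apply (intro ballI vecs_left; assumption)
      apply (simp add: star_mult star_star mult.assoc)
     apply (intro ballI conjI distrib_right mult.assoc)
    apply (intro allI ballI scaleC_mult_left)
   apply (intro ballI mult_1_left)
  done

lemma is_frame_E: "is_frame E [star \<nu>]"
  unfolding is_frame_def vectors_E E_simps using star_\<nu>_vecs by (simp add: star_star isometry_left)

lemma compatible_rep_E:
  assumes "A \<subseteq> B"
  shows "compatible_rep E [star \<nu>] B (\<lambda>a. a) (\<lambda>\<xi>. \<xi>)"
  unfolding compatible_rep_def vectors_E E_simps
  using assms vecs_subset by (auto simp: homog_def star_hom_on_def star_star isometry)

text \<open>Decoding writes a homogeneous element as a product of powers of
  \<open>star \<nu>\<close> and \<open>\<nu>\<close> with an element of degree 0; polynomials and
  then limits follow.\<close>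

lemma generated_E: "cstar_generated (homog 0 \<union> vecs) = A"
proof
  show "cstar_generated (homog 0 \<union> vecs) \<subseteq> A"
    using vecs_subset by (intro cstar_generated_subset(2)[OF A]) (auto simp: homog_def)
  let ?G = "cstar_generated (homog 0 \<union> vecs)"
  have G: "csubspace ?G" "\<And>x y. x \<in> ?G \<Longrightarrow> y \<in> ?G \<Longrightarrow> x * y \<in> ?G" "\<And>x. x \<in> ?G \<Longrightarrow> star x \<in> ?G"
    "closed ?G"
    using cstar_subalgebra_generated[of "homog 0 \<union> vecs"]
    by (auto simp: cstar_subalgebra_def star_subalgebra_def)
  have gen: "x \<in> ?G" if "x \<in> homog 0 \<or> x \<in> vecs" for x
    using cstar_generated_subset(1)[of "homog 0 \<union> vecs"] that by blast
  have "star (star \<nu>) \<in> ?G"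
    by (intro G(3) gen disjI2 star_\<nu>_vecs)
  then have \<nu>: "\<nu> \<in> ?G"
    by (simp only: star_star)
  have pow: "\<nu> ^ n \<in> ?G" for n
  proof (induction n)
    case (Suc n)
    then show ?case
      unfolding power_Suc by (rule G(2)[OF \<nu>])
  qed (simp add: gen one_homog)
  have homog: "x \<in> ?G" if x: "x \<in> homog k" for x k
  proof -
    define n p where "n = nat (- k)" and "p = nat k"
    have "\<nu> ^ n * x * star (\<nu> ^ p) \<in> homog 0"
      by (rule shift_homog[OF x]) (simp add: n_def p_def)
    then have "star (\<nu> ^ n) * (\<nu> ^ n * x * star (\<nu> ^ p)) * \<nu> ^ p \<in> ?G"
      by (intro G(2) G(3) pow gen disjI1)
    also have "star (\<nu> ^ n) * (\<nu> ^ n * x * star (\<nu> ^ p)) * \<nu> ^ p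
        = (star (\<nu> ^ n) * \<nu> ^ n) * x * (star (\<nu> ^ p) * \<nu> ^ p)"
      by (simp only: mult.assoc)
    finally show ?thesis
      by (simp only: \<nu>_power_isometry mult_1_left mult_1_right)
  qed
  have "polys \<subseteq> ?G"
  proof
    fix x assume "x \<in> polys"
    then obtain n where x: "x \<in> A" "x = (\<Sum>k\<in>{- int n..int n}. component k x)"
      unfolding polys_def poly_deg_def by blast
    have "(\<Sum>k\<in>{- int n..int n}. component k x) \<in> ?G"
      by (intro complex_vector.subspace_sum[OF G(1)] homog[OF component_homog[OF x(1)]])
    then show "x \<in> ?G"
      by (subst x(2))
  qed
  then have "closure polys \<subseteq> ?G"
    by (rule closure_minimal[OF _ G(4)])
  then show "A \<subseteq> ?G"
    by (simp only: closure_polys)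
qed

lemma hom_eq_on_generators:
  assumes f: "star_hom_on A f" and g: "star_hom_on A g"
    and eq: "\<And>a. a \<in> homog 0 \<Longrightarrow> f a = g a" "\<And>\<xi>. \<xi> \<in> vecs \<Longrightarrow> f \<xi> = g \<xi>"
    and x: "x \<in> A"
  shows "f x = g x"
proof -
  have "homog 0 \<union> vecs \<subseteq> {x\<in>A. f x = g x}"
    using eq vecs_subset by (auto simp: homog_def)
  from cstar_generated_subset(2)[OF cstar_subalgebra_equalizer[OF A local_unit_one[OF one_A] f g] this]
  show ?thesis
    using x unfolding generated_E by blast
qed

text \<open>The frame is \<open>star \<nu>\<close> alone, so \<open>s\<close> is determined by
  \<open>w = s (star \<nu>)\<close>. The frame identity gives \<open>w * star w = \<rho> 1\<close>;
  the inner product and the left action together give covariance.\<close>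

lemma compatible_rep_extends:
  assumes "compatible_rep E [star \<nu>] (UNIV :: 'b::cstar_algebra set) \<rho> s"
  obtains g where "star_hom_on A g" "\<And>a. a \<in> homog 0 \<Longrightarrow> g a = \<rho> a" "\<And>\<xi>. \<xi> \<in> vecs \<Longrightarrow> g \<xi> = s \<xi>"
proof -
  have \<rho>: "star_hom_on (homog 0) \<rho>"
    and inner: "\<And>\<xi> \<eta>. \<xi> \<in> vecs \<Longrightarrow> \<eta> \<in> vecs \<Longrightarrow> star (s \<xi>) * s \<eta> = \<rho> (star \<xi> * \<eta>)"
    and left: "\<And>a \<xi>. a \<in> homog 0 \<Longrightarrow> \<xi> \<in> vecs \<Longrightarrow> \<rho> a * s \<xi> = s (a * \<xi>)"
    and frame: "s (star \<nu>) * star (s (star \<nu>)) = \<rho> 1"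
    using assms unfolding compatible_rep_def vectors_E E_simps by simp_all
  interpret corner_rep \<gamma> A \<nu> \<rho> "s (star \<nu>)"
  proof
    fix a assume a: "a \<in> homog 0"
    have "star (s (star \<nu>)) * \<rho> a * s (star \<nu>) = star (s (star \<nu>)) * s (a * star \<nu>)"
      by (simp only: mult.assoc left[OF a star_\<nu>_vecs])
    also have "\<dots> = \<rho> (\<nu> * a * star \<nu>)"
      by (simp only: inner[OF star_\<nu>_vecs vecs_left[OF a star_\<nu>_vecs]] star_star mult.assoc)
    finally show "star (s (star \<nu>)) * \<rho> a * s (star \<nu>) = \<rho> (\<nu> * a * star \<nu>)" .
  qed (rule \<rho> frame)+
  obtain g where g: "star_hom_on A g" "\<And>a. a \<in> homog 0 \<Longrightarrow> g a = \<rho> a" "g (star \<nu>) = s (star \<nu>)"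
    using extension by metis
  have "g \<xi> = s \<xi>" if \<xi>: "\<xi> \<in> vecs" for \<xi>
  proof -
    have \<nu>\<xi>: "\<nu> * \<xi> \<in> homog 0"
      using \<xi> by (simp add: vecs_def)
    \<comment> \<open>A vector is \<open>star \<nu>\<close> times an element of degree 0, and
      \<open>g\<close> is known on both factors.\<close>
    have "g \<xi> = g (star \<nu> * (\<nu> * \<xi>))"
      by (simp only: isometry_left)
    also have "\<dots> = g (star \<nu>) * g (\<nu> * \<xi>)"
      by (rule star_hom_onD(2)[OF g(1)]) (use \<nu>\<xi> A_closed(3)[OF \<nu>_A] in \<open>simp_all add: homog_def\<close>)
    also have "\<dots> = s (star \<nu>) * \<rho> (star (star \<nu>) * \<xi>)"
      by (simp only: g(2)[OF \<nu>\<xi>] g(3) star_star)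
    also have "\<dots> = s (star \<nu>) * star (s (star \<nu>)) * s \<xi>"
      by (simp only: inner[OF star_\<nu>_vecs \<xi>] mult.assoc)
    also have "\<dots> = s \<xi>"
      by (simp only: frame left[OF one_homog \<xi>] mult_1_left)
    finally show ?thesis .
  qed
  with g(1,2) show ?thesis
    by (rule that)
qed

theorem pimsner_algebra_E:
  "pimsner_algebra TYPE('b::cstar_algebra) E [star \<nu>] A (\<lambda>a. a) (\<lambda>\<xi>. \<xi>)"
  unfolding pimsner_algebra_def vectors_E E_simps image_ident
proof (intro conjI cstar_correspondence_E is_frame_E A compatible_rep_E order_refl generated_E allI impI)
  fix \<rho> :: "'a \<Rightarrow> 'b" and s
  assume "compatible_rep E [star \<nu>] UNIV \<rho> s"
  then obtain g where g: "star_hom_on A g" "\<And>a. a \<in> homog 0 \<Longrightarrow> g a = \<rho> a" "\<And>\<xi>. \<xi> \<in> vecs \<Longrightarrow> g \<xi> = s \<xi>"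
    by (rule compatible_rep_extends) (rule that)
  show "\<exists>!\<phi>. \<phi> \<in> extensional A \<and> star_hom_on A \<phi> \<and> (\<forall>a\<in>homog 0. \<phi> a = \<rho> a) \<and> (\<forall>\<xi>\<in>vecs. \<phi> \<xi> = s \<xi>)"
  proof (rule ex1I)
    \<comment> \<open>Uniqueness is stated among extensional functions, so \<open>g\<close> is cut
      off outside \<open>A\<close>.\<close>
    have "star_hom_on A (restrict g A)"
      using g(1) A_closed complex_vector.subspace_add[OF A_closed(1)]
        complex_vector.subspace_scale[OF A_closed(1)] by (simp add: star_hom_on_def)
    then show "restrict g A \<in> extensional A \<and> star_hom_on A (restrict g A)
        \<and> (\<forall>a\<in>homog 0. restrict g A a = \<rho> a) \<and> (\<forall>\<xi>\<in>vecs. restrict g A \<xi> = s \<xi>)"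
      using g vecs_subset by (simp add: homog_def)
  next
    fix \<phi> assume \<phi>: "\<phi> \<in> extensional A \<and> star_hom_on A \<phi> \<and> (\<forall>a\<in>homog 0. \<phi> a = \<rho> a) \<and> (\<forall>\<xi>\<in>vecs. \<phi> \<xi> = s \<xi>)"
    show "\<phi> = restrict g A"
    proof (rule extensionalityI)
      show "\<phi> \<in> extensional A" "restrict g A \<in> extensional A"
        using \<phi> by simp_all
      fix x assume x: "x \<in> A"
      have "\<phi> x = g x"
        by (rule hom_eq_on_generators[OF _ g(1) _ _ x]) (use \<phi> g in simp_all)
      then show "\<phi> x = restrict g A x"
        using x by simp
    qed
  qed
qed

text \<open>The universal property of \<open>P\<close>, applied to the identity representation,
  gives a map from \<open>P\<close> to \<open>A\<close>; the converse map comes from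
  \<open>compatible_rep_extends\<close>. They are mutually inverse on generators, and continuity on
  \<open>P\<close> is obtained by showing that \<open>\<pi> 1\<close> is a unit of it.\<close>

theorem pimsner_algebra_isomorphic:
  fixes P :: "'p::cstar_algebra set"
  assumes "pimsner_algebra TYPE('a) E [star \<nu>] P \<pi> t"
  shows "cstar_isomorphic A P"
proof -
  have P: "cstar_subalgebra P" and rep: "compatible_rep E [star \<nu>] P \<pi> t"
    and gen: "cstar_generated (\<pi> ` homog 0 \<union> t ` vecs) = P"
    and univ: "\<exists>!\<phi>. \<phi> \<in> extensional P \<and> star_hom_on P \<phi> \<and> (\<forall>a\<in>homog 0. \<phi> (\<pi> a) = a)
      \<and> (\<forall>\<xi>\<in>vecs. \<phi> (t \<xi>) = \<xi>)"
    using assms compatible_rep_E[of UNIV] unfolding pimsner_algebra_def vectors_E E_simps by blast+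
  obtain \<phi> where \<phi>: "star_hom_on P \<phi>" "\<And>a. a \<in> homog 0 \<Longrightarrow> \<phi> (\<pi> a) = a" "\<And>\<xi>. \<xi> \<in> vecs \<Longrightarrow> \<phi> (t \<xi>) = \<xi>"
    using univ by blast
  have \<pi>: "star_hom_on (homog 0) \<pi>" and \<pi>P: "\<And>a. a \<in> homog 0 \<Longrightarrow> \<pi> a \<in> P" and tP: "\<And>\<xi>. \<xi> \<in> vecs \<Longrightarrow> t \<xi> \<in> P"
    and inner: "\<And>\<xi> \<eta>. \<xi> \<in> vecs \<Longrightarrow> \<eta> \<in> vecs \<Longrightarrow> star (t \<xi>) * t \<eta> = \<pi> (star \<xi> * \<eta>)"
    and left: "\<And>a \<xi>. a \<in> homog 0 \<Longrightarrow> \<xi> \<in> vecs \<Longrightarrow> \<pi> a * t \<xi> = t (a * \<xi>)"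
    using rep unfolding compatible_rep_def vectors_E E_simps by auto
  have "compatible_rep E [star \<nu>] UNIV \<pi> t"
    using rep by (simp add: compatible_rep_def)
  then obtain \<psi> where \<psi>: "star_hom_on A \<psi>" "\<And>a. a \<in> homog 0 \<Longrightarrow> \<psi> a = \<pi> a" "\<And>\<xi>. \<xi> \<in> vecs \<Longrightarrow> \<psi> \<xi> = t \<xi>"
    by (rule compatible_rep_extends) (rule that)
  have \<pi>1: "\<pi> 1 * \<pi> a = \<pi> a" "\<pi> a * \<pi> 1 = \<pi> a" if "a \<in> homog 0" for a
    using star_hom_onD(2)[OF \<pi> one_homog that] star_hom_onD(2)[OF \<pi> that one_homog] by simp_all
  have star_\<pi>1: "star (\<pi> 1) = \<pi> 1"
    using star_hom_onD(4)[OF \<pi> one_homog] by simp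
  \<comment> \<open>The four terms of \<open>star u * u\<close> all reduce to
    \<open>\<pi> (star \<xi> * \<xi>)\<close> and cancel, so the C*-identity applies.\<close>
  have t1: "t \<xi> * \<pi> 1 = t \<xi>" if \<xi>: "\<xi> \<in> vecs" for \<xi>
  proof -
    define u where "u = t \<xi> * \<pi> 1 - t \<xi>"
    have "star u * u = \<pi> 1 * (star (t \<xi>) * t \<xi>) * \<pi> 1 - \<pi> 1 * (star (t \<xi>) * t \<xi>)
        - (star (t \<xi>) * t \<xi>) * \<pi> 1 + star (t \<xi>) * t \<xi>"
      by (simp add: u_def star_diff star_mult star_\<pi>1 algebra_simps)
    also have "\<dots> = 0"
      by (simp add: inner[OF \<xi> \<xi>] \<pi>1[OF vecs_inner[OF \<xi> \<xi>]])
    finally show ?thesis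
      by (simp add: star_mult_self_eq_0 u_def)
  qed
  have unit: "local_unit (\<pi> 1) P"
  proof (rule local_unit_generated[OF P gen \<pi>P[OF one_homog] star_\<pi>1])
    fix x assume "x \<in> \<pi> ` homog 0 \<union> t ` vecs"
    then show "\<pi> 1 * x = x \<and> x * \<pi> 1 = x"
      using \<pi>1 t1 left[OF one_homog] by auto
  qed
  have \<psi>P: "\<psi> x \<in> P" if x: "x \<in> A" for x
  proof -
    have "homog 0 \<union> vecs \<subseteq> {x\<in>A. \<psi> x \<in> P}"
      using \<psi>(2,3) \<pi>P tP vecs_subset by (auto simp: homog_def)
    from cstar_generated_subset(2)[OF cstar_subalgebra_vimage[OF A local_unit_one[OF one_A] \<psi>(1) P] this]
    show ?thesis
      using x unfolding generated_E by blast
  qed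
  have \<phi>A: "\<phi> x \<in> A" if x: "x \<in> P" for x
  proof -
    have "\<pi> ` homog 0 \<union> t ` vecs \<subseteq> {x\<in>P. \<phi> x \<in> A}"
      using \<phi>(2,3) \<pi>P tP vecs_subset by (auto simp: homog_def)
    from cstar_generated_subset(2)[OF cstar_subalgebra_vimage[OF P unit \<phi>(1) A] this]
    show ?thesis
      using x unfolding gen by blast
  qed
  have "\<phi> (\<psi> x) = x" if x: "x \<in> A" for x
  proof (rule hom_eq_on_generators[OF _ _ _ _ x])
    show "star_hom_on A (\<lambda>x. \<phi> (\<psi> x))" "star_hom_on A (\<lambda>x. x)"
      by (simp_all add: star_hom_on_def star_hom_onD[OF \<psi>(1)] star_hom_onD[OF \<phi>(1)] \<psi>P)
  qed (simp_all add: \<phi> \<psi>)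
  moreover have "\<psi> (\<phi> x) = x" if x: "x \<in> P" for x
  proof -
    have hom: "star_hom_on P (\<lambda>x. \<psi> (\<phi> x))" "star_hom_on P (\<lambda>x. x)"
      by (simp_all add: star_hom_on_def star_hom_onD[OF \<psi>(1)] star_hom_onD[OF \<phi>(1)] \<phi>A)
    have "\<pi> ` homog 0 \<union> t ` vecs \<subseteq> {x\<in>P. \<psi> (\<phi> x) = x}"
      using \<pi>P tP by (auto simp: \<phi> \<psi>)
    from cstar_generated_subset(2)[OF cstar_subalgebra_equalizer[OF P unit hom] this]
    show ?thesis
      using x unfolding gen by blast
  qed
  ultimately have "bij_betw \<psi> A P"
    using \<psi>P \<phi>A by (intro bij_betw_byWitness[where f' = \<phi>]) auto
  with \<psi>(1) show ?thesis
    unfolding cstar_isomorphic_def by (intro exI conjI)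
qed

end

text \<open>Types cannot be quantified inside a formula, so the universal property is stated for an
  arbitrary type \<open>'b\<close>. The second clause adds that any algebra with this property for
  the Cuntz algebra as target is isomorphic to the fixed algebra.\<close>

theorem proposition4p7:
  fixes tens :: "'g::unital_cstar_algebra \<Rightarrow> 'g \<Rightarrow> 'gg::unital_cstar_algebra"
    and tensL :: "'gg \<Rightarrow> 'g \<Rightarrow> 'ggg::unital_cstar_algebra"
    and tensR :: "'g \<Rightarrow> 'gg \<Rightarrow> 'ggg"
    and \<Delta> :: "'g \<Rightarrow> 'gg"
    and \<alpha> :: "nat \<Rightarrow> nat \<Rightarrow> 'g"
    and S :: "nat \<Rightarrow> 'o::unital_cstar_algebra"
    and tensO :: "'o \<Rightarrow> 'g \<Rightarrow> 'og::unital_cstar_algebra"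
    and d N :: nat
  defines "O\<alpha> \<equiv> fixed_algebra tensO d S \<alpha>"
    and "F\<alpha> \<equiv> gauge_fixed_algebra tensO d S \<alpha>"
  assumes "compact_quantum_group tens tensL tensR \<Delta>"
    and "unitary_rep tens \<Delta> {..<d} \<alpha>"
    and "contained_in (words d N) (rep_power \<alpha>) (words d (N + 1)) (rep_power \<alpha>)"
    and "cuntz_algebra TYPE('o) d S"
    and "cuntz_algebra TYPE('og) d S"
    and "min_tensor_product tensO"
  shows "(\<exists>\<nu> \<in> cuntz_bimodule d S (N + 1) N \<inter> O\<alpha>. star \<nu> * \<nu> = 1) \<and>
    (\<forall>\<nu> \<in> cuntz_bimodule d S (N + 1) N \<inter> O\<alpha>. star \<nu> * \<nu> = 1 \<longrightarrow>
       pimsner_algebra TYPE('b::cstar_algebra)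
         (isometry_correspondence F\<alpha> \<nu>) [star \<nu>] O\<alpha> (\<lambda>a. a) (\<lambda>\<xi>. \<xi>) \<and>
       (\<forall>(P :: 'p::cstar_algebra set) \<pi> t.
          pimsner_algebra TYPE('o) (isometry_correspondence F\<alpha> \<nu>) [star \<nu>] P \<pi> t \<longrightarrow>
          cstar_isomorphic O\<alpha> P))"
proof -
  interpret cuntz_coaction tensO S \<alpha> d
  proof
    show "(\<Sum>k<d. star (\<alpha> k i) * \<alpha> k j) = (if i = j then 1 else 0)"
      "(\<Sum>k<d. \<alpha> i k * star (\<alpha> j k)) = (if i = j then 1 else 0)" if "i < d" "j < d" for i j
      using assms(4) that by (simp_all add: unitary_rep_def)
  qed (rule assms)+
  show ?thesis
  proof (rule conjI[OF _ ballI[OF impI]])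
    show "\<exists>\<nu>\<in>cuntz_bimodule d S (N + 1) N \<inter> O\<alpha>. star \<nu> * \<nu> = 1"
      unfolding O\<alpha>_def by (rule ex_isometry[OF assms(5)])
  next
    fix \<nu> assume \<nu>: "\<nu> \<in> cuntz_bimodule d S (N + 1) N \<inter> O\<alpha>" "star \<nu> * \<nu> = 1"
    interpret graded_isometry "gauge_action d S" O\<alpha> \<nu>
    proof
      show "cstar_subalgebra O\<alpha>" "1 \<in> O\<alpha>"
        unfolding O\<alpha>_def by (rule cstar_subalgebra_fixed one_fixed)+
      show "gauge_action d S z x \<in> O\<alpha>" if "cmod z = 1" "x \<in> O\<alpha>" for z x
        using gauge_fixed that unfolding O\<alpha>_def by blast
      \<comment> \<open>The degree of \<open>\<nu>\<close> is \<open>N + 1 - N = 1\<close>.\<close>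
      show "\<nu> \<in> O\<alpha>" "\<nu> \<in> spectral 1" "star \<nu> * \<nu> = 1"
        using \<nu> bimodule_spectral[of "N + 1" N] by auto
    qed
    have F: "F\<alpha> = homog 0"
      unfolding F\<alpha>_def gauge_fixed_algebra_def homog_def spectral_def O\<alpha>_def[symmetric]
      by (auto simp: scaleC_one)
    show "pimsner_algebra TYPE('b) (isometry_correspondence F\<alpha> \<nu>) [star \<nu>] O\<alpha> (\<lambda>a. a) (\<lambda>\<xi>. \<xi>) \<and>
       (\<forall>(P :: 'p set) \<pi> t.
          pimsner_algebra TYPE('o) (isometry_correspondence F\<alpha> \<nu>) [star \<nu>] P \<pi> t \<longrightarrow>
          cstar_isomorphic O\<alpha> P)"
      unfolding F using pimsner_algebra_E pimsner_algebra_isomorphic by blast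
  qed
qed

end
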